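(* Let $(z_R,z_B)$ be the unique pair with $0<z_R<\hat z$, $z_B>z_R$ and $\phi_1(z_R,z_B)=\phi_2(z_R,z_B)=0$, and let $\mathcal{Q}:(0,\infty)\to\mathbb{R}$ be the function defined in the context. (a) $\mathcal{Q}$ satisfies, for all $z>0$, the Hamilton–Jacobi–Bellman quasi-variational inequality $$\max\Big\{\min\Big\{\mathcal{L}\mathcal{Q}(z)+\big(\tilde u(\tfrac{z}{\kappa_1})+\epsilon_1z\big)\mathbf 1_{\{z>z_S\}}+\big(\tilde u(\tfrac{z}{\kappa_2})+\epsilon_2z\big)\mathbf 1_{\{z\le z_S\}},\,-\mathcal{Q}'(z)\Big\},\,J_R(z)-\mathcal{Q}(z)\Big\}=0,$$ where $\mathcal{L}=\frac{\theta^2}{2}z^2\frac{d^2}{dz^2}+(\delta-r)z\frac{d}{dz}-\delta$ (at $z=z_R$, $\mathcal{Q}''$ is the left-hand second derivative). Moreover $\mathcal{Q}$ is continuously differentiable on $(0,\infty)$ and twice continuously differentiable on $(0,\infty)\setminus\{z_R\}$. (b) $\{z>0\mid\mathcal{Q}(z)=J_R(z)\}=\{z>0\mid z\le z_R\}$, $\{z>0\mid\mathcal{Q}(z)>J_R(z)\}=\{z>0\mid z>z_R\}$, $\{z>0\mid\mathcal{Q}'(z)=0\}=\{z>0\mid z\ge z_B\}$, and $\{z>0\mid\mathcal{Q}'(z)<0\}=\{z>0\mid 0<z<z_B\}$. (c) $\mathcal{Q}$ is strictly convex on $(0,z_B)$. (d) $\lim_{z\to z_B-}\mathcal{Q}'(z)=0$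 and $\lim_{z\to0+}\mathcal{Q}'(z)=-\infty$.
   Context: Constants: $\delta>0$, $r>0$, $\mu>r$, $\sigma>0$, $\theta=(\mu-r)/\sigma$, $0<\epsilon_2<\epsilon_1$, $0<\kappa_1<\kappa_2<1$. Let $n_1>0>n_2$ be the two roots of $\frac{\theta^2}{2}n^2+(\delta-r-\frac{\theta^2}{2})n-\delta=0$. Utility: $u:[0,\infty)\to\mathbb{R}$ is strictly increasing, strictly concave, continuous, continuously differentiable on $(0,\infty)$, with $\lim_{c\to\infty}u'(c)=0$; write $u'(0)=\lim_{c\downarrow0}u'(c)\in(0,\infty]$. $I:(0,u'(0))\to(0,\infty)$ is the inverse of $u'$, extended by $I(y)=0$ for $y\ge u'(0)$. Assume $\int_0^y\eta^{-n_2}I(\eta)\,d\eta<\infty$ for all $y>0$. Let $\tilde u(y)=\sup_{c\ge0}(u(c)-yc)$. Auxiliary functions: $z_S>0$ is the unique zero on $(0,\infty)$ of $f(y)=\frac1y\big(\tilde u(\frac{y}{\kappa_1})-\tilde u(\frac{y}{\kappa_2})+y(\epsilon_1-\epsilon_2)\big)$. Define $h(z)=\big(\tilde u(\frac{z}{\kappa_1})-\tilde u(z)+\epsilon_1z\big)\mathbf 1_{\{z>z_S\}}+\big(\tilde u(\frac{z}{\kappa_2})-\tilde u(z)+\epsilon_2z\big)\mathbf 1_{\{z\le z_S\}}$, and let $\hat z>0$ be its unique zero on $(0,\infty)$. Define $\hat c(z)=\frac1{\kappa_1}I(\frac z{\kappa_1})\mathbf 1_{\{z>z_S\}}+\frac1{\kappa_2}I(\frac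 z{\kappa_2})\mathbf 1_{\{z\le z_S\}}$, $\hat\epsilon(z)=\epsilon_1\mathbf 1_{\{z>z_S\}}+\epsilon_2\mathbf 1_{\{z\le z_S\}}$, and $$\phi_1(z_1,z_2)=\int_{z_2}^\infty\eta^{-n_1}(\hat\epsilon(\eta)-\hat c(\eta))d\eta-n_1\int_{z_1}^\infty\eta^{-n_1-1}h(\eta)d\eta,$$ $$\phi_2(z_1,z_2)=\int_0^{z_2}\eta^{-n_2}(\hat\epsilon(\eta)-\hat c(\eta))d\eta-n_2\int_0^{z_1}\eta^{-n_2-1}h(\eta)d\eta.$$ $J_R(y)=\frac{2}{\theta^2(n_1-n_2)}\big[y^{n_2}\int_0^y\eta^{-n_2-1}\tilde u(\eta)d\eta+y^{n_1}\int_y^\infty\eta^{-n_1-1}\tilde u(\eta)d\eta\big]$ and $\Psi_h(z)=\frac{2}{\theta^2(n_1-n_2)}\big[z^{n_2}\int_0^z\eta^{-n_2-1}h(\eta)d\eta+z^{n_1}\int_z^\infty\eta^{-n_1-1}h(\eta)d\eta\big]$. With $E_1=-\frac{2}{\theta^2(n_1-n_2)}\int_{z_R}^\infty\eta^{-n_1-1}h(\eta)d\eta$ and $E_2=-\frac{2}{\theta^2(n_1-n_2)}\int_0^{z_R}\eta^{-n_2-1}h(\eta)d\eta$, define $\mathcal{Q}(z)=J_R(z)$ for $0<z\le z_R$; $\mathcal{Q}(z)=E_1z^{n_1}+E_2z^{n_2}+\Psi_h(z)+J_R(z)$ for $z_R\le z\le z_B$; $\mathcal{Q}(z)=E_1z_B^{n_1}+E_2z_B^{n_2}+\Psi_h(z_B)+J_R(z_B)$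 for $z\ge z_B$. *)

theory Defs
  imports "HOL-Analysis.Analysis"
begin

definition strictly_convex_on :: "'a::real_vector set \<Rightarrow> ('a \<Rightarrow> real) \<Rightarrow> bool" where
  "strictly_convex_on S f \<longleftrightarrow> convex S \<and>
     (\<forall>x\<in>S. \<forall>y\<in>S. \<forall>t. x \<noteq> y \<and> 0 < t \<and> t < 1 \<longrightarrow>
        f ((1 - t) *\<^sub>R x + t *\<^sub>R y) < (1 - t) * f x + t * f y)"

definition strictly_concave_on :: "'a::real_vector set \<Rightarrow> ('a \<Rightarrow> real) \<Rightarrow> bool" where
  "strictly_concave_on S f \<longleftrightarrow> strictly_convex_on S (\<lambda>x. - f x)"

text \<open>Only the values of a utility function on \<open>[0, \<infinity>)\<close> are meaningful.\<close>

definition utility :: "(real \<Rightarrow> real) \<Rightarrow> bool" where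
  "utility u \<longleftrightarrow>
     strict_mono_on {0..} u \<and> strictly_concave_on {0..} u \<and> continuous_on {0..} u \<and>
     u C1_differentiable_on {0<..} \<and> (deriv u \<longlongrightarrow> 0) at_top"

text \<open>The limit \<open>u'(0)\<close> of \<open>u'(c)\<close> as \<open>c\<close> decreases to 0 may be \<open>\<infinity>\<close>; it exists in
  \<open>ereal\<close> because \<open>u'\<close> is decreasing on \<open>(0, \<infinity>)\<close>.\<close>

definition marginal_at_0 :: "(real \<Rightarrow> real) \<Rightarrow> ereal" where
  "marginal_at_0 u = Lim (at_right 0) (\<lambda>c. ereal (deriv u c))"

text \<open>The function \<open>I\<close>, meaningful for \<open>y > 0\<close>.\<close>

definition inv_marginal :: "(real \<Rightarrow> real) \<Rightarrow> real \<Rightarrow> real" where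
  "inv_marginal u y =
     (if ereal y < marginal_at_0 u then the_inv_into {0<..} (deriv u) y else 0)"

text \<open>The dual utility of \<open>u\<close>; the supremum is finite for \<open>y > 0\<close>.\<close>

definition dual_utility :: "(real \<Rightarrow> real) \<Rightarrow> real \<Rightarrow> real" where
  "dual_utility u y = (SUP c\<in>{0..}. u c - y * c)"

text \<open>The function \<open>f\<close> whose zero is \<open>z\<^sub>S\<close>.\<close>

definition switch_fun ::
    "(real \<Rightarrow> real) \<Rightarrow> real \<Rightarrow> real \<Rightarrow> real \<Rightarrow> real \<Rightarrow> real \<Rightarrow> real" where
  "switch_fun u \<kappa>\<^sub>1 \<kappa>\<^sub>2 \<epsilon>\<^sub>1 \<epsilon>\<^sub>2 y =
     1 / y * (dual_utility u (y / \<kappa>\<^sub>1) - dual_utility u (y / \<kappa>\<^sub>2) + y * (\<epsilon>\<^sub>1 - \<epsilon>\<^sub>2))"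

definition h_fun ::
    "(real \<Rightarrow> real) \<Rightarrow> real \<Rightarrow> real \<Rightarrow> real \<Rightarrow> real \<Rightarrow> real \<Rightarrow> real \<Rightarrow> real" where
  "h_fun u \<kappa>\<^sub>1 \<kappa>\<^sub>2 \<epsilon>\<^sub>1 \<epsilon>\<^sub>2 z\<^sub>S z =
     (if z > z\<^sub>S then dual_utility u (z / \<kappa>\<^sub>1) - dual_utility u z + \<epsilon>\<^sub>1 * z
      else dual_utility u (z / \<kappa>\<^sub>2) - dual_utility u z + \<epsilon>\<^sub>2 * z)"

definition c_hat :: "(real \<Rightarrow> real) \<Rightarrow> real \<Rightarrow> real \<Rightarrow> real \<Rightarrow> real \<Rightarrow> real" where
  "c_hat u \<kappa>\<^sub>1 \<kappa>\<^sub>2 z\<^sub>S z =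
     (if z > z\<^sub>S then 1 / \<kappa>\<^sub>1 * inv_marginal u (z / \<kappa>\<^sub>1)
      else 1 / \<kappa>\<^sub>2 * inv_marginal u (z / \<kappa>\<^sub>2))"

definition eps_hat :: "real \<Rightarrow> real \<Rightarrow> real \<Rightarrow> real \<Rightarrow> real" where
  "eps_hat \<epsilon>\<^sub>1 \<epsilon>\<^sub>2 z\<^sub>S z = (if z > z\<^sub>S then \<epsilon>\<^sub>1 else \<epsilon>\<^sub>2)"

text \<open>In \<open>phi1\<close> and \<open>phi2\<close> the arguments \<open>h\<close>, \<open>c\<close> and \<open>e\<close> stand for \<open>h_fun\<close>, \<open>c_hat\<close>
  and \<open>eps_hat\<close>, with their parameters supplied.\<close>

definition phi1 ::
    "real \<Rightarrow> (real \<Rightarrow> real) \<Rightarrow> (real \<Rightarrow> real) \<Rightarrow> (real \<Rightarrow> real) \<Rightarrow> real \<Rightarrow> real \<Rightarrow> real" where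
  "phi1 n\<^sub>1 h c e z\<^sub>1 z\<^sub>2 =
     (LINT \<eta>:{z\<^sub>2<..}|lborel. \<eta> powr (- n\<^sub>1) * (e \<eta> - c \<eta>))
     - n\<^sub>1 * (LINT \<eta>:{z\<^sub>1<..}|lborel. \<eta> powr (- n\<^sub>1 - 1) * h \<eta>)"

definition phi2 ::
    "real \<Rightarrow> (real \<Rightarrow> real) \<Rightarrow> (real \<Rightarrow> real) \<Rightarrow> (real \<Rightarrow> real) \<Rightarrow> real \<Rightarrow> real \<Rightarrow> real" where
  "phi2 n\<^sub>2 h c e z\<^sub>1 z\<^sub>2 =
     (LINT \<eta>:{0<..z\<^sub>2}|lborel. \<eta> powr (- n\<^sub>2) * (e \<eta> - c \<eta>))
     - n\<^sub>2 * (LINT \<eta>:{0<..z\<^sub>1}|lborel. \<eta> powr (- n\<^sub>2 - 1) * h \<eta>)"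

text \<open>The common form of \<open>J\<^sub>R\<close> (with \<open>F\<close> the dual utility) and \<open>\<Psi>\<^sub>h\<close> (with \<open>F = h\<close>).\<close>

definition green_potential ::
    "real \<Rightarrow> real \<Rightarrow> real \<Rightarrow> (real \<Rightarrow> real) \<Rightarrow> real \<Rightarrow> real" where
  "green_potential \<theta> n\<^sub>1 n\<^sub>2 F z = 2 / (\<theta>\<^sup>2 * (n\<^sub>1 - n\<^sub>2)) *
     (z powr n\<^sub>2 * (LINT \<eta>:{0<..z}|lborel. \<eta> powr (- n\<^sub>2 - 1) * F \<eta>)
      + z powr n\<^sub>1 * (LINT \<eta>:{z<..}|lborel. \<eta> powr (- n\<^sub>1 - 1) * F \<eta>))"

definition J_R :: "real \<Rightarrow> real \<Rightarrow> real \<Rightarrow> (real \<Rightarrow> real) \<Rightarrow> real \<Rightarrow> real" where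
  "J_R \<theta> n\<^sub>1 n\<^sub>2 u = green_potential \<theta> n\<^sub>1 n\<^sub>2 (dual_utility u)"

definition Psi_h :: "real \<Rightarrow> real \<Rightarrow> real \<Rightarrow> (real \<Rightarrow> real) \<Rightarrow> real \<Rightarrow> real" where
  "Psi_h \<theta> n\<^sub>1 n\<^sub>2 h = green_potential \<theta> n\<^sub>1 n\<^sub>2 h"

definition E1 :: "real \<Rightarrow> real \<Rightarrow> real \<Rightarrow> (real \<Rightarrow> real) \<Rightarrow> real \<Rightarrow> real" where
  "E1 \<theta> n\<^sub>1 n\<^sub>2 h z\<^sub>R = - (2 / (\<theta>\<^sup>2 * (n\<^sub>1 - n\<^sub>2))) *
     (LINT \<eta>:{z\<^sub>R<..}|lborel. \<eta> powr (- n\<^sub>1 - 1) * h \<eta>)"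

definition E2 :: "real \<Rightarrow> real \<Rightarrow> real \<Rightarrow> (real \<Rightarrow> real) \<Rightarrow> real \<Rightarrow> real" where
  "E2 \<theta> n\<^sub>1 n\<^sub>2 h z\<^sub>R = - (2 / (\<theta>\<^sup>2 * (n\<^sub>1 - n\<^sub>2))) *
     (LINT \<eta>:{0<..z\<^sub>R}|lborel. \<eta> powr (- n\<^sub>2 - 1) * h \<eta>)"

text \<open>The expression for \<open>\<Q>\<close> on \<open>[z\<^sub>R, z\<^sub>B]\<close>.\<close>

definition Q_mid ::
    "real \<Rightarrow> real \<Rightarrow> real \<Rightarrow> (real \<Rightarrow> real) \<Rightarrow> (real \<Rightarrow> real) \<Rightarrow> real \<Rightarrow> real \<Rightarrow> real" where
  "Q_mid \<theta> n\<^sub>1 n\<^sub>2 u h z\<^sub>R z =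
     E1 \<theta> n\<^sub>1 n\<^sub>2 h z\<^sub>R * z powr n\<^sub>1 + E2 \<theta> n\<^sub>1 n\<^sub>2 h z\<^sub>R * z powr n\<^sub>2
     + Psi_h \<theta> n\<^sub>1 n\<^sub>2 h z + J_R \<theta> n\<^sub>1 n\<^sub>2 u z"

text \<open>The pieces of \<open>\<Q>\<close> agree at \<open>z\<^sub>R\<close> and at \<open>z\<^sub>B\<close>, so the choice made at these two points
  is immaterial. Only the values for \<open>z > 0\<close> are meaningful.\<close>

definition Q_fun ::
    "real \<Rightarrow> real \<Rightarrow> real \<Rightarrow> (real \<Rightarrow> real) \<Rightarrow> (real \<Rightarrow> real) \<Rightarrow> real \<Rightarrow> real \<Rightarrow> real \<Rightarrow> real" where
  "Q_fun \<theta> n\<^sub>1 n\<^sub>2 u h z\<^sub>R z\<^sub>B z =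
     (if z \<le> z\<^sub>R then J_R \<theta> n\<^sub>1 n\<^sub>2 u z
      else if z \<le> z\<^sub>B then Q_mid \<theta> n\<^sub>1 n\<^sub>2 u h z\<^sub>R z
      else Q_mid \<theta> n\<^sub>1 n\<^sub>2 u h z\<^sub>R z\<^sub>B)"

text \<open>The second derivative, read at the exceptional point \<open>a\<close> as the left-hand derivative of
  the first derivative.\<close>

definition second_deriv_left_at :: "real \<Rightarrow> (real \<Rightarrow> real) \<Rightarrow> real \<Rightarrow> real" where
  "second_deriv_left_at a f z =
     (if z = a then vector_derivative (deriv f) (at_left z) else deriv (deriv f) z)"

text \<open>The operator \<open>\<L>\<close>, with the second derivative read as above at \<open>a\<close>.\<close>

definition L_op ::
    "real \<Rightarrow> real \<Rightarrow> real \<Rightarrow> real \<Rightarrow> (real \<Rightarrow> real) \<Rightarrow> real \<Rightarrow> real" where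
  "L_op \<theta> \<delta> r a f z =
     \<theta>\<^sup>2 / 2 * z\<^sup>2 * second_deriv_left_at a f z + (\<delta> - r) * z * deriv f z - \<delta> * f z"

end

theory Submission
  imports Defs
begin

text \<open>Write \<open>L\<close> for the Euler operator of the problem, \<open>\<theta>\<^sup>2/2 z\<^sup>2 Q'' + (\<delta> - r) z Q' - \<delta> Q\<close>, and
  \<open>ut\<close> for the dual utility. A Green potential of \<open>F\<close> solves \<open>L y = - F\<close>, so \<open>J\<^sub>R\<close> solves
  \<open>L J + ut = 0\<close>, and the function \<open>q\<close> that defines \<open>\<Q>\<close> on \<open>[z\<^sub>R, z\<^sub>B]\<close> solves \<open>L q + H = 0\<close> with
  \<open>H = ut + h\<close>. Because the two branches \<open>ut (z / \<kappa>\<^sub>i) + \<epsilon>\<^sub>i z\<close> cross only at \<open>z\<^sub>S\<close>, \<open>H\<close> is their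
  maximum (\<open>H_eq_max\<close>), and therefore convex. The constants \<open>E\<^sub>1\<close> and \<open>E\<^sub>2\<close> are chosen so that \<open>q - J\<close> vanishes
  to first order at \<open>z\<^sub>R\<close>. The integrands of \<open>\<phi>\<^sub>1\<close> and \<open>\<phi>\<^sub>2\<close> contain \<open>H'\<close>, and after integration
  by parts \<open>\<phi>\<^sub>1 = \<phi>\<^sub>2 = 0\<close> says exactly that \<open>q'\<close> and \<open>q''\<close> vanish at \<open>z\<^sub>B\<close> (\<open>phi1_eq\<close>, \<open>phi2_eq\<close>,
  \<open>at_zB\<close>). Hence \<open>\<delta> q z\<^sub>B = H z\<^sub>B\<close>, and the three pieces of \<open>\<Q>\<close> fit as smoothly as claimed.

  The core is the strict convexity of \<open>q\<close> on \<open>[z\<^sub>R, z\<^sub>B]\<close>. Since \<open>h < 0\<close> at \<open>z\<^sub>R\<close> and \<open>J'' > 0\<close>, the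
  second derivative of \<open>q\<close> starts positive. The equation reads \<open>\<theta>\<^sup>2/2 z\<^sup>2 q'' = M - H\<close> with
  \<open>M = \<delta> q - (\<delta> - r) z q'\<close>, and \<open>M' = r q'\<close> wherever \<open>q'' = 0\<close>. If \<open>q'' < 0\<close> on a maximal
  interval, \<open>M\<close> lies below the chord of the convex function \<open>H\<close> there and touches it at both ends.
  So \<open>M'\<close>, and with it \<open>q'\<close>, is at least as large at the right end as at the left end, although
  \<open>q'\<close> decreases (\<open>q2_nonneg\<close>). The same representation yields that \<open>H\<close> does not fall below \<open>H z\<^sub>B\<close>
  to the right of \<open>z\<^sub>B\<close> (\<open>H_end_le\<close>). Strictness holds because \<open>H\<close> is nowhere affine with
  nonpositive slope (\<open>H_not_affine_decreasing\<close>).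

  Strict convexity and \<open>q' z\<^sub>B = 0\<close> give the sign of \<open>\<Q>'\<close>. On \<open>(0, z\<^sub>R]\<close> the required facts
  \<open>J' < 0\<close>, \<open>J'' > 0\<close> and \<open>J' \<longrightarrow> -\<infinity>\<close> at 0 follow from integral formulas for \<open>J'\<close> and \<open>J''\<close> in
  terms of the decreasing function \<open>I = - ut'\<close>, which is unbounded at 0. Finally \<open>q - J\<close> solves
  \<open>L W = - h\<close> with zero data at \<open>z\<^sub>R\<close>. It is positive up to \<open>zhat\<close>, where \<open>h < 0\<close>, by the explicit
  solution formula, and from there to \<open>z\<^sub>B\<close> by the minimum principle, as \<open>W' = - J' > 0\<close> at \<open>z\<^sub>B\<close>.
  Each of the three regimes of the variational inequality then reduces to one sign: \<open>h < 0\<close> up to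
  \<open>z\<^sub>R\<close>, \<open>q' \<le> 0\<close> between, and \<open>H z \<ge> H z\<^sub>B\<close> beyond \<open>z\<^sub>B\<close>.\<close>

section \<open>Integrals from 0 and to infinity as functions of the endpoint\<close>

lemma set_integrable_dominated:
  fixes f g :: "real \<Rightarrow> real"
  assumes "continuous_on {0<..} f" "set_integrable lborel S g" "S \<in> sets borel" "S \<subseteq> {0<..}"
    and "\<And>x. x \<in> S \<Longrightarrow> \<bar>f x\<bar> \<le> g x"
  shows "set_integrable lborel S f"
proof (rule set_integrable_bound[OF assms(2)])
  have "(\<lambda>x. indicator S x *\<^sub>R f x) \<in> borel_measurable borel"
    using assms(3) continuous_on_subset[OF assms(1,4)]
    by (intro borel_measurable_continuous_on_indicator) auto
  then show "set_borel_measurable lborel S f"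
    by (simp add: set_borel_measurable_def)
  show "AE x in lborel. x \<in> S \<longrightarrow> norm (f x) \<le> norm (g x)"
    using assms(5) by (intro AE_I2) (metis abs_le_iff abs_of_nonneg abs_ge_zero order_trans real_norm_def)
qed

lemma set_integrable_minus:
  "set_integrable M S f \<Longrightarrow> set_integrable M S (\<lambda>x. - f x)" for f :: "_ \<Rightarrow> real"
  unfolding set_integrable_def by simp

lemma set_integrable_if:
  fixes f g :: "real \<Rightarrow> real"
  assumes f: "set_integrable lborel S f" and g: "set_integrable lborel S g" and S: "S \<in> sets borel"
  shows "set_integrable lborel S (\<lambda>x. if x > c then f x else g x)"
proof -
  let ?k = "\<lambda>x. if x > c then f x else g x"
  have "set_integrable lborel (S \<inter> {c<..}) f" "set_integrable lborel (S \<inter> {..c}) g"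
    by (rule set_integrable_subset[OF f], use S in auto)
      (rule set_integrable_subset[OF g], use S in auto)
  then have "set_integrable lborel (S \<inter> {c<..}) ?k" "set_integrable lborel (S \<inter> {..c}) ?k"
    by (subst set_integrable_cong[OF refl refl, of _ ?k]; simp)+
  then have "set_integrable lborel ((S \<inter> {c<..}) \<union> (S \<inter> {..c})) ?k"
    using S by (intro set_integrable_Un) auto
  moreover have "(S \<inter> {c<..}) \<union> (S \<inter> {..c}) = S" by auto
  ultimately show ?thesis by simp
qed

context
  fixes f :: "real \<Rightarrow> real"
  assumes int: "\<And>z. z > 0 \<Longrightarrow> set_integrable lborel {0<..z} f"
begin

lemma lower_integral_split:
  assumes "0 < a" "a \<le> z"
  shows "(LINT x:{0<..z}|lborel. f x) = (LINT x:{0<..a}|lborel. f x) + integral {a..z} f"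
    and "f integrable_on {a..z}"
proof -
  have i: "set_integrable lborel {a..z} f"
    by (rule set_integrable_subset[OF int[of z]]) (use assms in auto)
  show "f integrable_on {a..z}"
    by (rule set_borel_integral_eq_integral[OF i])
  have "{0<..z} = {0<..a} \<union> {a..z}" using assms by auto
  moreover have "(LINT x:{0<..a}\<union>{a..z}|lborel. f x) =
      (LINT x:{0<..a}|lborel. f x) + (LINT x:{a..z}|lborel. f x)"
  proof (rule set_integral_Un_AE[OF _ _ _ int[OF assms(1)] i])
    show "AE x in lborel. \<not> (x \<in> {0<..a} \<and> x \<in> {a..z})"
      using AE_lborel_singleton[of a] by eventually_elim auto
  qed auto
  ultimately show "(LINT x:{0<..z}|lborel. f x) = (LINT x:{0<..a}|lborel. f x) + integral {a..z} f"
    using set_borel_integral_eq_integral(2)[OF i] by simp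
qed

lemma lower_integral_has_deriv:
  assumes "x > 0" "isCont f x"
  shows "((\<lambda>z. LINT t:{0<..z}|lborel. f t) has_real_derivative f x) (at x)"
proof -
  let ?a = "x / 2" and ?b = "2 * x"
  have eq: "(LINT t:{0<..?a}|lborel. f t) + integral {?a..z} f = (LINT t:{0<..z}|lborel. f t)" if "?a \<le> z" for z
    using lower_integral_split(1)[of ?a z] \<open>x > 0\<close> that by simp
  have "((\<lambda>z. integral {?a..z} f) has_vector_derivative f x) (at x within ({?a..?b} - {}))"
    by (rule integral_has_vector_derivative_continuous_at)
      (use assms lower_integral_split(2)[of ?a ?b] in \<open>auto intro: continuous_at_imp_continuous_within\<close>)
  then have "((\<lambda>z. integral {?a..z} f) has_real_derivative f x) (at x)"
    using assms by (simp add: has_real_derivative_iff_has_vector_derivative at_within_Icc_at)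
  then have "((\<lambda>z. (LINT t:{0<..?a}|lborel. f t) + integral {?a..z} f) has_real_derivative f x) (at x)"
    using DERIV_add[OF DERIV_const] by fastforce
  then show ?thesis
    by (rule has_field_derivative_transform_within_open[where S = "{?a<..<?b}"])
      (use assms eq in auto)
qed

lemma lower_integral_continuous: "continuous_on {0<..} (\<lambda>z. LINT t:{0<..z}|lborel. f t)"
proof (rule continuous_at_imp_continuous_on, rule ballI)
  fix x :: real assume "x \<in> {0<..}"
  then have "x > 0" by simp
  let ?a = "x / 2" and ?b = "2 * x"
  have eq: "(LINT t:{0<..?a}|lborel. f t) + integral {?a..z} f = (LINT t:{0<..z}|lborel. f t)" if "?a \<le> z" for z
    using lower_integral_split(1)[of ?a z] \<open>x > 0\<close> that by simp
  have "continuous_on {?a..?b} (\<lambda>z. (LINT t:{0<..?a}|lborel. f t) + integral {?a..z} f)"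
    by (intro continuous_intros indefinite_integral_continuous_1 lower_integral_split(2))
      (use \<open>x > 0\<close> in auto)
  then have "continuous_on {?a..?b} (\<lambda>z. LINT t:{0<..z}|lborel. f t)"
    by (rule continuous_on_eq) (use eq in auto)
  then show "isCont (\<lambda>z. LINT t:{0<..z}|lborel. f t) x"
    using \<open>x > 0\<close> by (intro continuous_on_interior[of "{?a..?b}"]) auto
qed

lemma lower_integral_tendsto_0: "((\<lambda>z. LINT t:{0<..z}|lborel. f t) \<longlongrightarrow> 0) (at_right 0)"
proof -
  have "((\<lambda>z. (LINT t:{0<..1}|lborel. f t) - (LINT t:{z..1}|lborel. f t)) \<longlongrightarrow>
      (LINT t:{0<..1}|lborel. f t) - (LINT t:{0<..1}|lborel. f t)) (at_right 0)"
    by (rule tendsto_diff[OF tendsto_const tendsto_set_lebesgue_integral_at_right[OF _ _ int]]) simp_all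
  moreover have "eventually (\<lambda>z. (LINT t:{0<..1}|lborel. f t) - (LINT t:{z..1}|lborel. f t)
      = (LINT t:{0<..z}|lborel. f t)) (at_right 0)"
    unfolding eventually_at_right_field
  proof (intro exI[of _ 1] conjI allI impI)
    fix z :: real assume z: "z > 0" "z < 1"
    have "set_integrable lborel {z..1} f"
      by (rule set_integrable_subset[OF int[of 1]]) (use z in auto)
    then show "(LINT t:{0<..1}|lborel. f t) - (LINT t:{z..1}|lborel. f t)
      = (LINT t:{0<..z}|lborel. f t)"
      using lower_integral_split(1)[of z 1] z by (simp add: set_borel_integral_eq_integral)
  qed simp
  ultimately show ?thesis by (simp add: tendsto_cong)
qed

end

context
  fixes f :: "real \<Rightarrow> real"
  assumes int: "\<And>z. z > 0 \<Longrightarrow> set_integrable lborel {z<..} f"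
begin

lemma upper_integral_split:
  assumes "0 < a" "a \<le> z"
  shows "(LINT x:{a<..}|lborel. f x) = integral {a..z} f + (LINT x:{z<..}|lborel. f x)"
    and "f integrable_on {a..z}" and "set_integrable lborel {a..z} f"
proof -
  show i: "set_integrable lborel {a..z} f"
    by (rule set_integrable_subset[OF int[of "a/2"]]) (use assms in auto)
  show "f integrable_on {a..z}"
    by (rule set_borel_integral_eq_integral[OF i])
  have i': "set_integrable lborel {a<..z} f"
    by (rule set_integrable_subset[OF i]) (use assms in auto)
  have eq: "{a<..z} \<union> {z<..} = {a<..}" using assms by auto
  have "(LINT x:{a<..z} \<union> {z<..}|lborel. f x) = (LINT x:{a<..z}|lborel. f x) + (LINT x:{z<..}|lborel. f x)"
    by (rule set_integral_Un[OF _ i' int]) (use assms in auto)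
  then have "(LINT x:{a<..}|lborel. f x) = (LINT x:{a<..z}|lborel. f x) + (LINT x:{z<..}|lborel. f x)"
    by (simp only: eq)
  also have "(LINT x:{a<..z}|lborel. f x) = (LINT x:{a..z}|lborel. f x)"
  proof (rule set_integral_cong_set)
    show "AE x in lborel. (x \<in> {a..z}) = (x \<in> {a<..z})"
      using AE_lborel_singleton[of a] by eventually_elim auto
  qed (use i i' in \<open>auto simp: set_integrable_def set_borel_measurable_def\<close>)
  finally show "(LINT x:{a<..}|lborel. f x) = integral {a..z} f + (LINT x:{z<..}|lborel. f x)"
    using set_borel_integral_eq_integral(2)[OF i] by simp
qed

lemma upper_integral_has_deriv:
  assumes "x > 0" "isCont f x"
  shows "((\<lambda>z. LINT t:{z<..}|lborel. f t) has_real_derivative - f x) (at x)"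
proof -
  let ?a = "x / 2" and ?b = "2 * x"
  have eq: "(LINT t:{?a<..}|lborel. f t) - integral {?a..z} f = (LINT t:{z<..}|lborel. f t)" if "?a \<le> z" for z
    using upper_integral_split(1)[of ?a z] \<open>x > 0\<close> that by simp
  have "((\<lambda>z. integral {?a..z} f) has_vector_derivative f x) (at x within ({?a..?b} - {}))"
    by (rule integral_has_vector_derivative_continuous_at)
      (use assms upper_integral_split(2)[of ?a ?b] in \<open>auto intro: continuous_at_imp_continuous_within\<close>)
  then have "((\<lambda>z. integral {?a..z} f) has_real_derivative f x) (at x)"
    using assms by (simp add: has_real_derivative_iff_has_vector_derivative at_within_Icc_at)
  then have "((\<lambda>z. (LINT t:{?a<..}|lborel. f t) - integral {?a..z} f) has_real_derivative - f x) (at x)"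
    using DERIV_diff[OF DERIV_const] by fastforce
  then show ?thesis
    by (rule has_field_derivative_transform_within_open[where S = "{?a<..<?b}"])
      (use assms eq in auto)
qed

lemma upper_integral_continuous: "continuous_on {0<..} (\<lambda>z. LINT t:{z<..}|lborel. f t)"
proof (rule continuous_at_imp_continuous_on, rule ballI)
  fix x :: real assume "x \<in> {0<..}"
  then have "x > 0" by simp
  let ?a = "x / 2" and ?b = "2 * x"
  have eq: "(LINT t:{?a<..}|lborel. f t) - integral {?a..z} f = (LINT t:{z<..}|lborel. f t)" if "?a \<le> z" for z
    using upper_integral_split(1)[of ?a z] \<open>x > 0\<close> that by simp
  have "continuous_on {?a..?b} (\<lambda>z. (LINT t:{?a<..}|lborel. f t) - integral {?a..z} f)"
    by (rule continuous_on_diff[OF continuous_on_const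
          indefinite_integral_continuous_1[OF upper_integral_split(2)]])
      (use \<open>x > 0\<close> in auto)
  then have "continuous_on {?a..?b} (\<lambda>z. LINT t:{z<..}|lborel. f t)"
    by (rule continuous_on_eq) (use eq in auto)
  then show "isCont (\<lambda>z. LINT t:{z<..}|lborel. f t) x"
    using \<open>x > 0\<close> by (intro continuous_on_interior[of "{?a..?b}"]) auto
qed

lemma upper_integral_tendsto_0: "((\<lambda>z. LINT t:{z<..}|lborel. f t) \<longlongrightarrow> 0) at_top"
proof -
  have i1: "set_integrable lborel {1..} f"
    by (rule set_integrable_subset[OF int[of "1/2"]]) auto
  have "((\<lambda>z. (LINT t:{1..}|lborel. f t) - (LINT t:{1..z}|lborel. f t)) \<longlongrightarrow>
      (LINT t:{1..}|lborel. f t) - (LINT t:{1..}|lborel. f t)) at_top"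
    by (rule tendsto_diff[OF tendsto_const tendsto_set_lebesgue_integral_at_top[OF _ i1]]) simp
  moreover have "eventually (\<lambda>z. (LINT t:{1..}|lborel. f t) - (LINT t:{1..z}|lborel. f t)
      = (LINT t:{z<..}|lborel. f t)) at_top"
    using eventually_ge_at_top[of 1]
  proof eventually_elim
    case (elim z)
    then have eq: "{1..} = {1..z} \<union> {z<..}" by auto
    have "(LINT t:{1..z} \<union> {z<..}|lborel. f t) = (LINT t:{1..z}|lborel. f t) + (LINT t:{z<..}|lborel. f t)"
      by (rule set_integral_Un[OF _ upper_integral_split(3)[of 1 z] int[of z]]) (use elim in auto)
    then show ?case unfolding eq[symmetric] by simp
  qed
  ultimately show ?thesis by (simp add: tendsto_cong)
qed

end

text \<open>An identity between integrals with a moving endpoint follows once both sides have the same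
  derivative off finitely many points and the same limit at one end of \<open>(0, \<infinity>)\<close>.\<close>

lemma vanishing_deriv_and_limit_imp_zero:
  fixes D :: "real \<Rightarrow> real"
  assumes "continuous_on {0<..} D" "finite S"
    and "\<And>x. x > 0 \<Longrightarrow> x \<notin> S \<Longrightarrow> (D has_real_derivative 0) (at x)"
    and lim: "(D \<longlongrightarrow> 0) F" and F: "eventually (\<lambda>x. x > 0) F" "F \<noteq> bot"
    and "z > 0"
  shows "D z = 0"
proof -
  have "\<forall>x\<in>{0<..} - S. (D has_real_derivative 0) (at x)"
    using assms(3) by blast
  then obtain c where c: "\<And>x. x \<in> {0<..} \<Longrightarrow> D x = c"
    using DERIV_zero_connected_constant[OF connected_Ioi open_greaterThan assms(2,1)] by blast
  have "eventually (\<lambda>x. D x = c) F" using F(1) by eventually_elim (use c in auto)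
  then have "((\<lambda>_. c) \<longlongrightarrow> 0) F" using lim by (simp add: tendsto_cong)
  then have "c = 0" using F(2) by (simp add: tendsto_const_iff)
  then show ?thesis using c \<open>z > 0\<close> by simp
qed

lemma isCont_powr_const: "x > 0 \<Longrightarrow> isCont (\<lambda>x::real. x powr p) x"
  by (intro continuous_intros) auto

lemma has_deriv_powr_mult:
  assumes "(K has_real_derivative k) (at x)" "x > 0"
  shows "((\<lambda>x. x powr p * K x) has_real_derivative x powr p * k + p * x powr (p - 1) * K x) (at x)"
  by (rule derivative_eq_intros has_real_derivative_powr assms refl)+ (use assms in auto)

text \<open>In the integrations by parts the derivative \<open>k\<close> may have finitely many jumps, because the
  income and consumption rates jump at the switching point.\<close>

context
  fixes K k :: "real \<Rightarrow> real" and p :: real and S :: "real set"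
  assumes S: "finite S"
    and K: "continuous_on {0<..} K"
      "\<And>x. x > 0 \<Longrightarrow> x \<notin> S \<Longrightarrow> (K has_real_derivative k x) (at x)"
    and k: "\<And>x. x > 0 \<Longrightarrow> x \<notin> S \<Longrightarrow> isCont k x"
begin

lemma isCont_antiderivative: "x > 0 \<Longrightarrow> isCont K x"
  using K(1) by (simp add: continuous_on_eq_continuous_at)

lemma integral_by_parts_from_0:
  assumes "\<And>z. z > 0 \<Longrightarrow> set_integrable lborel {0<..z} (\<lambda>x. x powr p * k x)"
    and "\<And>z. z > 0 \<Longrightarrow> set_integrable lborel {0<..z} (\<lambda>x. x powr (p - 1) * K x)"
    and "((\<lambda>x. x powr p * K x) \<longlongrightarrow> 0) (at_right 0)"
    and "z > 0"
  shows "(LINT x:{0<..z}|lborel. x powr p * k x)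
    = z powr p * K z - p * (LINT x:{0<..z}|lborel. x powr (p - 1) * K x)"
proof -
  let ?D = "\<lambda>z. (LINT x:{0<..z}|lborel. x powr p * k x)
    - (z powr p * K z - p * (LINT x:{0<..z}|lborel. x powr (p - 1) * K x))"
  have "?D z = 0"
  proof (rule vanishing_deriv_and_limit_imp_zero[of ?D S "at_right 0"])
    show "continuous_on {0<..} ?D"
      by (intro continuous_on_diff continuous_on_mult continuous_on_const continuous_on_powr continuous_on_id
          lower_integral_continuous assms K) auto
    show "(?D has_real_derivative 0) (at x)" if x: "x > 0" "x \<notin> S" for x
    proof -
      have "(?D has_real_derivative x powr p * k x - ((x powr p * k x + p * x powr (p - 1) * K x)
          - p * (x powr (p - 1) * K x))) (at x)"
        by (intro DERIV_diff DERIV_cmult lower_integral_has_deriv has_deriv_powr_mult assms x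
            K(2) isCont_mult isCont_powr_const isCont_antiderivative k) (use x in auto)
      then show ?thesis by (simp add: algebra_simps)
    qed
    show "(?D \<longlongrightarrow> 0) (at_right 0)"
      using tendsto_diff[OF lower_integral_tendsto_0[OF assms(1)]
          tendsto_diff[OF assms(3) tendsto_mult[OF tendsto_const[of p] lower_integral_tendsto_0[OF assms(2)]]]]
      by simp
  qed (use S assms in \<open>auto simp: eventually_at_right_less\<close>)
  then show ?thesis by simp
qed

lemma integral_by_parts_to_infinity:
  assumes "\<And>z. z > 0 \<Longrightarrow> set_integrable lborel {z<..} (\<lambda>x. x powr p * k x)"
    and "\<And>z. z > 0 \<Longrightarrow> set_integrable lborel {z<..} (\<lambda>x. x powr (p - 1) * K x)"
    and "((\<lambda>x. x powr p * K x) \<longlongrightarrow> 0) at_top"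
    and "z > 0"
  shows "(LINT x:{z<..}|lborel. x powr p * k x)
    = - (z powr p * K z) - p * (LINT x:{z<..}|lborel. x powr (p - 1) * K x)"
proof -
  let ?D = "\<lambda>z. (LINT x:{z<..}|lborel. x powr p * k x)
    - (- (z powr p * K z) - p * (LINT x:{z<..}|lborel. x powr (p - 1) * K x))"
  have "?D z = 0"
  proof (rule vanishing_deriv_and_limit_imp_zero[of ?D S at_top])
    show "continuous_on {0<..} ?D"
      by (intro continuous_on_diff continuous_on_minus continuous_on_mult continuous_on_const continuous_on_powr
          continuous_on_id upper_integral_continuous assms K) auto
    show "(?D has_real_derivative 0) (at x)" if x: "x > 0" "x \<notin> S" for x
    proof -
      have "(?D has_real_derivative - (x powr p * k x) - (- (x powr p * k x + p * x powr (p - 1) * K x)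
          - p * (- (x powr (p - 1) * K x)))) (at x)"
        by (intro DERIV_diff DERIV_minus DERIV_cmult upper_integral_has_deriv has_deriv_powr_mult assms x
            K(2) isCont_mult isCont_powr_const isCont_antiderivative k) (use x in auto)
      then show ?thesis by (simp add: algebra_simps)
    qed
    show "(?D \<longlongrightarrow> 0) at_top"
      using tendsto_diff[OF upper_integral_tendsto_0[OF assms(1)]
          tendsto_diff[OF tendsto_minus[OF assms(3)] tendsto_mult[OF tendsto_const[of p] upper_integral_tendsto_0[OF assms(2)]]]]
      by simp
  qed (use S assms eventually_gt_at_top in auto)
  then show ?thesis by simp
qed

end

lemma set_integrable_powr_lower:
  fixes p z :: real
  assumes "p > -1" "z > 0"
  shows "set_integrable lborel {0<..z} (\<lambda>x. x powr p)"
proof -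
  have "set_integrable lborel (einterval 0 (ereal (z + 1))) (\<lambda>x. x powr p)"
  proof (rule interval_integral_FTC_nonneg(1)[where F = "\<lambda>x. x powr (p + 1) / (p + 1)"])
    show "(((\<lambda>x. x powr (p + 1) / (p + 1)) \<circ> real_of_ereal) \<longlongrightarrow> 0) (at_right 0)"
      unfolding zero_ereal_def ereal_tendsto_simps
      using assms by (auto intro!: tendsto_eq_intros tendsto_powr' eventually_at_rightI[of 0 1])
    show "(((\<lambda>x. x powr (p + 1) / (p + 1)) \<circ> real_of_ereal) \<longlongrightarrow> (z+1) powr (p + 1) / (p + 1)) (at_left (ereal (z+1)))"
      unfolding ereal_tendsto_simps
      using assms by (auto intro!: tendsto_eq_intros)
    show "((\<lambda>x. x powr (p + 1) / (p + 1)) has_real_derivative x powr p) (at x)" if "0 < ereal x" for x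
      using that assms by (auto intro!: derivative_eq_intros)
    show "isCont (\<lambda>x. x powr p) x" if "0 < ereal x" for x
      using that by (auto intro!: continuous_intros)
  qed (use assms in auto)
  then show ?thesis
    by (rule set_integrable_subset) (use assms in \<open>auto simp: einterval_def\<close>)
qed

lemma set_integrable_powr_upper:
  fixes p z :: real
  assumes "p < -1" "z > 0"
  shows "set_integrable lborel {z<..} (\<lambda>x. x powr p)"
proof -
  have "set_integrable lborel (einterval (ereal z) \<infinity>) (\<lambda>x. x powr p)"
  proof (rule interval_integral_FTC_nonneg(1)[where F = "\<lambda>x. x powr (p + 1) / (p + 1)"])
    show "(((\<lambda>x. x powr (p + 1) / (p + 1)) \<circ> real_of_ereal) \<longlongrightarrow> 0) (at_left \<infinity>)"
      unfolding ereal_tendsto_simps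
      using tendsto_divide[OF tendsto_neg_powr[of "p + 1", OF _ filterlim_ident] tendsto_const[of "p + 1"]] assms
      by simp
    show "(((\<lambda>x. x powr (p + 1) / (p + 1)) \<circ> real_of_ereal) \<longlongrightarrow> z powr (p + 1) / (p + 1)) (at_right (ereal z))"
      unfolding ereal_tendsto_simps
      using assms by (auto intro!: tendsto_eq_intros)
    show "((\<lambda>x. x powr (p + 1) / (p + 1)) has_real_derivative x powr p) (at x)" if "ereal z < ereal x" for x
      using that assms by (auto intro!: derivative_eq_intros)
    show "isCont (\<lambda>x. x powr p) x" if "ereal z < ereal x" for x
      using that assms by (auto intro!: continuous_intros)
  qed (use assms in auto)
  then show ?thesis
    by (rule set_integrable_subset) (use assms in \<open>auto simp: einterval_def\<close>)
qed

section \<open>Convexity, signs and gluing of functions of one variable\<close>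

lemma convex_on_max_fun:
  fixes f g :: "'a::real_vector \<Rightarrow> real"
  assumes "convex_on S f" "convex_on S g"
  shows "convex_on S (\<lambda>x. max (f x) (g x))"
proof (rule convex_onI)
  fix t :: real and x y assume *: "0 < t" "t < 1" "x \<in> S" "y \<in> S"
  have "f ((1 - t) *\<^sub>R x + t *\<^sub>R y) \<le> (1 - t) * f x + t * f y"
    "g ((1 - t) *\<^sub>R x + t *\<^sub>R y) \<le> (1 - t) * g x + t * g y"
    using convex_onD[OF assms(1)] convex_onD[OF assms(2)] * by auto
  moreover have "(1 - t) * f x \<le> (1 - t) * max (f x) (g x)" "t * f y \<le> t * max (f y) (g y)"
    "(1 - t) * g x \<le> (1 - t) * max (f x) (g x)" "t * g y \<le> t * max (f y) (g y)"
    using * by (auto intro!: mult_left_mono)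
  ultimately show "max (f ((1 - t) *\<^sub>R x + t *\<^sub>R y)) (g ((1 - t) *\<^sub>R x + t *\<^sub>R y))
      \<le> (1 - t) * max (f x) (g x) + t * max (f y) (g y)" by linarith
qed (use assms in \<open>simp add: convex_on_imp_convex\<close>)

lemma sign_around_unique_zero:
  fixes g :: "real \<Rightarrow> real"
  assumes c: "continuous_on {0<..} g" and unique: "\<And>y. y > 0 \<Longrightarrow> g y = 0 \<Longrightarrow> y = z0"
    and neg: "\<And>w. w > 0 \<Longrightarrow> \<exists>y. 0 < y \<and> y < w \<and> g y < 0"
    and pos: "\<And>w. \<exists>y>w. g y > 0" and "z > 0"
  shows "z < z0 \<Longrightarrow> g z < 0" and "z > z0 \<Longrightarrow> g z > 0"
proof -
  have c': "continuous_on {x..y} g" if "x > 0" for x y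
    by (rule continuous_on_subset[OF c]) (use that in auto)
  show "g z < 0" if "z < z0"
  proof (rule ccontr)
    assume "\<not> g z < 0"
    obtain y where y: "0 < y" "y < z" "g y < 0" using neg[OF \<open>z > 0\<close>] by blast
    have "\<exists>x. y \<le> x \<and> x \<le> z \<and> g x = 0"
      by (rule IVT') (use y c' \<open>\<not> g z < 0\<close> in simp_all)
    then obtain x where "y \<le> x" "x \<le> z" "g x = 0" by blast
    then show False using unique[of x] y that by simp
  qed
  show "g z > 0" if "z > z0"
  proof (rule ccontr)
    assume "\<not> g z > 0"
    obtain y where y: "y > z" "g y > 0" using pos by blast
    have "\<exists>x. z \<le> x \<and> x \<le> y \<and> g x = 0"
      by (rule IVT') (use y c' \<open>z > 0\<close> \<open>\<not> g z > 0\<close> in simp_all)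
    then obtain x where "z \<le> x" "g x = 0" by blast
    then show False using unique[of x] \<open>z > 0\<close> that by simp
  qed
qed

lemma eventually_at_right_0_ex:
  assumes "eventually P (at_right (0 :: real))" "w > 0" shows "\<exists>y. 0 < y \<and> y < w \<and> P y"
proof -
  have "eventually (\<lambda>y. P y \<and> 0 < y \<and> y < w) (at_right 0)"
    using assms(1) eventually_at_right_less[of "0 :: real"] eventually_at_rightI[of 0 w "\<lambda>y. y < w"] assms(2)
    by (auto intro: eventually_conj)
  then show ?thesis using eventually_happens[of _ "at_right (0 :: real)"] by auto
qed

lemma eventually_at_top_ex:
  assumes "eventually P (at_top :: real filter)" shows "\<exists>y>w. P y"
  using eventually_happens[OF eventually_conj[OF assms eventually_gt_at_top[of w]]] by auto

text \<open>The derivatives have to agree only if \<open>z\<close> is the gluing point. In this form the lemma also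
  yields the second derivative of \<open>\<Q>\<close> away from \<open>z\<^sub>R\<close>, where it jumps.\<close>

lemma glue_has_deriv:
  fixes f g :: "real \<Rightarrow> real"
  assumes f: "\<And>z. z > 0 \<Longrightarrow> (f has_real_derivative f1 z) (at z)"
    and g: "\<And>z. z > 0 \<Longrightarrow> (g has_real_derivative g1 z) (at z)"
    and "f c = g c" and "c = z \<Longrightarrow> f1 c = g1 c" and "z > 0"
  shows "((\<lambda>x. if x \<le> c then f x else g x) has_real_derivative (if z \<le> c then f1 z else g1 z)) (at z)"
proof (cases z c rule: linorder_cases)
  case less
  show ?thesis
    by (rule has_field_derivative_transform_within_open[where S = "{..<c}" and f = f])
      (use less f[OF \<open>z > 0\<close>] in auto)
next
  case greater
  show ?thesis
    by (rule has_field_derivative_transform_within_open[where S = "{c<..}" and f = g])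
      (use greater g[OF \<open>z > 0\<close>] in auto)
next
  case equal
  let ?G = "\<lambda>x. if x \<le> c then f x else g x"
  have "((\<lambda>y. (f y - f c) / (y - c)) \<longlongrightarrow> f1 c) (at c)" "((\<lambda>y. (g y - g c) / (y - c)) \<longlongrightarrow> f1 c) (at c)"
    using f[of c] g[of c] assms(3-5) equal by (simp_all add: has_field_derivative_iff)
  then have "((\<lambda>y. (f y - f c) / (y - c)) \<longlongrightarrow> f1 c) (at_left c)"
    "((\<lambda>y. (g y - g c) / (y - c)) \<longlongrightarrow> f1 c) (at_right c)"
    by (simp_all add: filterlim_at_split)
  note lim = this
  have "eventually (\<lambda>y. (f y - f c) / (y - c) = (?G y - ?G c) / (y - c)) (at_left c)"
    by (simp add: eventually_at_filter)
  from Lim_transform_eventually[OF lim(1) this]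
  have left: "((\<lambda>y. (?G y - ?G c) / (y - c)) \<longlongrightarrow> f1 c) (at_left c)" .
  have "eventually (\<lambda>y. (g y - g c) / (y - c) = (?G y - ?G c) / (y - c)) (at_right c)"
    using \<open>f c = g c\<close> by (simp add: eventually_at_filter)
  from Lim_transform_eventually[OF lim(2) this]
  have right: "((\<lambda>y. (?G y - ?G c) / (y - c)) \<longlongrightarrow> f1 c) (at_right c)" .
  from filterlim_split_at[OF left right]
  have "((\<lambda>y. (?G y - ?G c) / (y - c)) \<longlongrightarrow> f1 c) (at c)" .
  then show ?thesis using equal by (simp add: has_field_derivative_iff)
qed

lemma strictly_convex_on_of_deriv_strict_mono:
  fixes f :: "real \<Rightarrow> real"
  assumes d: "\<And>z. a < z \<Longrightarrow> z < b \<Longrightarrow> (f has_real_derivative f' z) (at z)"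
    and mono: "\<And>x y. a < x \<Longrightarrow> x < y \<Longrightarrow> y < b \<Longrightarrow> f' x < f' y"
  shows "strictly_convex_on {a<..<b} f"
proof -
  have lt: "f ((1 - t) * x + t * y) < (1 - t) * f x + t * f y"
    if "a < x" "x < y" "y < b" "0 < t" "t < 1" for x y t
  proof -
    define w where "w = (1 - t) * x + t * y"
    have wx: "w - x = t * (y - x)" and yw: "y - w = (1 - t) * (y - x)"
      unfolding w_def by (simp_all add: algebra_simps)
    have "0 < t * (y - x)" "0 < (1 - t) * (y - x)" using that by simp_all
    then have "x < w" "w < y" unfolding wx[symmetric] yw[symmetric] by simp_all
    have "\<exists>p. x < p \<and> p < w \<and> f w - f x = (w - x) * f' p"
      by (rule MVT2[OF \<open>x < w\<close>], rule d) (use that \<open>w < y\<close> in simp_all)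
    then obtain p where p: "x < p" "p < w" "f w - f x = (w - x) * f' p" by blast
    have "\<exists>q. w < q \<and> q < y \<and> f y - f w = (y - w) * f' q"
      by (rule MVT2[OF \<open>w < y\<close>], rule d) (use that \<open>x < w\<close> in simp_all)
    then obtain q where q: "w < q" "q < y" "f y - f w = (y - w) * f' q" by blast
    have "f' p < f' q" using mono[of p q] p q that by simp
    then have "0 < (t * (1 - t) * (y - x)) * (f' q - f' p)"
      using that by simp
    also have "\<dots> = t * (f y - f w) - (1 - t) * (f w - f x)"
      unfolding p(3) q(3) wx yw by (simp add: algebra_simps)
    finally show ?thesis unfolding w_def[symmetric] by (simp add: algebra_simps)
  qed
  show ?thesis unfolding strictly_convex_on_def
  proof (intro conjI ballI allI impI)
    fix x y t :: real
    assume *: "x \<in> {a<..<b}" "y \<in> {a<..<b}" "x \<noteq> y \<and> 0 < t \<and> t < 1"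
    show "f ((1 - t) *\<^sub>R x + t *\<^sub>R y) < (1 - t) * f x + t * f y"
    proof (cases "x < y")
      case True
      then show ?thesis using lt[of x y t] * by simp
    next
      case False
      then show ?thesis using lt[of y x "1 - t"] * by (simp add: add.commute)
    qed
  qed simp
qed

text \<open>A minimum with nonpositive value is not at \<open>s\<close>, where \<open>W\<close> is positive, nor at \<open>t\<close>, where \<open>W\<close>
  increases; an interior one has \<open>W1 = 0\<close> and \<open>W2 < 0\<close>, which is impossible at a minimum.\<close>

lemma positive_by_minimum_principle:
  fixes W W1 W2 :: "real \<Rightarrow> real"
  assumes "s < t" and W: "\<And>z. s \<le> z \<Longrightarrow> z \<le> t \<Longrightarrow> (W has_real_derivative W1 z) (at z)"
    and W1: "\<And>z. s \<le> z \<Longrightarrow> z \<le> t \<Longrightarrow> (W1 has_real_derivative W2 z) (at z)"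
    and "W s > 0" "W1 t > 0"
    and super: "\<And>z. s < z \<Longrightarrow> z < t \<Longrightarrow> W z \<le> 0 \<Longrightarrow> W1 z = 0 \<Longrightarrow> W2 z < 0"
    and z: "s \<le> z" "z \<le> t"
  shows "W z > 0"
proof (rule ccontr)
  assume "\<not> W z > 0"
  have "continuous_on {s..t} W"
    using DERIV_isCont[OF W] by (intro continuous_at_imp_continuous_on) auto
  then obtain m where m: "s \<le> m" "m \<le> t" and min: "\<And>w. s \<le> w \<Longrightarrow> w \<le> t \<Longrightarrow> W m \<le> W w"
    using continuous_attains_inf[of "{s..t}" W] \<open>s < t\<close> by auto
  have "W m \<le> 0" using min[OF z] \<open>\<not> W z > 0\<close> by simp
  then have "s < m" using \<open>W s > 0\<close> m by (auto simp: less_le)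
  have "W1 m \<le> 0"
  proof (rule ccontr)
    assume "\<not> W1 m \<le> 0"
    then obtain e where e: "e > 0" "\<And>h. 0 < h \<Longrightarrow> h < e \<Longrightarrow> W (m - h) < W m"
      using DERIV_pos_inc_left[OF W[OF m]] by auto
    define h where "h = min e (m - s) / 2"
    have "0 < h" "h < e" "s < m - h"
      using \<open>e > 0\<close> \<open>s < m\<close> by (auto simp: h_def min_def field_simps)
    then show False using e(2)[of h] min[of "m - h"] m by simp
  qed
  then have "m < t" using m \<open>W1 t > 0\<close> by (auto simp: less_le)
  have "W1 m \<ge> 0"
  proof (rule ccontr)
    assume "\<not> W1 m \<ge> 0"
    then obtain e where e: "e > 0" "\<And>h. 0 < h \<Longrightarrow> h < e \<Longrightarrow> W m > W (m + h)"
      using DERIV_neg_dec_right[OF W[OF m]] by auto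
    define h where "h = min e (t - m) / 2"
    have "0 < h" "h < e" "m + h < t"
      using \<open>e > 0\<close> \<open>m < t\<close> by (auto simp: h_def min_def field_simps)
    then show False using e(2)[of h] min[of "m + h"] m by simp
  qed
  then have "W1 m = 0" using \<open>W1 m \<le> 0\<close> by simp
  then have "W2 m < 0" using super \<open>s < m\<close> \<open>m < t\<close> \<open>W m \<le> 0\<close> by simp
  then obtain e where e: "e > 0" "\<And>h. 0 < h \<Longrightarrow> h < e \<Longrightarrow> W1 m > W1 (m + h)"
    using DERIV_neg_dec_right[OF W1[OF m]] by auto
  define h where "h = min e (t - m) / 2"
  have h: "0 < h" "h < e" "m + h < t"
    using \<open>e > 0\<close> \<open>m < t\<close> by (auto simp: h_def min_def field_simps)
  have "m < m + h" using h by simp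
  then have "W (m + h) < W m"
  proof (rule DERIV_neg_imp_decreasing_open)
    fix x assume x: "m < x" "x < m + h"
    then have "W1 x < 0" using e(2)[of "x - m"] h \<open>W1 m = 0\<close> by simp
    then show "\<exists>l. (W has_real_derivative l) (at x) \<and> l < 0"
      using W[of x] x m h by (intro exI[of _ "W1 x"]) simp
    next
    show "continuous_on {m..m + h} W"
      by (rule continuous_on_subset[OF \<open>continuous_on {s..t} W\<close>]) (use m h in auto)
  qed
  then show False using min[of "m + h"] h m by simp
qed

section \<open>Convexity of a solution with convex forcing\<close>

text \<open>A line that touches a graph at a point and lies above it on one side of that point bounds
  the derivative there.\<close>

lemma deriv_le_of_linear_bound_right:
  assumes D: "(f has_real_derivative l) (at x)" and "x < y"
    and le: "\<And>z. x < z \<Longrightarrow> z < y \<Longrightarrow> f z \<le> f x + k * (z - x)"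
  shows "l \<le> (k :: real)"
proof (rule ccontr)
  assume "\<not> l \<le> k"
  moreover have "((\<lambda>z. f z - k * (z - x)) has_real_derivative l - k) (at x)"
    by (auto intro!: derivative_eq_intros D)
  ultimately obtain e where "e > 0" and
    e: "\<And>h. 0 < h \<Longrightarrow> h < e \<Longrightarrow> f x - k * (x - x) < f (x + h) - k * (x + h - x)"
    using DERIV_pos_inc_right[of "\<lambda>z. f z - k * (z - x)" "l - k" x] by auto
  define h where "h = min e (y - x) / 2"
  have "0 < h" "h < e" "x + h < y"
    using \<open>e > 0\<close> \<open>x < y\<close> by (auto simp: h_def min_def field_simps)
  then show False using e[of h] le[of "x + h"] by auto
qed

lemma deriv_ge_of_linear_bound_left:
  assumes D: "(f has_real_derivative l) (at x)" and "y < x"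
    and le: "\<And>z. y < z \<Longrightarrow> z < x \<Longrightarrow> f z \<le> f x + k * (z - x)"
  shows "l \<ge> (k :: real)"
proof (rule ccontr)
  assume "\<not> l \<ge> k"
  moreover have "((\<lambda>z. f z - k * (z - x)) has_real_derivative l - k) (at x)"
    by (auto intro!: derivative_eq_intros D)
  ultimately obtain e where "e > 0" and
    e: "\<And>h. 0 < h \<Longrightarrow> h < e \<Longrightarrow> f x - k * (x - x) < f (x - h) - k * (x - h - x)"
    using DERIV_neg_dec_left[of "\<lambda>z. f z - k * (z - x)" "l - k" x] by auto
  define h where "h = min e (x - y) / 2"
  have "0 < h" "h < e" "y < x - h"
    using \<open>e > 0\<close> \<open>y < x\<close> by (auto simp: h_def min_def field_simps)
  then show False using e[of h] le[of "x - h"] by auto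
qed

text \<open>The equation \<open>a z\<^sup>2 q'' + b z q' - d q + H = 0\<close> reads \<open>a z\<^sup>2 q'' = M - H\<close> with
  \<open>M = d q - b z q'\<close>. As \<open>M' = (d - b) q' - b z q''\<close> contains neither a third derivative of \<open>q\<close>
  nor a derivative of \<open>H\<close>, the equation can in effect be differentiated although \<open>H\<close> has a kink.\<close>

locale convex_forcing_ode =
  fixes a b d s t :: real and H q q1 q2 :: "real \<Rightarrow> real"
  assumes a: "a > 0" and db: "b < d" and st: "0 < s" "s < t"
    and cvx: "convex_on {0<..} H"
    and q: "\<And>z. z > 0 \<Longrightarrow> (q has_real_derivative q1 z) (at z)"
    and q1: "\<And>z. z > 0 \<Longrightarrow> (q1 has_real_derivative q2 z) (at z)"
    and cont: "continuous_on {0<..} q2"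
    and ode: "\<And>z. z > 0 \<Longrightarrow> a * z\<^sup>2 * q2 z + b * z * q1 z - d * q z + H z = 0"
    and start: "q2 s > 0" and q1_end: "q1 t = 0" and q2_end: "q2 t = 0"
begin

definition M :: "real \<Rightarrow> real" where "M z = d * q z - b * z * q1 z"

lemma M_has_deriv: "z > 0 \<Longrightarrow> (M has_real_derivative (d - b) * q1 z - b * z * q2 z) (at z)"
  unfolding M_def by (auto intro!: derivative_eq_intros q q1 simp: algebra_simps)

lemma M_minus_H: "z > 0 \<Longrightarrow> M z - H z = a * z\<^sup>2 * q2 z"
  using ode[of z] unfolding M_def by (simp add: algebra_simps)

lemma H_below_chord:
  assumes "0 < x" "x \<le> z" "z \<le> y" "x < y"
  shows "H z \<le> H x + (H y - H x) / (y - x) * (z - x)"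
proof -
  have "convex_on {x..y} H"
    using convex_on_subset[OF cvx, of "{x..y}"] assms by fastforce
  then show ?thesis using convex_onD_Icc'[of x y H z] assms by (simp add: algebra_simps)
qed

text \<open>If \<open>q2 < 0\<close> on a maximal interval \<open>(x, y)\<close>, then \<open>q2\<close> vanishes at both ends, so there \<open>M = H\<close>,
  and \<open>M \<le> H\<close> in between. Hence \<open>M\<close> stays below the chord of the convex function \<open>H\<close> and meets it at
  both ends, which gives \<open>M' x \<le> M' y\<close>, that is \<open>q1 x \<le> q1 y\<close>. But \<open>q1\<close> strictly decreases.\<close>

lemma q2_nonneg:
  assumes "s \<le> z" "z \<le> t"
  shows "q2 z \<ge> 0"
proof (rule ccontr)
  assume neg: "\<not> 0 \<le> q2 z"
  have c: "continuous_on {x..y} q2" if "0 < x" for x y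
    by (rule continuous_on_subset[OF cont]) (use that in auto)
  \<comment> \<open>\<open>x\<close> and \<open>y\<close> are the ends of the component of \<open>{q2 < 0}\<close> that contains \<open>z\<close>.\<close>
  let ?X = "{w \<in> {s..z}. q2 w \<ge> 0}" and ?Y = "{w \<in> {z..t}. q2 w \<ge> 0}"
  have "closed ?X" "closed ?Y"
    using continuous_closed_preimage[OF c[of s z], of "{0..}"]
      continuous_closed_preimage[OF c[of z t], of "{0..}"] st assms
    by (simp_all add: vimage_def Int_def)
  moreover have "bounded ?X" "bounded ?Y"
    by (auto intro: bounded_subset[OF bounded_closed_interval])
  ultimately have cX: "compact ?X" and cY: "compact ?Y"
    by (simp_all only: compact_eq_bounded_closed)
  have "s \<in> ?X" "t \<in> ?Y" using start q2_end assms by auto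
  then have nX: "?X \<noteq> {}" and nY: "?Y \<noteq> {}" by blast+
  obtain x where x: "x \<in> ?X" and xmax: "\<And>w. w \<in> ?X \<Longrightarrow> w \<le> x"
    using compact_attains_sup[OF cX nX] by auto
  obtain y where y: "y \<in> ?Y" and ymin: "\<And>w. w \<in> ?Y \<Longrightarrow> y \<le> w"
    using compact_attains_inf[OF cY nY] by auto
  have xz: "s \<le> x" "x < z" and zy: "z < y" "y \<le> t"
    using x y neg by (auto simp: less_le)
  then have "0 < x" using st by simp
  have between: "q2 w < 0" if "x < w" "w < y" for w
  proof (rule ccontr)
    assume "\<not> q2 w < 0"
    then have "w \<in> ?X \<or> w \<in> ?Y" using that xz zy by auto
    then show False using xmax[of w] ymin[of w] that by auto
  qed
  have "q2 x = 0"
  proof (rule ccontr)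
    assume "q2 x \<noteq> 0"
    then have "0 \<le> q2 x" "q2 x > 0" using x by auto
    have "\<exists>w. x \<le> w \<and> w \<le> z \<and> q2 w = 0"
      by (rule IVT2') (use neg c[OF \<open>0 < x\<close>] \<open>q2 x > 0\<close> xz in simp_all)
    then obtain w where w: "x \<le> w" "w \<le> z" "q2 w = 0" by blast
    then have "w \<le> x" using xz by (intro xmax) simp
    then show False using w \<open>q2 x > 0\<close> by simp
  qed
  moreover have "q2 y = 0"
  proof (rule ccontr)
    assume "q2 y \<noteq> 0"
    then have "q2 y > 0" using y by auto
    have "\<exists>w. z \<le> w \<and> w \<le> y \<and> q2 w = 0"
      by (rule IVT') (use neg c[of z y] \<open>q2 y > 0\<close> \<open>0 < x\<close> xz zy in simp_all)
    then obtain w where w: "z \<le> w" "w \<le> y" "q2 w = 0" by blast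
    then have "y \<le> w" using zy by (intro ymin) simp
    then show False using w \<open>q2 y > 0\<close> by simp
  qed
  moreover have "x < y" using xz zy by simp
  ultimately have M_eq: "M x = H x" "M y = H y"
    using M_minus_H[of x] M_minus_H[of y] \<open>0 < x\<close> by auto
  let ?k = "(H y - H x) / (y - x)"
  have chord: "M w \<le> H x + ?k * (w - x)" if "x < w" "w < y" for w
  proof -
    have "a * w\<^sup>2 * q2 w \<le> 0"
      using a between[OF that] by (intro mult_nonneg_nonpos) auto
    then have "M w \<le> H w" using M_minus_H[of w] that \<open>0 < x\<close> by simp
    also have "\<dots> \<le> H x + ?k * (w - x)"
      using H_below_chord[of x w y] that \<open>0 < x\<close> by simp
    finally show ?thesis .
  qed
  have "(d - b) * q1 x - b * x * q2 x \<le> ?k"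
    by (rule deriv_le_of_linear_bound_right[OF M_has_deriv \<open>x < y\<close>])
      (use \<open>0 < x\<close> chord M_eq in auto)
  moreover have "(d - b) * q1 y - b * y * q2 y \<ge> ?k"
  proof (rule deriv_ge_of_linear_bound_left[OF M_has_deriv \<open>x < y\<close>])
    fix w assume w: "x < w" "w < y"
    have "H x + ?k * (w - x) = H y + ?k * (w - y)"
      using \<open>x < y\<close> by (simp add: field_simps)
    then show "M w \<le> M y + ?k * (w - y)" using chord[OF w] M_eq by simp
  qed (use \<open>0 < x\<close> \<open>x < y\<close> in simp)
  ultimately have "(d - b) * q1 x \<le> (d - b) * q1 y"
    using \<open>q2 x = 0\<close> \<open>q2 y = 0\<close> by simp
  then have "q1 x \<le> q1 y" using db by simp
  moreover have "q1 y < q1 x"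
  proof (rule DERIV_neg_imp_decreasing_open[OF \<open>x < y\<close>])
    show "\<exists>l. (q1 has_real_derivative l) (at w) \<and> l < 0" if "x < w" "w < y" for w
      using q1[of w] between[of w] that \<open>0 < x\<close> by auto
    show "continuous_on {x..y} q1"
      using DERIV_isCont[OF q1] \<open>0 < x\<close> by (intro continuous_at_imp_continuous_on ballI) simp
  qed
  ultimately show False by simp
qed

lemma q1_mono:
  assumes "s \<le> x" "x \<le> y" "y \<le> t" shows "q1 x \<le> q1 y"
proof (rule DERIV_nonneg_imp_nondecreasing[OF assms(2)])
  fix z assume "x \<le> z" "z \<le> y"
  then show "\<exists>l. (q1 has_real_derivative l) (at z) \<and> 0 \<le> l"
    using q1[of z] q2_nonneg[of z] assms st by (intro exI[of _ "q2 z"]) simp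
qed

lemma q1_nonpos: "s \<le> z \<Longrightarrow> z \<le> t \<Longrightarrow> q1 z \<le> 0"
  using q1_mono[of z t] q1_end by simp

text \<open>If \<open>q1\<close> takes the same value twice, it is constant in between, so \<open>q2 = 0\<close> there and
  \<open>H = M\<close> is affine with slope \<open>(d - b) q1 \<le> 0\<close>.\<close>

lemma q1_strict_mono:
  assumes not_affine: "\<And>x y k. s \<le> x \<Longrightarrow> x < y \<Longrightarrow> y \<le> t \<Longrightarrow> k \<le> 0 \<Longrightarrow>
      (\<And>z. x < z \<Longrightarrow> z < y \<Longrightarrow> (H has_real_derivative k) (at z)) \<Longrightarrow> False"
    and xy: "s \<le> x" "x < y" "y \<le> t"
  shows "q1 x < q1 y"
proof (rule ccontr)
  assume "\<not> q1 x < q1 y"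
  then have "q1 y \<le> q1 x" by simp
  then have const: "q1 z = q1 x" if "x \<le> z" "z \<le> y" for z
    using q1_mono[of x z] q1_mono[of z y] that xy by auto
  have q2_0: "q2 z = 0" if "x < z" "z < y" for z
  proof -
    have "((\<lambda>_. q1 x) has_real_derivative q2 z) (at z)"
    proof (rule has_field_derivative_transform_within_open[OF q1[of z], where S = "{x<..<y}"])
      show "q1 w = q1 x" if "w \<in> {x<..<y}" for w
        using that by (intro const) auto
    qed (use that xy st in auto)
    then show ?thesis by (rule DERIV_unique[OF _ DERIV_const])
  qed
  have "(H has_real_derivative (d - b) * q1 x) (at z)" if "x < z" "z < y" for z
  proof (rule has_field_derivative_transform_within_open[where S = "{x<..<y}" and f = M])
    show "(M has_real_derivative (d - b) * q1 x) (at z)"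
      using M_has_deriv[of z] q2_0[of z] const[of z] that xy st by simp
    show "M w = H w" if "w \<in> {x<..<y}" for w
      using M_minus_H[of w] q2_0[of w] that xy st by simp
  qed (use that in auto)
  then show False
    using not_affine[of x y "(d - b) * q1 x"] xy db q1_nonpos[of x]
    by (simp add: mult_nonneg_nonpos)
qed

text \<open>At \<open>t\<close> the function \<open>M\<close> is stationary, meets \<open>H\<close>, and lies above \<open>H\<close> on the left. If \<open>H\<close> had a
  smaller value to the right of \<open>t\<close>, convexity would make \<open>H\<close>, and so \<open>M\<close>, descend into \<open>t\<close>.\<close>

lemma H_end_le:
  assumes "t \<le> z" shows "H t \<le> H z"
proof (rule ccontr)
  assume "\<not> H t \<le> H z"
  then have "t < z" "H z < H t" using assms by (auto simp: less_le)
  let ?k = "(H z - H t) / (z - t)"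
  have "?k < 0" using \<open>t < z\<close> \<open>H z < H t\<close> by (simp add: divide_neg_pos)
  have "M t = H t" using M_minus_H[of t] q2_end st by simp
  have "- ((d - b) * q1 t - b * t * q2 t) \<ge> - ?k"
  proof (rule deriv_ge_of_linear_bound_left[OF DERIV_minus[OF M_has_deriv] st(2)])
    fix w assume w: "s < w" "w < t"
    have "H t \<le> H w + (H z - H w) / (z - w) * (t - w)"
      by (rule H_below_chord) (use w st \<open>t < z\<close> in auto)
    then have "H t * (z - w) \<le> H w * (z - w) + (H z - H w) * (t - w)"
      using w \<open>t < z\<close> by (simp add: field_simps)
    then have "H t + ?k * (w - t) \<le> H w"
      using \<open>t < z\<close> by (simp add: field_simps)
    also have "H w \<le> M w"
    proof -
      have "0 \<le> a * w\<^sup>2 * q2 w"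
        using q2_nonneg[of w] a w by (intro mult_nonneg_nonneg) simp_all
      then show ?thesis using M_minus_H[of w] w st by simp
    qed
    finally show "- M w \<le> - M t + - ?k * (w - t)"
      using \<open>M t = H t\<close> by simp
  qed (use st in simp)
  then show False using \<open>?k < 0\<close> q1_end q2_end by simp
qed

end

section \<open>Duality between a utility function and its conjugate\<close>

locale utility_function =
  fixes u :: "real \<Rightarrow> real"
  assumes util: "utility u"
begin

lemma u_has_deriv: "x > 0 \<Longrightarrow> (u has_real_derivative deriv u x) (at x)"
  using util unfolding utility_def C1_differentiable_on_eq
  by (auto simp: DERIV_deriv_iff_real_differentiable)

lemma continuous_on_deriv_u: "continuous_on {0<..} (deriv u)"
proof -
  have "continuous_on {0<..} (\<lambda>x. vector_derivative u (at x))"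
    using util unfolding utility_def C1_differentiable_on_eq by blast
  moreover have "vector_derivative u (at x) = deriv u x" if "x \<in> {0<..}" for x
    using u_has_deriv[of x] that
    by (auto intro!: vector_derivative_at simp: has_real_derivative_iff_has_vector_derivative)
  ultimately show ?thesis
    using continuous_on_eq by blast
qed

text \<open>Strict concavity puts the graph strictly below each tangent; the midpoint of the chord
  supplies the strictness.\<close>

lemma u_less_tangent:
  assumes "c > 0" "x \<ge> 0" "x \<noteq> c"
  shows "u x < u c + deriv u c * (x - c)"
proof -
  have sc: "strictly_convex_on {0..} (\<lambda>x. - u x)"
    using util unfolding utility_def strictly_concave_on_def by blast
  have cvx: "convex_on {0..} (\<lambda>x. - u x)"
  proof (rule convex_onI)
    fix t x y :: real
    assume "0 < t" "t < 1" "x \<in> {0..}" "y \<in> {0..}"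
    then show "- u ((1 - t) *\<^sub>R x + t *\<^sub>R y) \<le> (1 - t) * - u x + t * - u y"
    proof (cases "x = y")
      case True
      then show ?thesis by (simp add: algebra_simps)
    next
      case False
      then show ?thesis
        using sc \<open>0 < t\<close> \<open>t < 1\<close> \<open>x \<in> {0..}\<close> \<open>y \<in> {0..}\<close>
        unfolding strictly_convex_on_def by (intro less_imp_le) blast
    qed
  qed simp
  have tangent: "u m \<le> u c + deriv u c * (m - c)" if "m \<ge> 0" for m
  proof -
    have d: "((\<lambda>x. - u x) has_real_derivative - deriv u c) (at c within {0..})"
      by (rule DERIV_subset[OF DERIV_minus[OF u_has_deriv[OF assms(1)]]]) simp
    have "- u m - - u c \<ge> - deriv u c * (m - c)"
      by (rule convex_on_imp_above_tangent[OF cvx _ _ _ d])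
        (use assms that in \<open>auto simp: interior_real_atLeast\<close>)
    then show ?thesis by simp
  qed
  have "- u ((1 - 1/2) *\<^sub>R c + (1/2) *\<^sub>R x) < (1 - 1/2) * - u c + (1/2) * - u x"
    using sc[unfolded strictly_convex_on_def, THEN conjunct2, rule_format, of c x "1/2"] assms
    by simp
  then have "u c + u x < 2 * u ((c + x) / 2)"
    by (simp add: field_simps)
  also have "\<dots> \<le> 2 * (u c + deriv u c * ((c + x) / 2 - c))"
    using tangent[of "(c + x) / 2"] assms by simp
  finally show ?thesis by (simp add: field_simps)
qed

lemma deriv_u_strict_antimono:
  assumes "0 < x" "x < y"
  shows "deriv u y < deriv u x"
proof -
  have "u y < u x + deriv u x * (y - x)" "u x < u y + deriv u y * (x - y)"
    using u_less_tangent[of x y] u_less_tangent[of y x] assms by auto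
  then have "0 < (deriv u x - deriv u y) * (y - x)" by (simp add: algebra_simps)
  then show ?thesis using assms by (simp add: zero_less_mult_iff)
qed

lemma deriv_u_tendsto_0: "(deriv u \<longlongrightarrow> 0) at_top"
  using util unfolding utility_def by blast

lemma deriv_u_pos: assumes "x > 0" shows "deriv u x > 0"
proof -
  have "eventually (\<lambda>t. deriv u t \<le> deriv u (x + 1)) at_top"
    using eventually_gt_at_top[of "x + 1"]
    by eventually_elim (use deriv_u_strict_antimono[of "x+1"] assms in \<open>force intro: less_imp_le\<close>)
  then have "0 \<le> deriv u (x + 1)"
    using tendsto_upperbound[OF deriv_u_tendsto_0] by simp
  then show ?thesis using deriv_u_strict_antimono[of x "x+1"] assms by simp
qed

text \<open>\<open>u'\<close> is monotone, so its limit at 0 is its supremum.\<close>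

lemma less_marginal_at_0_iff: "ereal y < marginal_at_0 u \<longleftrightarrow> (\<exists>c>0. y < deriv u c)"
proof -
  have "((\<lambda>c. ereal (deriv u c)) \<longlongrightarrow> (SUP c\<in>{0<..}. ereal (deriv u c))) (at_right 0)"
  proof (rule order_tendstoI)
    fix a assume "a < (SUP c\<in>{0<..}. ereal (deriv u c))"
    then obtain c where c: "c > 0" "a < ereal (deriv u c)" by (auto simp: less_SUP_iff)
    then show "eventually (\<lambda>c. a < ereal (deriv u c)) (at_right 0)"
      unfolding eventually_at_right_field
      by (intro exI[of _ c] conjI allI impI)
        (auto intro: less_trans[OF c(2)] simp: deriv_u_strict_antimono)
  next
    fix a assume a: "(SUP c\<in>{0<..}. ereal (deriv u c)) < a"
    show "eventually (\<lambda>c. ereal (deriv u c) < a) (at_right 0)"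
      unfolding eventually_at_right_field
      by (intro exI[of _ 1] conjI allI impI le_less_trans[OF SUP_upper a]) auto
  qed
  then have "marginal_at_0 u = (SUP c\<in>{0<..}. ereal (deriv u c))"
    unfolding marginal_at_0_def by (intro tendsto_Lim) auto
  then show ?thesis by (auto simp: less_SUP_iff)
qed

text \<open>All properties of \<open>I\<close> rest on this alternative: either \<open>I y\<close> is the critical point
  of \<open>c \<mapsto> u c - y c\<close>, or there is no critical point and the maximum sits at \<open>c = 0\<close>.\<close>

lemma inv_marginal_cases:
  assumes "y > 0"
  obtains (interior) "inv_marginal u y > 0" "deriv u (inv_marginal u y) = y"
  | (corner) "inv_marginal u y = 0" "\<And>c. c > 0 \<Longrightarrow> deriv u c < y"
proof (cases "ereal y < marginal_at_0 u")
  case True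
  then obtain a where a: "a > 0" "y < deriv u a" by (auto simp: less_marginal_at_0_iff)
  have "eventually (\<lambda>t. deriv u t < y \<and> t > a) at_top"
    using order_tendstoD(2)[OF deriv_u_tendsto_0 assms] eventually_gt_at_top[of a]
    by eventually_elim auto
  then obtain b where b: "deriv u b < y" "b > a"
    using eventually_happens[of _ "at_top :: real filter"] by auto
  have "\<exists>c. a \<le> c \<and> c \<le> b \<and> deriv u c = y"
    by (rule IVT2') (use a b in \<open>auto intro!: continuous_on_subset[OF continuous_on_deriv_u]\<close>)
  then obtain c where c: "a \<le> c" "deriv u c = y" by blast
  have inj: "inj_on (deriv u) {0<..}"
    by (rule linorder_inj_onI) (use deriv_u_strict_antimono in \<open>force+\<close>)
  have "inv_marginal u y = c"
    unfolding inv_marginal_def using True c a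
    by (auto intro!: the_inv_into_f_eq[OF inj])
  then show ?thesis using c a interior by auto
next
  case False
  then have le: "deriv u c \<le> y" if "c > 0" for c
    using that less_marginal_at_0_iff not_less by blast
  have "deriv u c < y" if "c > 0" for c
    using deriv_u_strict_antimono[of "c/2" c] le[of "c/2"] that by simp
  moreover have "inv_marginal u y = 0"
    using False by (simp add: inv_marginal_def)
  ultimately show ?thesis using corner by blast
qed

lemma inv_marginal_nonneg: "y > 0 \<Longrightarrow> inv_marginal u y \<ge> 0"
  by (cases y rule: inv_marginal_cases) auto

text \<open>\<open>I\<close> inverts the strictly decreasing \<open>u'\<close> in the sense of the next two equivalences, which cover
  the interior and the corner case at once. Monotonicity, continuity and the limit of \<open>I\<close> at 0
  are read off from them.\<close>

lemma inv_marginal_less_iff: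
  assumes "y > 0" "x > 0" shows "inv_marginal u y < x \<longleftrightarrow> deriv u x < y"
  using assms(1)
proof (cases rule: inv_marginal_cases)
  case interior
  then show ?thesis using deriv_u_strict_antimono[of "inv_marginal u y" x]
    deriv_u_strict_antimono[of x "inv_marginal u y"] assms
    by (cases "inv_marginal u y" x rule: linorder_cases) auto
qed (use assms in auto)

lemma less_inv_marginal_iff:
  assumes "y > 0" "x > 0" shows "x < inv_marginal u y \<longleftrightarrow> y < deriv u x"
  using assms(1)
proof (cases rule: inv_marginal_cases)
  case interior
  then show ?thesis using deriv_u_strict_antimono[of "inv_marginal u y" x]
    deriv_u_strict_antimono[of x "inv_marginal u y"] assms
    by (cases "inv_marginal u y" x rule: linorder_cases) auto
qed (use assms in force)

lemma inv_marginal_antimono: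
  assumes "0 < y" "y \<le> z" shows "inv_marginal u z \<le> inv_marginal u y"
proof (rule ccontr)
  assume "\<not> ?thesis"
  then obtain x where x: "inv_marginal u y < x" "x < inv_marginal u z"
    using dense by (metis not_le)
  then have "x > 0" using inv_marginal_nonneg[of y] assms by linarith
  then have "deriv u x < y" "z < deriv u x"
    using x assms by (auto simp: inv_marginal_less_iff less_inv_marginal_iff)
  then show False using assms by simp
qed

lemma inv_marginal_strict:
  assumes "0 < y" "y < z" "inv_marginal u y > 0"
  shows "inv_marginal u z < inv_marginal u y"
proof -
  have "deriv u (inv_marginal u y) = y"
    using assms(1) by (cases rule: inv_marginal_cases) (use assms in auto)
  then show ?thesis using assms by (simp add: inv_marginal_less_iff)
qed

lemma isCont_inv_marginal: assumes "y > 0" shows "isCont (inv_marginal u) y"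
  unfolding isCont_def
proof (rule order_tendstoI)
  have ev: "eventually (\<lambda>z. z > 0) (at y)"
    using order_tendstoD(1)[OF tendsto_ident_at assms] .
  fix a assume a: "a < inv_marginal u y"
  show "eventually (\<lambda>z. a < inv_marginal u z) (at y)"
  proof (cases "a < 0")
    case True
    show ?thesis using ev
      by eventually_elim (use True inv_marginal_nonneg in force)
  next
    case False
    with a dense[OF a] obtain x where x: "a < x" "x < inv_marginal u y" "x > 0" by auto
    then have "y < deriv u x" using assms by (simp add: less_inv_marginal_iff)
    then have "eventually (\<lambda>z. z < deriv u x) (at y)"
      using order_tendstoD(2)[OF tendsto_ident_at] by blast
    then show ?thesis using ev
      by eventually_elim (use x less_inv_marginal_iff in force)
  qed
next
  have ev: "eventually (\<lambda>z. z > 0) (at y)"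
    using order_tendstoD(1)[OF tendsto_ident_at assms] .
  fix a assume a: "inv_marginal u y < a"
  then have "a > 0" using inv_marginal_nonneg[OF assms] by linarith
  then have "deriv u a < y" using a assms by (simp add: inv_marginal_less_iff)
  then have "eventually (\<lambda>z. deriv u a < z) (at y)"
    using order_tendstoD(1)[OF tendsto_ident_at] by blast
  then show "eventually (\<lambda>z. inv_marginal u z < a) (at y)" using ev
    by eventually_elim (use \<open>a > 0\<close> inv_marginal_less_iff in force)
qed

lemma inv_marginal_at_0: "filterlim (inv_marginal u) at_top (at_right 0)"
  unfolding filterlim_at_top_gt[of _ _ 0]
proof (intro allI impI)
  fix x :: real assume "x > 0"
  show "eventually (\<lambda>y. x \<le> inv_marginal u y) (at_right 0)"
    unfolding eventually_at_right_field
    using less_inv_marginal_iff[of _ x] deriv_u_pos[OF \<open>x > 0\<close>] \<open>x > 0\<close>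
    by (intro exI[of _ "deriv u x"]) (auto intro: less_imp_le)
qed

text \<open>The supremum defining the dual utility is attained at \<open>I y\<close>: in the interior case by the
  tangent at \<open>I y\<close>, in the corner case because \<open>c \<mapsto> u c - y c\<close> decreases.\<close>

lemma inv_marginal_maximizes:
  assumes "y > 0" "c \<ge> 0"
  shows "u c - y * c \<le> u (inv_marginal u y) - y * inv_marginal u y"
  using assms(1)
proof (cases rule: inv_marginal_cases)
  case interior
  then show ?thesis
    using u_less_tangent[of "inv_marginal u y" c] assms
    by (cases "c = inv_marginal u y") (auto simp: algebra_simps)
next
  case corner
  show ?thesis
  proof (cases "c = 0")
    case False
    then have "c > 0" using assms by simp
    have cont: "continuous_on {0..c} u"
      using util continuous_on_subset unfolding utility_def by (metis atLeastAtMost_iff atLeast_iff subsetI)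
    obtain l z where z: "0 < z" "z < c" "(u has_real_derivative l) (at z)" "u c - u 0 = (c - 0) * l"
      using MVT[OF \<open>c > 0\<close> cont] u_has_deriv real_differentiable_def by blast
    have "l = deriv u z" using z u_has_deriv[of z] DERIV_unique by blast
    then have "l \<le> y" using corner(2)[of z] z by simp
    then have "c * l \<le> c * y" using \<open>c > 0\<close> by simp
    then show ?thesis using z corner by (simp add: algebra_simps)
  qed (use corner in simp)
qed

lemma dual_utility_eq:
  assumes "y > 0"
  shows "dual_utility u y = u (inv_marginal u y) - y * inv_marginal u y"
  unfolding dual_utility_def
  by (rule cSup_eq_maximum)
    (use assms inv_marginal_maximizes inv_marginal_nonneg in auto)

lemma dual_utility_ge_u0: "y > 0 \<Longrightarrow> u 0 \<le> dual_utility u y"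
  using inv_marginal_maximizes[of y 0] by (simp add: dual_utility_eq)

lemma dual_utility_subgradient:
  assumes "y > 0" "z > 0"
  shows "dual_utility u z \<ge> dual_utility u y - (z - y) * inv_marginal u y"
  using inv_marginal_maximizes[of z "inv_marginal u y"] assms inv_marginal_nonneg[of y]
  by (simp add: dual_utility_eq algebra_simps)

text \<open>Since \<open>- I\<close> is a subgradient of the dual utility at every point and is continuous, it is
  the derivative.\<close>

lemma dual_utility_has_deriv:
  assumes "y > 0"
  shows "(dual_utility u has_real_derivative - inv_marginal u y) (at y)"
  unfolding has_field_derivative_iff
proof -
  let ?q = "\<lambda>z. (dual_utility u z - dual_utility u y) / (z - y)"
  have lim: "((\<lambda>z. - inv_marginal u z) \<longlongrightarrow> - inv_marginal u y) (at y)"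
    using isCont_inv_marginal[OF assms] unfolding isCont_def by (rule tendsto_minus)
  have ev: "eventually (\<lambda>z. z > 0 \<and> z \<noteq> y) (at y)"
    using order_tendstoD(1)[OF tendsto_ident_at[of y UNIV] assms] eventually_neq_at_within[of y y UNIV]
    by eventually_elim auto
  have lo: "eventually (\<lambda>z. min (- inv_marginal u y) (- inv_marginal u z) \<le> ?q z) (at y)"
    using ev
  proof eventually_elim
    case (elim z)
    then show ?case
      using dual_utility_subgradient[of y z] dual_utility_subgradient[of z y] assms
      by (cases "z < y") (auto simp: min_le_iff_disj field_simps)
  qed
  have hi: "eventually (\<lambda>z. ?q z \<le> max (- inv_marginal u y) (- inv_marginal u z)) (at y)"
    using ev
  proof eventually_elim
    case (elim z)
    then show ?case
      using dual_utility_subgradient[of y z] dual_utility_subgradient[of z y] assms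
      by (cases "z < y") (auto simp: le_max_iff_disj field_simps)
  qed
  show "(?q \<longlongrightarrow> - inv_marginal u y) (at y)"
    by (rule tendsto_sandwich[OF lo hi])
      (use tendsto_min[OF tendsto_const lim, of "- inv_marginal u y"]
        tendsto_max[OF tendsto_const lim, of "- inv_marginal u y"] in auto)
qed

end

section \<open>The Euler operator and variation of constants\<close>

locale euler_operator =
  fixes \<theta> \<delta> r n\<^sub>1 n\<^sub>2 :: real
  assumes \<theta>: "\<theta> \<noteq> 0" and \<delta>: "\<delta> > 0" and r: "r > 0" and n1: "n\<^sub>1 > 0" and n2: "n\<^sub>2 < 0"
    and root1: "\<theta>\<^sup>2 / 2 * n\<^sub>1\<^sup>2 + (\<delta> - r - \<theta>\<^sup>2 / 2) * n\<^sub>1 - \<delta> = 0"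
    and root2: "\<theta>\<^sup>2 / 2 * n\<^sub>2\<^sup>2 + (\<delta> - r - \<theta>\<^sup>2 / 2) * n\<^sub>2 - \<delta> = 0"
begin

text \<open>The normalisation of the Green function of \<open>L\<close>.\<close>

definition C :: real where "C = 2 / (\<theta>\<^sup>2 * (n\<^sub>1 - n\<^sub>2))"

lemma C_pos: "C > 0"
  unfolding C_def using \<theta> n1 n2 by (intro divide_pos_pos mult_pos_pos) auto

lemma half_theta_sq_C: "\<theta>\<^sup>2 / 2 * (C * (n\<^sub>1 - n\<^sub>2)) = 1"
  unfolding C_def using \<theta> n1 n2 by (simp add: field_simps)

lemma vieta:
  shows "\<theta>\<^sup>2 / 2 * (n\<^sub>1 + n\<^sub>2) = - (\<delta> - r - \<theta>\<^sup>2 / 2)" and "\<theta>\<^sup>2 / 2 * (n\<^sub>1 * n\<^sub>2) = - \<delta>"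
proof -
  have "(n\<^sub>1 - n\<^sub>2) * (\<theta>\<^sup>2 / 2 * (n\<^sub>1 + n\<^sub>2) + (\<delta> - r - \<theta>\<^sup>2 / 2))
      = (\<theta>\<^sup>2 / 2 * n\<^sub>1\<^sup>2 + (\<delta> - r - \<theta>\<^sup>2 / 2) * n\<^sub>1 - \<delta>)
        - (\<theta>\<^sup>2 / 2 * n\<^sub>2\<^sup>2 + (\<delta> - r - \<theta>\<^sup>2 / 2) * n\<^sub>2 - \<delta>)"
    by (simp add: field_simps power2_eq_square)
  then show *: "\<theta>\<^sup>2 / 2 * (n\<^sub>1 + n\<^sub>2) = - (\<delta> - r - \<theta>\<^sup>2 / 2)"
    unfolding root1 root2 using n1 n2 by (simp add: eq_neg_iff_add_eq_0)
  have "\<theta>\<^sup>2 / 2 * (n\<^sub>1 * n\<^sub>2) = n\<^sub>1 * (\<theta>\<^sup>2 / 2 * (n\<^sub>1 + n\<^sub>2)) - \<theta>\<^sup>2 / 2 * n\<^sub>1\<^sup>2"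
    by (simp add: field_simps power2_eq_square)
  then show "\<theta>\<^sup>2 / 2 * (n\<^sub>1 * n\<^sub>2) = - \<delta>"
    unfolding * using root1 by (simp add: algebra_simps)
qed

text \<open>The characteristic polynomial takes the value \<open>- r < 0\<close> at 1.\<close>

lemma n1_gt_1: "n\<^sub>1 > 1"
proof -
  have "\<theta>\<^sup>2 / 2 * ((1 - n\<^sub>1) * (1 - n\<^sub>2))
      = \<theta>\<^sup>2 / 2 - \<theta>\<^sup>2 / 2 * (n\<^sub>1 + n\<^sub>2) + \<theta>\<^sup>2 / 2 * (n\<^sub>1 * n\<^sub>2)"
    by algebra
  then have "\<theta>\<^sup>2 / 2 * ((1 - n\<^sub>1) * (1 - n\<^sub>2)) = - r" unfolding vieta by simp
  moreover have "\<theta>\<^sup>2 / 2 * ((1 - n\<^sub>1) * (1 - n\<^sub>2)) \<ge> 0" if "n\<^sub>1 \<le> 1"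
    using that n2 by (intro mult_nonneg_nonneg) auto
  ultimately show ?thesis using r by linarith
qed

text \<open>The continuous functions whose Green potential exists.\<close>

definition admissible :: "(real \<Rightarrow> real) \<Rightarrow> bool" where
  "admissible F \<longleftrightarrow> continuous_on {0<..} F \<and>
     (\<forall>z>0. set_integrable lborel {0<..z} (\<lambda>x. x powr (- n\<^sub>2 - 1) * F x)) \<and>
     (\<forall>z>0. set_integrable lborel {z<..} (\<lambda>x. x powr (- n\<^sub>1 - 1) * F x))"

abbreviation lo :: "(real \<Rightarrow> real) \<Rightarrow> real \<Rightarrow> real" where
  "lo F z \<equiv> LINT x:{0<..z}|lborel. x powr (- n\<^sub>2 - 1) * F x"

abbreviation up :: "(real \<Rightarrow> real) \<Rightarrow> real \<Rightarrow> real" where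
  "up F z \<equiv> LINT x:{z<..}|lborel. x powr (- n\<^sub>1 - 1) * F x"

lemma admissible_add:
  assumes "admissible F" "admissible G"
  shows "admissible (\<lambda>x. F x + G x)"
    and "z > 0 \<Longrightarrow> lo (\<lambda>x. F x + G x) z = lo F z + lo G z"
    and "z > 0 \<Longrightarrow> up (\<lambda>x. F x + G x) z = up F z + up G z"
proof -
  show "admissible (\<lambda>x. F x + G x)"
    unfolding admissible_def distrib_left
  proof (intro conjI allI impI)
    show "continuous_on {0<..} (\<lambda>x. F x + G x)"
      using assms unfolding admissible_def by (intro continuous_on_add) blast+
    fix z :: real assume "z > 0"
    show "set_integrable lborel {0<..z} (\<lambda>x. x powr (- n\<^sub>2 - 1) * F x + x powr (- n\<^sub>2 - 1) * G x)"
      using assms \<open>z > 0\<close> unfolding admissible_def by (intro set_integral_add(1)) blast+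
    show "set_integrable lborel {z<..} (\<lambda>x. x powr (- n\<^sub>1 - 1) * F x + x powr (- n\<^sub>1 - 1) * G x)"
      using assms \<open>z > 0\<close> unfolding admissible_def by (intro set_integral_add(1)) blast+
  qed
  show "lo (\<lambda>x. F x + G x) z = lo F z + lo G z" if "z > 0"
    unfolding distrib_left using assms that unfolding admissible_def by (intro set_integral_add(2)) blast+
  show "up (\<lambda>x. F x + G x) z = up F z + up G z" if "z > 0"
    unfolding distrib_left using assms that unfolding admissible_def by (intro set_integral_add(2)) blast+
qed

lemma admissible_cong:
  assumes "\<And>x. x > 0 \<Longrightarrow> F x = G x"
  shows "admissible F \<longleftrightarrow> admissible G"
proof -
  have "continuous_on {0<..} F \<longleftrightarrow> continuous_on {0<..} G"
    by (rule continuous_on_cong) (use assms in auto)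
  moreover have "set_integrable lborel {0<..z} (\<lambda>x. x powr (- n\<^sub>2 - 1) * F x) \<longleftrightarrow>
      set_integrable lborel {0<..z} (\<lambda>x. x powr (- n\<^sub>2 - 1) * G x)" for z
    by (rule set_integrable_cong) (use assms in auto)
  moreover have "set_integrable lborel {z<..} (\<lambda>x. x powr (- n\<^sub>1 - 1) * F x) \<longleftrightarrow>
      set_integrable lborel {z<..} (\<lambda>x. x powr (- n\<^sub>1 - 1) * G x)" if "z > 0" for z
    by (rule set_integrable_cong) (use assms that in auto)
  ultimately show ?thesis unfolding admissible_def by auto
qed

text \<open>The solution of \<open>L y = - F\<close> by variation of constants: the coefficients of \<open>z powr n\<^sub>1\<close>
  and \<open>z powr n\<^sub>2\<close> vary so that their derivatives contribute nothing to \<open>y'\<close>. The function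
  \<open>J\<^sub>R\<close>, the middle piece of \<open>\<Q>\<close> and the difference of the two have this form, with \<open>sol1\<close> and \<open>sol2\<close>
  as their first two derivatives.\<close>

definition sol :: "real \<Rightarrow> real \<Rightarrow> (real \<Rightarrow> real) \<Rightarrow> real \<Rightarrow> real" where
  "sol A B F z = (A + C * up F z) * z powr n\<^sub>1 + (B + C * lo F z) * z powr n\<^sub>2"

definition sol1 :: "real \<Rightarrow> real \<Rightarrow> (real \<Rightarrow> real) \<Rightarrow> real \<Rightarrow> real" where
  "sol1 A B F z = ((A + C * up F z) * (n\<^sub>1 * z powr n\<^sub>1) + (B + C * lo F z) * (n\<^sub>2 * z powr n\<^sub>2)) / z"

definition sol2 :: "real \<Rightarrow> real \<Rightarrow> (real \<Rightarrow> real) \<Rightarrow> real \<Rightarrow> real" where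
  "sol2 A B F z = ((A + C * up F z) * (n\<^sub>1 * (n\<^sub>1 - 1) * z powr n\<^sub>1)
     + (B + C * lo F z) * (n\<^sub>2 * (n\<^sub>2 - 1) * z powr n\<^sub>2) - C * (n\<^sub>1 - n\<^sub>2) * F z) / z\<^sup>2"

lemma green_potential_eq_sol: "green_potential \<theta> n\<^sub>1 n\<^sub>2 F z = sol 0 0 F z"
  unfolding green_potential_def sol_def C_def by (simp add: algebra_simps)

lemma powr_neg_minus_1: "z > 0 \<Longrightarrow> z powr (- n - 1) = inverse (z powr n) / z" for z n :: real
  by (simp add: powr_diff powr_minus)

lemma powr_minus_1: "z > 0 \<Longrightarrow> z powr (n - 1) = z powr n / z" for z n :: real
  by (simp add: powr_diff)

context
  fixes F :: "real \<Rightarrow> real"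
  assumes F: "admissible F"
begin

lemma isCont_forcing: "z > 0 \<Longrightarrow> isCont F z"
  using F unfolding admissible_def by (simp add: continuous_on_eq_continuous_at)

lemma up_has_deriv: "z > 0 \<Longrightarrow> (up F has_real_derivative - (inverse (z powr n\<^sub>1) / z * F z)) (at z)"
  using upper_integral_has_deriv[OF _ _ isCont_mult[OF isCont_powr_const isCont_forcing], of "- n\<^sub>1 - 1" z] F
  unfolding admissible_def by (simp add: powr_neg_minus_1)

lemma lo_has_deriv: "z > 0 \<Longrightarrow> (lo F has_real_derivative inverse (z powr n\<^sub>2) / z * F z) (at z)"
  using lower_integral_has_deriv[OF _ _ isCont_mult[OF isCont_powr_const isCont_forcing], of "- n\<^sub>2 - 1" z] F
  unfolding admissible_def by (simp add: powr_neg_minus_1)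

lemma powr_has_deriv: "z > 0 \<Longrightarrow> ((\<lambda>z. z powr n) has_real_derivative n * z powr n / z) (at z)"
  for z n :: real
  using has_real_derivative_powr[of z n] by (simp add: powr_minus_1)

lemma sol_has_deriv:
  assumes "z > 0"
  shows "(sol A B F has_real_derivative sol1 A B F z) (at z)"
proof -
  have alg: "C * - (inverse P / z * f) * P + n\<^sub>1 * P / z * X + (C * (inverse R / z * f) * R + n\<^sub>2 * R / z * Y)
      = (X * (n\<^sub>1 * P) + Y * (n\<^sub>2 * R)) / z" if "P \<noteq> 0" "R \<noteq> 0" for P R X Y f
    using that assms by (simp add: field_simps)
  have "(sol A B F has_real_derivative
      C * - (inverse (z powr n\<^sub>1) / z * F z) * z powr n\<^sub>1 + n\<^sub>1 * z powr n\<^sub>1 / z * (A + C * up F z)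
      + (C * (inverse (z powr n\<^sub>2) / z * F z) * z powr n\<^sub>2 + n\<^sub>2 * z powr n\<^sub>2 / z * (B + C * lo F z))) (at z)"
    unfolding sol_def[abs_def]
    by (intro DERIV_add DERIV_mult DERIV_cmult up_has_deriv lo_has_deriv powr_has_deriv assms
        DERIV_add[OF DERIV_const, of _ _ _ _ A, simplified] DERIV_add[OF DERIV_const, of _ _ _ _ B, simplified])
  then show ?thesis unfolding sol1_def using assms by (subst (asm) alg) simp_all
qed

lemma sol1_has_deriv:
  assumes "z > 0"
  shows "(sol1 A B F has_real_derivative sol2 A B F z) (at z)"
proof -
  have alg: "((C * - (inverse P / z * f) * (n\<^sub>1 * P) + n\<^sub>1 * (n\<^sub>1 * P / z) * X
      + (C * (inverse R / z * f) * (n\<^sub>2 * R) + n\<^sub>2 * (n\<^sub>2 * R / z) * Y)) * z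
      - (X * (n\<^sub>1 * P) + Y * (n\<^sub>2 * R)) * 1) / (z * z)
      = (X * (n\<^sub>1 * (n\<^sub>1 - 1) * P) + Y * (n\<^sub>2 * (n\<^sub>2 - 1) * R) - C * (n\<^sub>1 - n\<^sub>2) * f) / z\<^sup>2"
    if "P \<noteq> 0" "R \<noteq> 0" for P R X Y f
    using that assms by (simp add: field_simps power2_eq_square)
  have "(sol1 A B F has_real_derivative
      ((C * - (inverse (z powr n\<^sub>1) / z * F z) * (n\<^sub>1 * z powr n\<^sub>1) + n\<^sub>1 * (n\<^sub>1 * z powr n\<^sub>1 / z) * (A + C * up F z)
      + (C * (inverse (z powr n\<^sub>2) / z * F z) * (n\<^sub>2 * z powr n\<^sub>2) + n\<^sub>2 * (n\<^sub>2 * z powr n\<^sub>2 / z) * (B + C * lo F z))) * z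
      - ((A + C * up F z) * (n\<^sub>1 * z powr n\<^sub>1) + (B + C * lo F z) * (n\<^sub>2 * z powr n\<^sub>2)) * 1) / (z * z)) (at z)"
    unfolding sol1_def[abs_def]
    by (intro DERIV_divide DERIV_add DERIV_mult DERIV_cmult up_has_deriv lo_has_deriv powr_has_deriv assms DERIV_ident
        DERIV_add[OF DERIV_const, of _ _ _ _ A, simplified] DERIV_add[OF DERIV_const, of _ _ _ _ B, simplified])
      (use assms in simp)
  then show ?thesis unfolding sol2_def using assms by (subst (asm) alg) simp_all
qed

lemma continuous_on_sol2: "continuous_on {0<..} (sol2 A B F)"
proof (rule continuous_at_imp_continuous_on, rule ballI)
  fix z :: real assume "z \<in> {0<..}"
  then have z: "z > 0" by simp
  show "isCont (sol2 A B F) z"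
    unfolding sol2_def[abs_def]
    by (intro isCont_divide isCont_add isCont_diff isCont_mult continuous_const isCont_powr_const[OF z]
        isCont_forcing[OF z] DERIV_isCont[OF up_has_deriv[OF z]] DERIV_isCont[OF lo_has_deriv[OF z]]
        continuous_power continuous_ident)
      (use z in auto)
qed

lemma sol_ode:
  assumes "z > 0"
  shows "\<theta>\<^sup>2 / 2 * z\<^sup>2 * sol2 A B F z + (\<delta> - r) * z * sol1 A B F z - \<delta> * sol A B F z + F z = 0"
proof -
  let ?A = "(A + C * up F z) * z powr n\<^sub>1" and ?B = "(B + C * lo F z) * z powr n\<^sub>2"
  have 2: "z\<^sup>2 * sol2 A B F z = ?A * (n\<^sub>1 * (n\<^sub>1 - 1)) + ?B * (n\<^sub>2 * (n\<^sub>2 - 1)) - C * (n\<^sub>1 - n\<^sub>2) * F z"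
    using assms unfolding sol2_def by simp
  have 1: "z * sol1 A B F z = ?A * n\<^sub>1 + ?B * n\<^sub>2"
    using assms unfolding sol1_def by simp
  have 0: "sol A B F z = ?A + ?B" unfolding sol_def ..
  have "\<theta>\<^sup>2 / 2 * (z\<^sup>2 * sol2 A B F z) + (\<delta> - r) * (z * sol1 A B F z) - \<delta> * sol A B F z + F z =
     ?A * (\<theta>\<^sup>2 / 2 * n\<^sub>1\<^sup>2 + (\<delta> - r - \<theta>\<^sup>2 / 2) * n\<^sub>1 - \<delta>)
     + ?B * (\<theta>\<^sup>2 / 2 * n\<^sub>2\<^sup>2 + (\<delta> - r - \<theta>\<^sup>2 / 2) * n\<^sub>2 - \<delta>)
     + (1 - \<theta>\<^sup>2 / 2 * (C * (n\<^sub>1 - n\<^sub>2))) * F z"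
    unfolding 0 1 2 by (simp add: algebra_simps power2_eq_square)
  then show ?thesis using root1 root2 half_theta_sq_C by (simp add: mult.assoc)
qed

end

lemma set_integrable_lower_linear:
  "z > 0 \<Longrightarrow> set_integrable lborel {0<..z} (\<lambda>x. x powr (- n\<^sub>2 - 1) * (e * x))"
proof -
  assume "z > 0"
  then have "set_integrable lborel {0<..z} (\<lambda>x. e * x powr (- n\<^sub>2))"
    using n2 by (intro set_integrable_mult_right set_integrable_powr_lower) auto
  then show ?thesis
    by (subst set_integrable_cong[OF refl refl, of _ _ "\<lambda>x. e * x powr (- n\<^sub>2)"])
      (auto simp: powr_diff)
qed

lemma set_integrable_upper_linear:
  "z > 0 \<Longrightarrow> set_integrable lborel {z<..} (\<lambda>x. x powr (- n\<^sub>1 - 1) * (e * x))"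
proof -
  assume "z > 0"
  then have "set_integrable lborel {z<..} (\<lambda>x. e * x powr (- n\<^sub>1))"
    using n1_gt_1 by (intro set_integrable_mult_right set_integrable_powr_upper) auto
  then show ?thesis
    by (subst set_integrable_cong[OF refl refl, of _ _ "\<lambda>x. e * x powr (- n\<^sub>1)"])
      (use \<open>z > 0\<close> in \<open>auto simp: powr_diff\<close>)
qed

lemma admissible_linear: "admissible (\<lambda>x. e * x)"
  unfolding admissible_def
  by (auto intro!: continuous_intros simp: set_integrable_lower_linear set_integrable_upper_linear
      simp del: set_integrable_mult_right_iff)

lemma admissible_minus: "admissible F \<Longrightarrow> admissible (\<lambda>x. - F x)"
  unfolding admissible_def by (auto intro!: continuous_on_minus set_integrable_minus)

lemma powr_mult_tendsto_0_at_top: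
  assumes "\<And>x. x \<ge> 1 \<Longrightarrow> \<bar>G x\<bar> \<le> K * x"
  shows "((\<lambda>x. x powr (- n\<^sub>1) * G x) \<longlongrightarrow> 0) at_top"
proof (rule Lim_null_comparison)
  show "eventually (\<lambda>x. norm (x powr (- n\<^sub>1) * G x) \<le> x powr (1 - n\<^sub>1) * K) at_top"
    using eventually_ge_at_top[of 1]
  proof eventually_elim
    case (elim x)
    have "norm (x powr (- n\<^sub>1) * G x) \<le> x powr (- n\<^sub>1) * (K * x)"
      using assms[OF elim] by (simp add: abs_mult mult_left_mono)
    also have "\<dots> = x powr (1 - n\<^sub>1) * K"
      using elim by (simp add: powr_diff powr_minus field_simps)
    finally show ?case .
  qed
  have "((\<lambda>x. x powr (1 - n\<^sub>1)) \<longlongrightarrow> 0) at_top"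
    using n1_gt_1 by (intro tendsto_neg_powr filterlim_ident) auto
  then show "((\<lambda>x. x powr (1 - n\<^sub>1) * K) \<longlongrightarrow> 0) at_top"
    by (rule tendsto_mult_left_zero)
qed

end

section \<open>The value of immediate retirement\<close>

locale retirement = utility_function u + euler_operator \<theta> \<delta> r n\<^sub>1 n\<^sub>2
  for u :: "real \<Rightarrow> real" and \<theta> \<delta> r n\<^sub>1 n\<^sub>2 +
  assumes integrable_I: "y > 0 \<Longrightarrow> set_integrable lborel {0<..y} (\<lambda>x. x powr (- n\<^sub>2) * inv_marginal u x)"
begin

abbreviation I :: "real \<Rightarrow> real" where "I \<equiv> inv_marginal u"
abbreviation ut :: "real \<Rightarrow> real" where "ut \<equiv> dual_utility u"

lemma ut_antimono: "0 < z \<Longrightarrow> z \<le> y \<Longrightarrow> ut y \<le> ut z"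
  using dual_utility_subgradient[of y z] inv_marginal_nonneg[of y]
    mult_nonneg_nonneg[of "y - z" "I y"] by (simp add: algebra_simps)

lemma isCont_ut: "z > 0 \<Longrightarrow> isCont ut z"
  by (rule DERIV_isCont[OF dual_utility_has_deriv])

lemma continuous_on_ut: "continuous_on {0<..} ut"
  by (simp add: continuous_on_eq_continuous_at isCont_ut)

lemma continuous_on_I: "continuous_on {0<..} I"
  by (simp add: continuous_on_eq_continuous_at isCont_inv_marginal)

lemma powr_tendsto_0: "((\<lambda>x. x powr (- n\<^sub>2) * c) \<longlongrightarrow> 0) (at_right 0)"
proof -
  have "((\<lambda>x. x powr (- n\<^sub>2)) \<longlongrightarrow> 0 powr (- n\<^sub>2)) (at_right 0)"
    using n2 by (intro tendsto_powr' tendsto_intros) (auto intro!: eventually_at_rightI[of 0 1])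
  then show ?thesis using tendsto_mult_left_zero by fastforce
qed

text \<open>\<open>loI\<close> and \<open>upI\<close> are the integrals that occur in the derivatives of \<open>J\<^sub>R\<close>.\<close>

abbreviation loI :: "real \<Rightarrow> real" where
  "loI z \<equiv> LINT x:{0<..z}|lborel. x powr (- n\<^sub>2) * I x"

abbreviation upI :: "real \<Rightarrow> real" where
  "upI z \<equiv> LINT x:{z<..}|lborel. x powr (- n\<^sub>1) * I x"

lemma loI_has_deriv: "z > 0 \<Longrightarrow> (loI has_real_derivative z powr (- n\<^sub>2) * I z) (at z)"
  by (rule lower_integral_has_deriv[OF integrable_I])
    (simp_all add: isCont_mult isCont_powr_const isCont_inv_marginal)

lemma loI_tendsto_0: "(loI \<longlongrightarrow> 0) (at_right 0)"
  by (rule lower_integral_tendsto_0[OF integrable_I])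

text \<open>Adding \<open>loI\<close> cancels the term with \<open>I\<close> and leaves a derivative of constant sign, so this
  function controls \<open>ut\<close> near 0 through the assumption on \<open>I\<close> alone.\<close>

lemma powr_ut_has_deriv:
  "x > 0 \<Longrightarrow> ((\<lambda>x. loI x + x powr (- n\<^sub>2) * (ut x - c)) has_real_derivative
     (- n\<^sub>2) * (x powr (- n\<^sub>2 - 1) * (ut x - c))) (at x)"
  by (rule derivative_eq_intros loI_has_deriv has_deriv_powr_mult dual_utility_has_deriv refl | assumption)+
    simp

lemma loI_nonneg: "loI z \<ge> 0"
  unfolding set_lebesgue_integral_def
  by (intro integral_nonneg_AE AE_I2) (auto simp: indicator_def inv_marginal_nonneg)

lemma powr_ut_diff_le:
  assumes "0 < x" "x \<le> y"
  shows "x powr (- n\<^sub>2) * (ut x - ut y) \<le> loI y"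
proof -
  have "loI x + x powr (- n\<^sub>2) * (ut x - ut y) \<le> loI y + y powr (- n\<^sub>2) * (ut y - ut y)"
  proof (rule DERIV_nonneg_imp_nondecreasing[OF assms(2)])
    fix w assume "x \<le> w" "w \<le> y"
    then show "\<exists>l. ((\<lambda>x. loI x + x powr (- n\<^sub>2) * (ut x - ut y)) has_real_derivative l) (at w) \<and> 0 \<le> l"
      using powr_ut_has_deriv[of w "ut y"] assms ut_antimono[of w y] n2
      by (intro exI conjI, assumption?) (auto intro!: mult_nonpos_nonneg)
  qed
  then show ?thesis using loI_nonneg[of x] by simp
qed

text \<open>The boundary term at 0 of the integrations by parts: on \<open>(0, \<rho>]\<close> it is controlled by
  the small number \<open>loI \<rho>\<close>.\<close>

lemma powr_ut_tendsto_0: "((\<lambda>x. x powr (- n\<^sub>2) * ut x) \<longlongrightarrow> 0) (at_right 0)"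
proof -
  have "((\<lambda>x. x powr (- n\<^sub>2) * (ut x - u 0)) \<longlongrightarrow> 0) (at_right 0)"
  proof (rule order_tendstoI)
    fix a :: real assume "a < 0"
    show "eventually (\<lambda>x. a < x powr (- n\<^sub>2) * (ut x - u 0)) (at_right 0)"
      using eventually_at_right_less[of "0 :: real"]
    proof eventually_elim
      case (elim x)
      then have "0 \<le> x powr (- n\<^sub>2) * (ut x - u 0)" using dual_utility_ge_u0[of x] by simp
      then show ?case using \<open>a < 0\<close> by simp
    qed
  next
    fix e :: real assume "e > 0"
    have "eventually (\<lambda>y. loI y < e / 2 \<and> y > 0) (at_right 0)"
      using order_tendstoD(2)[OF loI_tendsto_0, of "e / 2"] \<open>e > 0\<close> eventually_at_right_less[of "0 :: real"]
      by (auto intro: eventually_conj)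
    then obtain y where y: "loI y < e / 2" "y > 0"
      using eventually_happens[of _ "at_right (0 :: real)"] by auto
    have "eventually (\<lambda>x. x < y) (at_right 0)"
      using y by (intro eventually_at_rightI[of 0 y]) auto
    moreover have "eventually (\<lambda>x. x powr (- n\<^sub>2) * (ut y - u 0) < e / 2) (at_right 0)"
      using order_tendstoD(2)[OF powr_tendsto_0, of "e / 2"] \<open>e > 0\<close> by simp
    ultimately show "eventually (\<lambda>x. x powr (- n\<^sub>2) * (ut x - u 0) < e) (at_right 0)"
      using eventually_at_right_less[of "0 :: real"]
    proof eventually_elim
      case (elim x)
      have "x powr (- n\<^sub>2) * (ut x - u 0) = x powr (- n\<^sub>2) * (ut x - ut y) + x powr (- n\<^sub>2) * (ut y - u 0)"
        by (simp add: algebra_simps)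
      also have "\<dots> < e" using powr_ut_diff_le[of x y] elim y by simp
      finally show ?case .
    qed
  qed
  from tendsto_add[OF this powr_tendsto_0[of "u 0"]] show ?thesis
    by (simp add: algebra_simps)
qed

text \<open>After subtraction of \<open>u 0\<close> the integrand is nonnegative and, up to a constant factor, the
  derivative of a function that extends continuously to 0.\<close>

lemma set_integrable_ut_lower:
  assumes "z > 0"
  shows "set_integrable lborel {0<..z} (\<lambda>x. x powr (- n\<^sub>2 - 1) * ut x)"
proof -
  let ?P = "\<lambda>x. loI x + x powr (- n\<^sub>2) * (ut x - u 0)"
  have P0: "(?P \<longlongrightarrow> 0) (at_right 0)"
    using tendsto_add[OF loI_tendsto_0 tendsto_diff[OF powr_ut_tendsto_0 powr_tendsto_0[of "u 0"]]]
    by (simp add: algebra_simps)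
  have "isCont ?P (z + 1)"
    using powr_ut_has_deriv[of "z + 1"] assms by (intro DERIV_isCont) auto
  then have P1: "(?P \<longlongrightarrow> ?P (z + 1)) (at_left (z + 1))"
    unfolding isCont_def using filterlim_at_split by blast
  have "set_integrable lborel (einterval 0 (ereal (z + 1))) (\<lambda>x. (- n\<^sub>2) * (x powr (- n\<^sub>2 - 1) * (ut x - u 0)))"
  proof (rule interval_integral_FTC_nonneg(1)[where F = ?P])
    show "((?P \<circ> real_of_ereal) \<longlongrightarrow> 0) (at_right 0)"
      unfolding zero_ereal_def ereal_tendsto_simps using P0 .
    show "((?P \<circ> real_of_ereal) \<longlongrightarrow> ?P (z + 1)) (at_left (ereal (z + 1)))"
      unfolding ereal_tendsto_simps using P1 .
    show "(?P has_real_derivative (- n\<^sub>2) * (x powr (- n\<^sub>2 - 1) * (ut x - u 0))) (at x)" if "0 < ereal x" for x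
      using powr_ut_has_deriv[of x] that by simp
    show "isCont (\<lambda>x. (- n\<^sub>2) * (x powr (- n\<^sub>2 - 1) * (ut x - u 0))) x" if "0 < ereal x" for x
      using that by (intro isCont_mult isCont_diff continuous_const isCont_powr_const isCont_ut) auto
    show "AE x in lborel. 0 < ereal x \<longrightarrow> ereal x < ereal (z + 1) \<longrightarrow>
        0 \<le> (- n\<^sub>2) * (x powr (- n\<^sub>2 - 1) * (ut x - u 0))"
      using n2 dual_utility_ge_u0 by (intro AE_I2) (auto intro!: mult_nonpos_nonneg)
  qed (use assms in auto)
  then have "set_integrable lborel (einterval 0 (ereal (z + 1))) (\<lambda>x. x powr (- n\<^sub>2 - 1) * (ut x - u 0))"
    using n2 by (subst (asm) set_integrable_mult_right_iff) auto
  then have "set_integrable lborel {0<..z} (\<lambda>x. x powr (- n\<^sub>2 - 1) * (ut x - u 0))"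
    by (rule set_integrable_subset) (use assms in \<open>auto simp: einterval_def\<close>)
  moreover have "set_integrable lborel {0<..z} (\<lambda>x. x powr (- n\<^sub>2 - 1) * u 0)"
    using n2 assms by (intro set_integrable_mult_left set_integrable_powr_lower) auto
  ultimately have "set_integrable lborel {0<..z}
      (\<lambda>x. x powr (- n\<^sub>2 - 1) * (ut x - u 0) + x powr (- n\<^sub>2 - 1) * u 0)"
    by (rule set_integral_add)
  then show ?thesis by (simp add: algebra_simps)
qed

lemma ut_abs_le:
  assumes "0 < z" "z \<le> x"
  shows "\<bar>ut x\<bar> \<le> \<bar>u 0\<bar> + \<bar>ut z\<bar>"
  using ut_antimono[OF assms] dual_utility_ge_u0[of x] assms by linarith

context
  fixes \<kappa> :: real
  assumes \<kappa>: "0 < \<kappa>" "\<kappa> \<le> 1"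
begin

text \<open>Since \<open>x \<le> x / \<kappa>\<close> and both \<open>ut\<close> and \<open>I\<close> decrease, the rescaled functions are dominated
  by the original ones near 0.\<close>

lemma le_scaled: "x > 0 \<Longrightarrow> x \<le> x / \<kappa>"
  using \<kappa> mult_left_mono[of \<kappa> 1 x] by (simp add: field_simps)

lemma continuous_on_scaled:
  assumes "continuous_on {0<..} (f :: real \<Rightarrow> real)"
  shows "continuous_on {0<..} (\<lambda>x. f (x / \<kappa>))"
  by (rule continuous_on_compose2[OF assms]) (use \<kappa> in \<open>auto intro!: continuous_intros\<close>)

lemma admissible_ut: "admissible (\<lambda>x. ut (x / \<kappa>))"
  unfolding admissible_def
proof (intro conjI allI impI)
  show c: "continuous_on {0<..} (\<lambda>x. ut (x / \<kappa>))"
    by (rule continuous_on_scaled[OF continuous_on_ut])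
  have c': "continuous_on {0<..} (\<lambda>x. x powr p * ut (x / \<kappa>))" for p
    by (intro continuous_on_mult c continuous_on_powr continuous_on_id continuous_on_const) simp
  fix z :: real assume z: "z > 0"
  show "set_integrable lborel {0<..z} (\<lambda>x. x powr (- n\<^sub>2 - 1) * ut (x / \<kappa>))"
  proof (rule set_integrable_dominated[OF c'])
    show "set_integrable lborel {0<..z} (\<lambda>x. x powr (- n\<^sub>2 - 1) * ut x + x powr (- n\<^sub>2 - 1) * (2 * \<bar>u 0\<bar>))"
      using z n2 by (intro set_integral_add(1) set_integrable_ut_lower set_integrable_mult_left
          set_integrable_powr_lower) auto
    fix x assume "x \<in> {0<..z}"
    then have x: "x > 0" by simp
    have "\<bar>ut (x / \<kappa>)\<bar> \<le> ut x + 2 * \<bar>u 0\<bar>"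
      using ut_antimono[OF x le_scaled[OF x]] dual_utility_ge_u0[of x] dual_utility_ge_u0[of "x / \<kappa>"] x \<kappa>
      by (simp add: abs_if split: if_splits)
    then have "x powr (- n\<^sub>2 - 1) * \<bar>ut (x / \<kappa>)\<bar> \<le> x powr (- n\<^sub>2 - 1) * (ut x + 2 * \<bar>u 0\<bar>)"
      by (rule mult_left_mono) simp
    then show "\<bar>x powr (- n\<^sub>2 - 1) * ut (x / \<kappa>)\<bar> \<le>
        x powr (- n\<^sub>2 - 1) * ut x + x powr (- n\<^sub>2 - 1) * (2 * \<bar>u 0\<bar>)"
      by (simp add: abs_mult distrib_left)
  qed auto
  show "set_integrable lborel {z<..} (\<lambda>x. x powr (- n\<^sub>1 - 1) * ut (x / \<kappa>))"
  proof (rule set_integrable_dominated[OF c'])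
    show "set_integrable lborel {z<..} (\<lambda>x. x powr (- n\<^sub>1 - 1) * (\<bar>u 0\<bar> + \<bar>ut (z / \<kappa>)\<bar>))"
      using z n1 by (intro set_integrable_mult_left set_integrable_powr_upper) auto
    fix x assume "x \<in> {z<..}"
    then have "\<bar>ut (x / \<kappa>)\<bar> \<le> \<bar>u 0\<bar> + \<bar>ut (z / \<kappa>)\<bar>"
      using z \<kappa> by (intro ut_abs_le divide_right_mono divide_pos_pos) auto
    then show "\<bar>x powr (- n\<^sub>1 - 1) * ut (x / \<kappa>)\<bar> \<le> x powr (- n\<^sub>1 - 1) * (\<bar>u 0\<bar> + \<bar>ut (z / \<kappa>)\<bar>)"
      unfolding abs_mult by (simp add: mult_left_mono)
  qed (use z in auto)
qed

lemma integrable_I_scaled: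
  assumes "z > 0"
  shows "set_integrable lborel {0<..z} (\<lambda>x. x powr (- n\<^sub>2) * I (x / \<kappa>))"
    and "set_integrable lborel {z<..} (\<lambda>x. x powr (- n\<^sub>1) * I (x / \<kappa>))"
proof -
  have c': "continuous_on {0<..} (\<lambda>x. x powr p * I (x / \<kappa>))" for p
    by (intro continuous_on_mult continuous_on_scaled[OF continuous_on_I]
        continuous_on_powr continuous_on_id continuous_on_const) simp
  have nonneg: "0 \<le> I (x / \<kappa>)" if "x > 0" for x
    using that \<kappa> by (intro inv_marginal_nonneg) simp
  show "set_integrable lborel {0<..z} (\<lambda>x. x powr (- n\<^sub>2) * I (x / \<kappa>))"
  proof (rule set_integrable_dominated[OF c' integrable_I[OF assms]])
    show "\<bar>x powr (- n\<^sub>2) * I (x / \<kappa>)\<bar> \<le> x powr (- n\<^sub>2) * I x" if "x \<in> {0<..z}" for x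
      using that nonneg[of x] inv_marginal_antimono[OF _ le_scaled, of x]
      by (auto simp: abs_mult intro!: mult_left_mono)
  qed auto
  show "set_integrable lborel {z<..} (\<lambda>x. x powr (- n\<^sub>1) * I (x / \<kappa>))"
  proof (rule set_integrable_dominated[OF c'])
    show "set_integrable lborel {z<..} (\<lambda>x. x powr (- n\<^sub>1) * I (z / \<kappa>))"
      using assms n1_gt_1 by (intro set_integrable_mult_left set_integrable_powr_upper) auto
    fix x assume x: "x \<in> {z<..}"
    then have "I (x / \<kappa>) \<le> I (z / \<kappa>)"
      using assms \<kappa> by (intro inv_marginal_antimono divide_right_mono divide_pos_pos) auto
    then show "\<bar>x powr (- n\<^sub>1) * I (x / \<kappa>)\<bar> \<le> x powr (- n\<^sub>1) * I (z / \<kappa>)"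
      using nonneg[of x] x assms by (auto simp: abs_mult intro!: mult_left_mono)
  qed (use assms in auto)
qed

end

lemma admissible_dual_utility: "admissible ut"
  using admissible_ut[of 1] by simp

lemma upI_integrable: "z > 0 \<Longrightarrow> set_integrable lborel {z<..} (\<lambda>x. x powr (- n\<^sub>1) * I x)"
  using integrable_I_scaled(2)[of 1 z] by simp

lemma upI_has_deriv: "z > 0 \<Longrightarrow> (upI has_real_derivative - (z powr (- n\<^sub>1) * I z)) (at z)"
  by (rule upper_integral_has_deriv[OF upI_integrable])
    (simp_all add: isCont_mult isCont_powr_const isCont_inv_marginal)

lemma upI_nonneg: "z > 0 \<Longrightarrow> upI z \<ge> 0"
  unfolding set_lebesgue_integral_def
  by (intro integral_nonneg_AE AE_I2) (auto simp: indicator_def inv_marginal_nonneg)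

lemma lo_ut:
  assumes "z > 0" shows "n\<^sub>2 * lo ut z = - loI z - z powr (- n\<^sub>2) * ut z"
proof -
  have i: "set_integrable lborel {0<..z} (\<lambda>x. x powr (- n\<^sub>2) * - I x)" if "z > 0" for z
    using set_integrable_minus[OF integrable_I[OF that]] by simp
  have "(LINT x:{0<..z}|lborel. x powr (- n\<^sub>2) * - I x)
      = z powr (- n\<^sub>2) * ut z - (- n\<^sub>2) * lo ut z"
    by (rule integral_by_parts_from_0[OF finite.emptyI continuous_on_ut dual_utility_has_deriv _ i
          set_integrable_ut_lower powr_ut_tendsto_0 assms])
      (auto intro: isCont_minus isCont_inv_marginal)
  moreover have "(LINT x:{0<..z}|lborel. x powr (- n\<^sub>2) * - I x) = - loI z"
    by (simp add: set_lebesgue_integral_def)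
  ultimately show ?thesis by simp
qed

lemma ut_linear_growth: "x \<ge> 1 \<Longrightarrow> \<bar>ut x\<bar> \<le> (\<bar>u 0\<bar> + \<bar>ut 1\<bar>) * x"
  using ut_abs_le[of 1 x] mult_left_mono[of 1 x "\<bar>u 0\<bar> + \<bar>ut 1\<bar>"] by simp

lemma up_ut:
  assumes "z > 0" shows "n\<^sub>1 * up ut z = z powr (- n\<^sub>1) * ut z - upI z"
proof -
  have i: "set_integrable lborel {z<..} (\<lambda>x. x powr (- n\<^sub>1) * - I x)" if "z > 0" for z
    using set_integrable_minus[OF upI_integrable[OF that]] by simp
  have i': "set_integrable lborel {z<..} (\<lambda>x. x powr (- n\<^sub>1 - 1) * ut x)" if "z > 0" for z
    using admissible_dual_utility that unfolding admissible_def by blast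
  have "(LINT x:{z<..}|lborel. x powr (- n\<^sub>1) * - I x)
      = - (z powr (- n\<^sub>1) * ut z) - (- n\<^sub>1) * up ut z"
    by (rule integral_by_parts_to_infinity[OF finite.emptyI continuous_on_ut dual_utility_has_deriv _ i
          i' powr_mult_tendsto_0_at_top[OF ut_linear_growth] assms])
      (auto intro: isCont_minus isCont_inv_marginal)
  moreover have "(LINT x:{z<..}|lborel. x powr (- n\<^sub>1) * - I x) = - upI z"
    by (simp add: set_lebesgue_integral_def)
  ultimately show ?thesis by simp
qed

text \<open>After integration by parts the terms with \<open>ut\<close> cancel, and the first two derivatives of \<open>J\<^sub>R\<close>
  are expressed by the nonnegative decreasing function \<open>I\<close>.\<close>

lemma J_deriv_eq:
  assumes "z > 0"
  shows "z * sol1 0 0 ut z = - C * (z powr n\<^sub>2 * loI z + z powr n\<^sub>1 * upI z)"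
proof -
  have "z * sol1 0 0 ut z = (C * up ut z) * (n\<^sub>1 * z powr n\<^sub>1) + (C * lo ut z) * (n\<^sub>2 * z powr n\<^sub>2)"
    using assms unfolding sol1_def by simp
  also have "\<dots> = C * (z powr n\<^sub>1 * (n\<^sub>1 * up ut z) + z powr n\<^sub>2 * (n\<^sub>2 * lo ut z))"
    by (simp add: algebra_simps)
  also have "\<dots> = C * ((z powr n\<^sub>1 * z powr (- n\<^sub>1)) * ut z - (z powr n\<^sub>2 * z powr (- n\<^sub>2)) * ut z
      - z powr n\<^sub>1 * upI z - z powr n\<^sub>2 * loI z)"
    unfolding lo_ut[OF assms] up_ut[OF assms] by (simp add: algebra_simps)
  finally show ?thesis using assms by (simp add: powr_minus algebra_simps)
qed

lemma J_deriv2_eq: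
  assumes "z > 0"
  shows "z\<^sup>2 * sol2 0 0 ut z = C * ((1 - n\<^sub>2) * (z powr n\<^sub>2 * loI z) - (n\<^sub>1 - 1) * (z powr n\<^sub>1 * upI z))"
proof -
  have "z\<^sup>2 * sol2 0 0 ut z = (C * up ut z) * (n\<^sub>1 * (n\<^sub>1 - 1) * z powr n\<^sub>1)
     + (C * lo ut z) * (n\<^sub>2 * (n\<^sub>2 - 1) * z powr n\<^sub>2) - C * (n\<^sub>1 - n\<^sub>2) * ut z"
    using assms unfolding sol2_def by simp
  also have "\<dots> = C * ((n\<^sub>1 - 1) * z powr n\<^sub>1 * (n\<^sub>1 * up ut z)
      + (n\<^sub>2 - 1) * z powr n\<^sub>2 * (n\<^sub>2 * lo ut z) - (n\<^sub>1 - n\<^sub>2) * ut z)"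
    by (simp add: algebra_simps)
  also have "\<dots> = C * ((n\<^sub>1 - 1) * (z powr n\<^sub>1 * z powr (- n\<^sub>1)) * ut z - (n\<^sub>2 - 1) * (z powr n\<^sub>2 * z powr (- n\<^sub>2)) * ut z
      - (n\<^sub>1 - 1) * z powr n\<^sub>1 * upI z - (n\<^sub>2 - 1) * z powr n\<^sub>2 * loI z - (n\<^sub>1 - n\<^sub>2) * ut z)"
    unfolding lo_ut[OF assms] up_ut[OF assms] by (simp add: algebra_simps)
  finally show ?thesis using assms by (simp add: powr_minus algebra_simps)
qed

text \<open>\<open>I \<ge> I z\<close> on \<open>(0, z]\<close> and \<open>I \<le> I z\<close> on \<open>[z, \<infinity>)\<close>, so \<open>loI z\<close> and \<open>upI z\<close> are compared with the
  integrals of the constant \<open>I z\<close>. The two bounds cancel in \<open>J_deriv2_eq\<close>.\<close>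

lemma loI_minus_powr_has_deriv:
  "x > 0 \<Longrightarrow> ((\<lambda>x. (1 - n\<^sub>2) * loI x - x powr (1 - n\<^sub>2) * c) has_real_derivative
     (1 - n\<^sub>2) * (x powr (- n\<^sub>2) * (I x - c))) (at x)"
  by (rule derivative_eq_intros loI_has_deriv has_real_derivative_powr refl | assumption)+
    (simp add: algebra_simps)

lemma loI_minus_powr_mono:
  assumes "0 < x" "x \<le> y"
  shows "(1 - n\<^sub>2) * loI x - x powr (1 - n\<^sub>2) * I y \<le> (1 - n\<^sub>2) * loI y - y powr (1 - n\<^sub>2) * I y"
proof (rule DERIV_nonneg_imp_nondecreasing[OF assms(2)])
  fix w assume "x \<le> w" "w \<le> y"
  then have "w > 0" "I y \<le> I w" using assms inv_marginal_antimono by auto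
  moreover from this have "0 \<le> (1 - n\<^sub>2) * (w powr (- n\<^sub>2) * (I w - I y))"
    using n2 by (intro mult_nonneg_nonneg) auto
  ultimately show "\<exists>l. ((\<lambda>x. (1 - n\<^sub>2) * loI x - x powr (1 - n\<^sub>2) * I y) has_real_derivative l) (at w) \<and> 0 \<le> l"
    using loI_minus_powr_has_deriv by blast
qed

lemma loI_ge:
  assumes "z > 0" shows "z powr (1 - n\<^sub>2) * I z \<le> (1 - n\<^sub>2) * loI z"
proof -
  have "((\<lambda>x. x powr (1 - n\<^sub>2)) \<longlongrightarrow> 0 powr (1 - n\<^sub>2)) (at_right 0)"
    using n2 by (intro tendsto_powr' tendsto_intros) (auto intro!: eventually_at_rightI[of 0 1])
  then have "((\<lambda>x. (1 - n\<^sub>2) * loI x - x powr (1 - n\<^sub>2) * I z) \<longlongrightarrow> (1 - n\<^sub>2) * 0 - 0 * I z) (at_right 0)"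
    by (intro tendsto_diff tendsto_mult tendsto_const loI_tendsto_0) simp
  moreover have "eventually (\<lambda>x. (1 - n\<^sub>2) * loI x - x powr (1 - n\<^sub>2) * I z
      \<le> (1 - n\<^sub>2) * loI z - z powr (1 - n\<^sub>2) * I z) (at_right 0)"
    using assms by (intro eventually_at_rightI[of 0 z] loI_minus_powr_mono) auto
  ultimately have "(1 - n\<^sub>2) * 0 - 0 * I z \<le> (1 - n\<^sub>2) * loI z - z powr (1 - n\<^sub>2) * I z"
    by (rule tendsto_upperbound) simp
  then show ?thesis by simp
qed

text \<open>The inequality is strict because \<open>I\<close> is unbounded near 0.\<close>

lemma loI_gt:
  assumes "z > 0" shows "z powr (1 - n\<^sub>2) * I z < (1 - n\<^sub>2) * loI z"
proof -
  have "eventually (\<lambda>w. I z < I w \<and> 0 < w \<and> w < z) (at_right 0)"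
    using filterlim_at_top_dense[THEN iffD1, OF inv_marginal_at_0, rule_format, of "I z"]
      eventually_at_right_less[of "0 :: real"] eventually_at_rightI[of 0 z "\<lambda>w. w < z"] assms
    by (auto intro: eventually_conj)
  then obtain w where w: "I z < I w" "0 < w" "w < z"
    using eventually_happens[of _ "at_right (0 :: real)"] by auto
  have "w powr (1 - n\<^sub>2) * I z < w powr (1 - n\<^sub>2) * I w" using w by simp
  then show ?thesis using loI_ge[of w] loI_minus_powr_mono[of w z] w by linarith
qed

lemma upI_le:
  assumes "z > 0" shows "(n\<^sub>1 - 1) * upI z \<le> z powr (1 - n\<^sub>1) * I z"
proof -
  let ?g = "\<lambda>x. (n\<^sub>1 - 1) * upI x - x powr (1 - n\<^sub>1) * I z"
  have d: "(?g has_real_derivative (n\<^sub>1 - 1) * (x powr (- n\<^sub>1) * (I z - I x))) (at x)" if "x > 0" for x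
    using that
    apply -
    apply (rule derivative_eq_intros upI_has_deriv has_real_derivative_powr refl | assumption)+
    apply (simp add: algebra_simps)
    done
  have mono: "?g z \<le> ?g x" if "z \<le> x" for x
  proof (rule DERIV_nonneg_imp_nondecreasing[OF that])
    fix w assume "z \<le> w" "w \<le> x"
    then have "w > 0" "I w \<le> I z" using assms inv_marginal_antimono by auto
    moreover from this have "0 \<le> (n\<^sub>1 - 1) * (w powr (- n\<^sub>1) * (I z - I w))"
      using n1_gt_1 by (intro mult_nonneg_nonneg) auto
    ultimately show "\<exists>l. (?g has_real_derivative l) (at w) \<and> 0 \<le> l"
      using d by blast
  qed
  have "(?g \<longlongrightarrow> (n\<^sub>1 - 1) * 0 - 0 * I z) at_top"
    using n1_gt_1 by (intro tendsto_diff tendsto_mult tendsto_const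
        upper_integral_tendsto_0[OF upI_integrable] tendsto_neg_powr filterlim_ident) auto
  moreover have "eventually (\<lambda>x. ?g z \<le> ?g x) at_top"
    using eventually_ge_at_top[of z] by eventually_elim (rule mono)
  ultimately have "?g z \<le> (n\<^sub>1 - 1) * 0 - 0 * I z"
    by (rule tendsto_lowerbound) simp
  then show ?thesis by simp
qed

lemma J_deriv2_pos:
  assumes "z > 0" shows "sol2 0 0 ut z > 0"
proof -
  have "(n\<^sub>1 - 1) * (z powr n\<^sub>1 * upI z) = z powr n\<^sub>1 * ((n\<^sub>1 - 1) * upI z)"
    by simp
  also have "\<dots> \<le> z powr n\<^sub>1 * (z powr (1 - n\<^sub>1) * I z)"
    by (rule mult_left_mono[OF upI_le[OF assms]]) simp
  also have "\<dots> = z powr n\<^sub>2 * (z powr (1 - n\<^sub>2) * I z)"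
    using assms by (simp add: powr_diff)
  also have "\<dots> < z powr n\<^sub>2 * ((1 - n\<^sub>2) * loI z)"
    using loI_gt[OF assms] assms by simp
  finally have "0 < z\<^sup>2 * sol2 0 0 ut z"
    unfolding J_deriv2_eq[OF assms] using C_pos by (intro mult_pos_pos) (auto simp: algebra_simps)
  then show ?thesis using assms by (simp add: zero_less_mult_iff)
qed

lemma J_deriv_le:
  assumes "z > 0" shows "sol1 0 0 ut z \<le> - (C / (1 - n\<^sub>2)) * I z"
    and "sol1 0 0 ut z < 0"
proof -
  have e: "z powr (1 - n\<^sub>2) = z / z powr n\<^sub>2" using assms by (simp add: powr_diff)
  have "z * I z \<le> (1 - n\<^sub>2) * (z powr n\<^sub>2 * loI z)"
    using mult_left_mono[OF loI_ge[OF assms], of "z powr n\<^sub>2"] assms by (simp add: e mult.left_commute)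
  then have "z * I z / (1 - n\<^sub>2) \<le> z powr n\<^sub>2 * loI z"
    using n2 by (simp add: field_simps)
  also have "\<dots> \<le> z powr n\<^sub>2 * loI z + z powr n\<^sub>1 * upI z"
    using upI_nonneg[OF assms] by simp
  finally have "C * (z * I z / (1 - n\<^sub>2)) \<le> C * (z powr n\<^sub>2 * loI z + z powr n\<^sub>1 * upI z)"
    using C_pos by (intro mult_left_mono) auto
  then have "z * sol1 0 0 ut z \<le> z * (- (C / (1 - n\<^sub>2)) * I z)"
    unfolding J_deriv_eq[OF assms] by (simp add: algebra_simps)
  then show "sol1 0 0 ut z \<le> - (C / (1 - n\<^sub>2)) * I z"
    using assms by (rule mult_left_le_imp_le)
  have "loI z > 0"
  proof -
    have "0 \<le> z powr (1 - n\<^sub>2) * I z" using inv_marginal_nonneg[OF assms] by simp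
    then have "0 < (1 - n\<^sub>2) * loI z" using loI_gt[OF assms] by linarith
    then show ?thesis using n2 by (simp add: zero_less_mult_iff)
  qed
  then have "0 < z powr n\<^sub>2 * loI z + z powr n\<^sub>1 * upI z"
    using upI_nonneg[OF assms] assms by (intro add_pos_nonneg) auto
  then have "z * sol1 0 0 ut z < 0"
    unfolding J_deriv_eq[OF assms] using C_pos by (simp add: mult_neg_pos)
  then show "sol1 0 0 ut z < 0" using assms by (simp add: mult_less_0_iff)
qed

lemma J_deriv_at_0: "filterlim (sol1 0 0 ut) at_bot (at_right 0)"
proof (rule filterlim_at_bot_mono)
  show "filterlim (\<lambda>z. - (C / (1 - n\<^sub>2)) * I z) at_bot (at_right 0)"
    using C_pos n2 by (intro filterlim_tendsto_neg_mult_at_bot[OF tendsto_const _ inv_marginal_at_0])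
      (simp add: divide_pos_pos)
  show "eventually (\<lambda>z. sol1 0 0 ut z \<le> - (C / (1 - n\<^sub>2)) * I z) (at_right 0)"
    using eventually_at_right_less[of "0 :: real"] by eventually_elim (rule J_deriv_le)
qed

end

section \<open>The optimal choice between two jobs\<close>

locale retirement_choice = retirement +
  fixes \<kappa>\<^sub>1 \<kappa>\<^sub>2 \<epsilon>\<^sub>1 \<epsilon>\<^sub>2 z\<^sub>S zhat :: real
  assumes eps: "0 < \<epsilon>\<^sub>2" "\<epsilon>\<^sub>2 < \<epsilon>\<^sub>1" and kap: "0 < \<kappa>\<^sub>1" "\<kappa>\<^sub>1 < \<kappa>\<^sub>2" "\<kappa>\<^sub>2 < 1"
    and zS: "z\<^sub>S > 0"
    and zS_unique: "\<And>y. y > 0 \<Longrightarrow> switch_fun u \<kappa>\<^sub>1 \<kappa>\<^sub>2 \<epsilon>\<^sub>1 \<epsilon>\<^sub>2 y = 0 \<Longrightarrow> y = z\<^sub>S"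
    and zhat_unique: "\<And>z. z > 0 \<Longrightarrow> h_fun u \<kappa>\<^sub>1 \<kappa>\<^sub>2 \<epsilon>\<^sub>1 \<epsilon>\<^sub>2 z\<^sub>S z = 0 \<Longrightarrow> z = zhat"
begin

abbreviation h :: "real \<Rightarrow> real" where "h \<equiv> h_fun u \<kappa>\<^sub>1 \<kappa>\<^sub>2 \<epsilon>\<^sub>1 \<epsilon>\<^sub>2 z\<^sub>S"

text \<open>\<open>H\<close> is the running reward while working: the better one of the two branches.\<close>

definition branch :: "real \<Rightarrow> real \<Rightarrow> real \<Rightarrow> real" where "branch \<kappa> e z = ut (z / \<kappa>) + e * z"

definition H :: "real \<Rightarrow> real" where "H z = (if z > z\<^sub>S then branch \<kappa>\<^sub>1 \<epsilon>\<^sub>1 z else branch \<kappa>\<^sub>2 \<epsilon>\<^sub>2 z)"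

text \<open>The derivative of \<open>H\<close> away from \<open>z\<^sub>S\<close>.\<close>

definition dH :: "real \<Rightarrow> real" where
  "dH z = eps_hat \<epsilon>\<^sub>1 \<epsilon>\<^sub>2 z\<^sub>S z - c_hat u \<kappa>\<^sub>1 \<kappa>\<^sub>2 z\<^sub>S z"

lemma dH_eq: "dH z = (if z > z\<^sub>S then \<epsilon>\<^sub>1 - I (z / \<kappa>\<^sub>1) / \<kappa>\<^sub>1 else \<epsilon>\<^sub>2 - I (z / \<kappa>\<^sub>2) / \<kappa>\<^sub>2)"
  unfolding dH_def eps_hat_def c_hat_def by simp

lemma h_eq: "h z = H z - ut z"
  unfolding h_fun_def H_def branch_def by simp

text \<open>Near 0 the slope \<open>- I\<close> of \<open>ut\<close> is unbounded and outweighs the income \<open>e y\<close>; near infinity \<open>ut\<close>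
  is bounded and the income prevails. So both \<open>h\<close> and the difference of the two branches go from negative to positive, and each
  changes sign at its only zero.\<close>

lemma ut_diff_neg_near_0:
  assumes "0 < \<kappa>" "\<kappa> < k" "e > 0"
  shows "eventually (\<lambda>y. ut (y / \<kappa>) - ut (y / k) + e * y < 0) (at_right 0)"
proof -
  define d where "d = 1 / \<kappa> - 1 / k"
  have "d > 0" unfolding d_def using assms by (simp add: field_simps)
  have "filterlim (\<lambda>y. y / \<kappa>) (at_right 0) (at_right 0)"
    unfolding filterlim_at using assms
    by (auto intro!: tendsto_eq_intros eventually_at_rightI[of 0 1])
  then have "eventually (\<lambda>y. I (y / \<kappa>) > e / d) (at_right 0)"
    using filterlim_at_top_dense[THEN iffD1, OF filterlim_compose[OF inv_marginal_at_0]] by blast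
  then show ?thesis using eventually_at_right_less[of "0 :: real"]
  proof eventually_elim
    case (elim y)
    have "ut (y / k) \<ge> ut (y / \<kappa>) - (y / k - y / \<kappa>) * I (y / \<kappa>)"
      using elim assms by (intro dual_utility_subgradient) auto
    then have "ut (y / \<kappa>) - ut (y / k) + e * y \<le> y * (e - d * I (y / \<kappa>))"
      unfolding d_def by (simp add: algebra_simps)
    also have "\<dots> < 0"
      using elim \<open>d > 0\<close> by (intro mult_pos_neg) (auto simp: field_simps)
    finally show ?case .
  qed
qed

lemma ut_diff_pos_at_top:
  assumes "0 < \<kappa>" "0 < k" "e > 0"
  shows "eventually (\<lambda>y. ut (y / \<kappa>) - ut (y / k) + e * y > 0) at_top"
  using eventually_ge_at_top[of 1] eventually_gt_at_top[of "(ut (1 / k) - u 0) / e"]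
proof eventually_elim
  case (elim y)
  have "ut (1 / k) - u 0 < e * y" using elim assms by (simp add: field_simps)
  moreover have "ut (y / k) \<le> ut (1 / k)" "u 0 \<le> ut (y / \<kappa>)"
    using elim assms by (auto intro!: ut_antimono dual_utility_ge_u0 divide_right_mono)
  ultimately show ?case by linarith
qed

lemma kap': "\<kappa>\<^sub>1 \<le> 1" "\<kappa>\<^sub>2 \<le> 1" "0 < \<kappa>\<^sub>2" using kap by auto

lemma continuous_on_branch: "0 < \<kappa> \<Longrightarrow> \<kappa> \<le> 1 \<Longrightarrow> continuous_on {0<..} (branch \<kappa> e)"
  unfolding branch_def[abs_def]
  by (intro continuous_on_add continuous_on_mult continuous_on_id continuous_on_const
      continuous_on_scaled[OF _ _ continuous_on_ut]) auto

text \<open>The branches switch where they cross, which makes \<open>H\<close> their maximum and hence convex.\<close>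

lemma branch_compare:
  assumes "z > 0"
  shows "z < z\<^sub>S \<Longrightarrow> branch \<kappa>\<^sub>1 \<epsilon>\<^sub>1 z < branch \<kappa>\<^sub>2 \<epsilon>\<^sub>2 z" and "z > z\<^sub>S \<Longrightarrow> branch \<kappa>\<^sub>1 \<epsilon>\<^sub>1 z > branch \<kappa>\<^sub>2 \<epsilon>\<^sub>2 z"
proof -
  let ?g = "\<lambda>z. branch \<kappa>\<^sub>1 \<epsilon>\<^sub>1 z - branch \<kappa>\<^sub>2 \<epsilon>\<^sub>2 z"
  have g: "?g z = ut (z / \<kappa>\<^sub>1) - ut (z / \<kappa>\<^sub>2) + (\<epsilon>\<^sub>1 - \<epsilon>\<^sub>2) * z" for z
    unfolding branch_def by (simp add: algebra_simps)
  have c: "continuous_on {0<..} ?g"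
    using kap kap' by (intro continuous_on_diff continuous_on_branch) auto
  have unique: "y = z\<^sub>S" if "y > 0" "?g y = 0" for y
    using zS_unique[of y] that unfolding g switch_fun_def by (simp add: mult.commute)
  have neg: "\<exists>y. 0 < y \<and> y < w \<and> ?g y < 0" if "w > 0" for w
    using eventually_at_right_0_ex[OF ut_diff_neg_near_0[of \<kappa>\<^sub>1 \<kappa>\<^sub>2 "\<epsilon>\<^sub>1 - \<epsilon>\<^sub>2"] that] kap eps
    unfolding g by auto
  have pos: "\<exists>y>w. ?g y > 0" for w
    using eventually_at_top_ex[OF ut_diff_pos_at_top[of \<kappa>\<^sub>1 \<kappa>\<^sub>2 "\<epsilon>\<^sub>1 - \<epsilon>\<^sub>2"]] kap eps
    unfolding g by auto
  show "z < z\<^sub>S \<Longrightarrow> branch \<kappa>\<^sub>1 \<epsilon>\<^sub>1 z < branch \<kappa>\<^sub>2 \<epsilon>\<^sub>2 z" "z > z\<^sub>S \<Longrightarrow> branch \<kappa>\<^sub>1 \<epsilon>\<^sub>1 z > branch \<kappa>\<^sub>2 \<epsilon>\<^sub>2 z"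
    using sign_around_unique_zero[OF c unique neg pos assms] by auto
qed

text \<open>The strict inequalities on the two sides of \<open>z\<^sub>S\<close> force equality at \<open>z\<^sub>S\<close> by continuity.\<close>

lemma branch_zS: "branch \<kappa>\<^sub>1 \<epsilon>\<^sub>1 z\<^sub>S = branch \<kappa>\<^sub>2 \<epsilon>\<^sub>2 z\<^sub>S"
proof -
  let ?g = "\<lambda>z. branch \<kappa>\<^sub>1 \<epsilon>\<^sub>1 z - branch \<kappa>\<^sub>2 \<epsilon>\<^sub>2 z"
  have "continuous_on {0<..} ?g"
    using kap kap' by (intro continuous_on_diff continuous_on_branch) auto
  then have "isCont ?g z\<^sub>S" using zS by (simp add: continuous_on_eq_continuous_at)
  then have lim: "(?g \<longlongrightarrow> ?g z\<^sub>S) (at_left z\<^sub>S)" "(?g \<longlongrightarrow> ?g z\<^sub>S) (at_right z\<^sub>S)"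
    unfolding isCont_def by (simp_all add: filterlim_at_split)
  have "eventually (\<lambda>z. ?g z \<le> 0) (at_left z\<^sub>S)"
    using zS branch_compare(1) by (intro eventually_at_leftI[of 0]) (auto intro: less_imp_le)
  then have "?g z\<^sub>S \<le> 0" by (rule tendsto_upperbound[OF lim(1)]) simp
  moreover have "eventually (\<lambda>z. ?g z \<ge> 0) (at_right z\<^sub>S)"
    using zS branch_compare(2) by (intro eventually_at_rightI[of _ "z\<^sub>S + 1"]) (auto intro: less_imp_le)
  then have "?g z\<^sub>S \<ge> 0" by (rule tendsto_lowerbound[OF lim(2)]) simp
  ultimately show ?thesis by simp
qed

lemma H_eq_max: "z > 0 \<Longrightarrow> H z = max (branch \<kappa>\<^sub>1 \<epsilon>\<^sub>1 z) (branch \<kappa>\<^sub>2 \<epsilon>\<^sub>2 z)"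
  unfolding H_def using branch_compare[of z] branch_zS by (cases z z\<^sub>S rule: linorder_cases) auto

lemma continuous_on_H: "continuous_on {0<..} H"
proof -
  have "continuous_on {0<..} (\<lambda>z. max (branch \<kappa>\<^sub>1 \<epsilon>\<^sub>1 z) (branch \<kappa>\<^sub>2 \<epsilon>\<^sub>2 z))"
    using kap kap' by (intro continuous_on_max continuous_on_branch) auto
  then show ?thesis by (rule continuous_on_eq) (simp add: H_eq_max)
qed

lemma branch_has_deriv:
  assumes "0 < \<kappa>" "z > 0"
  shows "(branch \<kappa> e has_real_derivative e - I (z / \<kappa>) / \<kappa>) (at z)"
proof -
  have "((\<lambda>z. ut (z / \<kappa>)) has_real_derivative - I (z / \<kappa>) * (1 / \<kappa>)) (at z)"
    by (rule DERIV_chain'[of "\<lambda>z. z / \<kappa>" _ z UNIV ut, OF _ dual_utility_has_deriv])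
      (use assms in \<open>auto intro!: derivative_eq_intros\<close>)
  then show ?thesis unfolding branch_def[abs_def]
    by (auto intro!: derivative_eq_intros)
qed

lemma convex_on_branch: "0 < \<kappa> \<Longrightarrow> convex_on {0<..} (branch \<kappa> e)"
proof (rule convex_on_realI)
  assume "0 < \<kappa>"
  show "(branch \<kappa> e has_real_derivative e - I (z / \<kappa>) / \<kappa>) (at z)" if "z \<in> {0<..}" for z
    using branch_has_deriv[OF \<open>0 < \<kappa>\<close>] that by simp
  show "e - I (x / \<kappa>) / \<kappa> \<le> e - I (y / \<kappa>) / \<kappa>" if "x \<in> {0<..}" "y \<in> {0<..}" "x \<le> y" for x y
    using inv_marginal_antimono[of "x / \<kappa>" "y / \<kappa>"] that \<open>0 < \<kappa>\<close> by (simp add: divide_right_mono)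
qed simp

lemma convex_on_H: "convex_on {0<..} H"
proof -
  have "convex_on {0<..} (\<lambda>z. max (branch \<kappa>\<^sub>1 \<epsilon>\<^sub>1 z) (branch \<kappa>\<^sub>2 \<epsilon>\<^sub>2 z))"
    using kap kap' by (intro convex_on_max_fun convex_on_branch) auto
  note max = this
  show ?thesis
  proof (rule convex_onI)
    fix t x y :: real
    assume *: "0 < t" "t < 1" "x \<in> {0<..}" "y \<in> {0<..}"
    then have "0 < (1 - t) *\<^sub>R x + t *\<^sub>R y" by (simp add: add_pos_pos)
    then show "H ((1 - t) *\<^sub>R x + t *\<^sub>R y) \<le> (1 - t) * H x + t * H y"
      using convex_onD[OF max, of t x y] * by (simp add: H_eq_max)
  qed simp
qed

lemma H_has_deriv:
  assumes "z > 0" "z \<noteq> z\<^sub>S"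
  shows "(H has_real_derivative dH z) (at z)"
proof (cases "z > z\<^sub>S")
  case True
  show ?thesis
    by (rule has_field_derivative_transform_within_open[where S = "{z\<^sub>S<..}" and f = "branch \<kappa>\<^sub>1 \<epsilon>\<^sub>1"])
      (use True branch_has_deriv[OF kap(1) assms(1)] in \<open>auto simp: dH_eq H_def\<close>)
next
  case False
  then have "z < z\<^sub>S" using assms by simp
  show ?thesis
    by (rule has_field_derivative_transform_within_open[where S = "{..<z\<^sub>S}" and f = "branch \<kappa>\<^sub>2 \<epsilon>\<^sub>2"])
      (use \<open>z < z\<^sub>S\<close> branch_has_deriv[OF kap'(3) assms(1)] in \<open>auto simp: dH_eq H_def\<close>)
qed

lemma isCont_dH:
  assumes "z > 0" "z \<noteq> z\<^sub>S"
  shows "isCont dH z"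
proof -
  have c: "continuous_on {0<..} (\<lambda>x. e - I (x / \<kappa>) / \<kappa>)" if "0 < \<kappa>" "\<kappa> \<le> 1" for e \<kappa>
    using that by (intro continuous_on_diff continuous_on_divide continuous_on_const
        continuous_on_scaled continuous_on_I) auto
  show ?thesis
  proof (cases "z > z\<^sub>S")
    case True
    have "continuous_on {z\<^sub>S<..} dH"
      by (rule continuous_on_eq[OF continuous_on_subset[OF c[OF kap(1) kap'(1)], of _ "\<epsilon>\<^sub>1"]])
        (use zS in \<open>auto simp: dH_eq\<close>)
    then show ?thesis using True by (simp add: continuous_on_eq_continuous_at)
  next
    case False
    have "continuous_on {0<..<z\<^sub>S} dH"
      by (rule continuous_on_eq[OF continuous_on_subset[OF c[OF kap'(3,2)], of _ "\<epsilon>\<^sub>2"]])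
        (auto simp: dH_eq)
    then show ?thesis using False assms by (simp add: continuous_on_eq_continuous_at)
  qed
qed

lemma admissible_branch: "0 < \<kappa> \<Longrightarrow> \<kappa> \<le> 1 \<Longrightarrow> admissible (branch \<kappa> e)"
  unfolding branch_def[abs_def] by (intro admissible_add(1) admissible_ut admissible_linear)

lemma admissible_H: "admissible H"
proof -
  have if_distrib: "x powr p * H x = (if x > z\<^sub>S then x powr p * branch \<kappa>\<^sub>1 \<epsilon>\<^sub>1 x else x powr p * branch \<kappa>\<^sub>2 \<epsilon>\<^sub>2 x)" for x p
    by (simp add: H_def)
  show ?thesis
    using admissible_branch[of \<kappa>\<^sub>1 \<epsilon>\<^sub>1] admissible_branch[of \<kappa>\<^sub>2 \<epsilon>\<^sub>2] kap kap'
    unfolding admissible_def if_distrib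
    by (intro conjI allI impI continuous_on_H set_integrable_if) auto
qed

lemma admissible_h: "admissible h"
proof -
  have "admissible (\<lambda>x. H x + - ut x)"
    by (intro admissible_add(1) admissible_minus admissible_H admissible_dual_utility)
  then show ?thesis by (subst admissible_cong) (auto simp: h_eq)
qed

lemma continuous_on_h: "continuous_on {0<..} h"
  using admissible_h unfolding admissible_def by blast

lemma lo_H: "z > 0 \<Longrightarrow> lo H z = lo ut z + lo h z" and up_H: "z > 0 \<Longrightarrow> up H z = up ut z + up h z"
  using admissible_add(2,3)[OF admissible_dual_utility admissible_h] by (simp_all add: h_eq)

lemma h_sign:
  assumes "z > 0" shows "z < zhat \<Longrightarrow> h z < 0" and "z > zhat \<Longrightarrow> h z > 0"
proof -
  have neg: "\<exists>y. 0 < y \<and> y < w \<and> h y < 0" if "w > 0" for w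
  proof -
    have "\<exists>y. 0 < y \<and> y < min w z\<^sub>S \<and> ut (y / \<kappa>\<^sub>2) - ut (y / 1) + \<epsilon>\<^sub>2 * y < 0"
      using that zS kap kap' eps by (intro eventually_at_right_0_ex ut_diff_neg_near_0) auto
    then show ?thesis by (force simp: h_fun_def)
  qed
  have pos: "\<exists>y>w. h y > 0" for w
  proof -
    have "\<exists>y>max w z\<^sub>S. ut (y / \<kappa>\<^sub>1) - ut (y / 1) + \<epsilon>\<^sub>1 * y > 0"
      using kap eps by (intro eventually_at_top_ex ut_diff_pos_at_top) auto
    then show ?thesis by (force simp: h_fun_def)
  qed
  show "z < zhat \<Longrightarrow> h z < 0" "z > zhat \<Longrightarrow> h z > 0"
    by (rule sign_around_unique_zero[OF continuous_on_h zhat_unique neg pos assms]; assumption)+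
qed

text \<open>Where a branch is affine, \<open>I (z / \<kappa>)\<close> is constant and therefore 0, since \<open>I\<close> strictly decreases
  while it is positive. So the slope is the income \<open>\<epsilon>\<^sub>1\<close> or \<open>\<epsilon>\<^sub>2\<close>, which is positive.\<close>

lemma H_not_affine_decreasing:
  assumes "0 < x" "x < y" "k \<le> 0"
    and H: "\<And>z. x < z \<Longrightarrow> z < y \<Longrightarrow> (H has_real_derivative k) (at z)"
  shows False
proof -
  \<comment> \<open>\<open>(x', y)\<close> is the part of the interval that lies on one side of the kink \<open>z\<^sub>S\<close>.\<close>
  define x' where "x' = (if x < z\<^sub>S \<and> z\<^sub>S < y then z\<^sub>S else x)"
  have x': "x \<le> x'" "x' < y" "\<not> (x' < z\<^sub>S \<and> z\<^sub>S < y)" using assms unfolding x'_def by auto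
  define p where "p = (2 * x' + y) / 3"
  define q where "q = (x' + 2 * y) / 3"
  have pq: "x' < p" "p < q" "q < y" unfolding p_def q_def using x' by simp_all
  have "p > 0" "q > 0" using pq x' assms by linarith+
  have "p \<noteq> z\<^sub>S" "q \<noteq> z\<^sub>S" "p > z\<^sub>S \<longleftrightarrow> q > z\<^sub>S" using pq x' by auto
  have "dH p = k" "dH q = k"
    using DERIV_unique[OF H_has_deriv H] pq x' \<open>p > 0\<close> \<open>q > 0\<close> \<open>p \<noteq> z\<^sub>S\<close> \<open>q \<noteq> z\<^sub>S\<close> by auto
  have "False" if k: "k = e - I (p / \<kappa>) / \<kappa>" "k = e - I (q / \<kappa>) / \<kappa>" and "0 < \<kappa>" "0 < e" for \<kappa> e
  proof -
    have "I (p / \<kappa>) / \<kappa> > 0" using k \<open>0 < e\<close> \<open>k \<le> 0\<close> by linarith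
    then have "I (p / \<kappa>) > 0" using \<open>0 < \<kappa>\<close> by (simp add: zero_less_divide_iff)
    then have "I (q / \<kappa>) < I (p / \<kappa>)"
      using pq \<open>p > 0\<close> \<open>0 < \<kappa>\<close> by (intro inv_marginal_strict divide_strict_right_mono) auto
    moreover have "I (p / \<kappa>) / \<kappa> = I (q / \<kappa>) / \<kappa>" using k by linarith
    ultimately show False using \<open>0 < \<kappa>\<close> by simp
  qed
  note contra = this
  show False
  proof (cases "p > z\<^sub>S")
    case True
    then have "q > z\<^sub>S" using \<open>p > z\<^sub>S \<longleftrightarrow> q > z\<^sub>S\<close> by simp
    show False
    proof (rule contra)
      show "k = \<epsilon>\<^sub>1 - I (p / \<kappa>\<^sub>1) / \<kappa>\<^sub>1" using \<open>dH p = k\<close> True unfolding dH_eq by simp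
      show "k = \<epsilon>\<^sub>1 - I (q / \<kappa>\<^sub>1) / \<kappa>\<^sub>1" using \<open>dH q = k\<close> \<open>q > z\<^sub>S\<close> unfolding dH_eq by simp
    qed (use kap eps in auto)
  next
    case False
    then have "\<not> q > z\<^sub>S" using \<open>p > z\<^sub>S \<longleftrightarrow> q > z\<^sub>S\<close> by simp
    show False
    proof (rule contra)
      show "k = \<epsilon>\<^sub>2 - I (p / \<kappa>\<^sub>2) / \<kappa>\<^sub>2" using \<open>dH p = k\<close> False unfolding dH_eq by simp
      show "k = \<epsilon>\<^sub>2 - I (q / \<kappa>\<^sub>2) / \<kappa>\<^sub>2" using \<open>dH q = k\<close> \<open>\<not> q > z\<^sub>S\<close> unfolding dH_eq by simp
    qed (use kap' eps in auto)
  qed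
qed

lemma powr_ut_scaled_tendsto_0:
  assumes "0 < \<kappa>" "\<kappa> \<le> 1"
  shows "((\<lambda>x. x powr (- n\<^sub>2) * ut (x / \<kappa>)) \<longlongrightarrow> 0) (at_right 0)"
proof (rule tendsto_sandwich[OF _ _ powr_tendsto_0 powr_ut_tendsto_0])
  show "eventually (\<lambda>x. x powr (- n\<^sub>2) * u 0 \<le> x powr (- n\<^sub>2) * ut (x / \<kappa>)) (at_right 0)"
    using eventually_at_right_less[of "0 :: real"]
    by eventually_elim (use assms in \<open>auto intro!: mult_left_mono dual_utility_ge_u0\<close>)
  show "eventually (\<lambda>x. x powr (- n\<^sub>2) * ut (x / \<kappa>) \<le> x powr (- n\<^sub>2) * ut x) (at_right 0)"
    using eventually_at_right_less[of "0 :: real"]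
    by eventually_elim (use assms in \<open>auto intro!: mult_left_mono ut_antimono le_scaled\<close>)
qed

lemma powr_H_tendsto_0: "((\<lambda>x. x powr (- n\<^sub>2) * H x) \<longlongrightarrow> 0) (at_right 0)"
proof -
  have "((\<lambda>x. x powr (- n\<^sub>2) * ut (x / \<kappa>\<^sub>2) + x powr (- n\<^sub>2) * \<epsilon>\<^sub>2 * x) \<longlongrightarrow> 0 + 0 * 0) (at_right 0)"
    using kap' by (intro tendsto_add tendsto_mult powr_ut_scaled_tendsto_0 powr_tendsto_0 tendsto_ident_at) auto
  moreover have "eventually (\<lambda>x. x powr (- n\<^sub>2) * ut (x / \<kappa>\<^sub>2) + x powr (- n\<^sub>2) * \<epsilon>\<^sub>2 * x = x powr (- n\<^sub>2) * H x) (at_right 0)"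
    using zS by (intro eventually_at_rightI[of 0 z\<^sub>S]) (auto simp: H_def branch_def algebra_simps)
  ultimately show ?thesis by (simp add: tendsto_cong)
qed

lemma H_linear_growth:
  assumes "x \<ge> 1"
  shows "\<bar>H x\<bar> \<le> (\<bar>u 0\<bar> + \<bar>ut (1 / \<kappa>\<^sub>1)\<bar> + \<bar>ut (1 / \<kappa>\<^sub>2)\<bar> + \<epsilon>\<^sub>1) * x"
proof -
  let ?K = "\<bar>u 0\<bar> + \<bar>ut (1 / \<kappa>\<^sub>1)\<bar> + \<bar>ut (1 / \<kappa>\<^sub>2)\<bar>"
  have 1: "\<bar>ut (x / \<kappa>)\<bar> \<le> \<bar>u 0\<bar> + \<bar>ut (1 / \<kappa>)\<bar>" if "0 < \<kappa>" for \<kappa>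
    using assms that by (intro ut_abs_le divide_right_mono) auto
  have 2: "\<epsilon>\<^sub>2 * x \<le> \<epsilon>\<^sub>1 * x" "0 \<le> \<epsilon>\<^sub>2 * x" using eps assms by auto
  have "?K \<le> ?K * x" using mult_left_mono[of 1 x ?K] assms by simp
  moreover have "\<bar>H x\<bar> \<le> ?K + \<epsilon>\<^sub>1 * x"
    unfolding H_def branch_def using 1[OF kap(1)] 1[OF kap'(3)] 2 by (cases "x > z\<^sub>S") (simp; linarith)+
  ultimately show ?thesis by (simp add: algebra_simps)
qed

lemma dH_integrable:
  assumes "z > 0"
  shows "set_integrable lborel {0<..z} (\<lambda>x. x powr (- n\<^sub>2) * dH x)"
    and "set_integrable lborel {z<..} (\<lambda>x. x powr (- n\<^sub>1) * dH x)"
proof -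
  have if_distrib: "x powr p * dH x = (if x > z\<^sub>S then x powr p * (\<epsilon>\<^sub>1 - I (x / \<kappa>\<^sub>1) / \<kappa>\<^sub>1)
      else x powr p * (\<epsilon>\<^sub>2 - I (x / \<kappa>\<^sub>2) / \<kappa>\<^sub>2))" for x p
    by (simp add: dH_eq)
  have eq: "x powr p * (e - I (x / \<kappa>) / \<kappa>) = x powr p * e + - (x powr p * I (x / \<kappa>) / \<kappa>)" for x p e \<kappa>
    by (simp add: algebra_simps)
  have lower: "set_integrable lborel {0<..z} (\<lambda>x. x powr (- n\<^sub>2) * (e - I (x / \<kappa>) / \<kappa>))"
    if "0 < \<kappa>" "\<kappa> \<le> 1" for e \<kappa>
    unfolding eq using that n2 assms
    by (intro set_integral_add(1) set_integrable_minus set_integrable_divide set_integrable_mult_left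
        set_integrable_powr_lower integrable_I_scaled) auto
  have upper: "set_integrable lborel {z<..} (\<lambda>x. x powr (- n\<^sub>1) * (e - I (x / \<kappa>) / \<kappa>))"
    if "0 < \<kappa>" "\<kappa> \<le> 1" for e \<kappa>
    unfolding eq using that n1_gt_1 assms
    by (intro set_integral_add(1) set_integrable_minus set_integrable_divide set_integrable_mult_left
        set_integrable_powr_upper integrable_I_scaled) auto
  show "set_integrable lborel {0<..z} (\<lambda>x. x powr (- n\<^sub>2) * dH x)"
    unfolding if_distrib using kap kap' by (intro set_integrable_if lower) auto
  show "set_integrable lborel {z<..} (\<lambda>x. x powr (- n\<^sub>1) * dH x)"
    unfolding if_distrib using kap kap' by (intro set_integrable_if upper) auto
qed

text \<open>The integrals of \<open>\<phi>\<^sub>1\<close> and \<open>\<phi>\<^sub>2\<close> contain the derivative of \<open>H\<close>; integration by parts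
  turns them into values of \<open>up H\<close> and \<open>lo H\<close>.\<close>

lemma phi1_eq:
  assumes "z > 0"
  shows "phi1 n\<^sub>1 h (c_hat u \<kappa>\<^sub>1 \<kappa>\<^sub>2 z\<^sub>S) (eps_hat \<epsilon>\<^sub>1 \<epsilon>\<^sub>2 z\<^sub>S) y z
    = n\<^sub>1 * (up H z - up h y) - z powr (- n\<^sub>1) * H z"
proof -
  have "(LINT x:{z<..}|lborel. x powr (- n\<^sub>1) * dH x) = - (z powr (- n\<^sub>1) * H z) - (- n\<^sub>1) * up H z"
    by (rule integral_by_parts_to_infinity[OF _ continuous_on_H H_has_deriv isCont_dH dH_integrable(2) _
          powr_mult_tendsto_0_at_top[OF H_linear_growth] assms, of "{z\<^sub>S}"])
      (use admissible_H in \<open>auto simp: admissible_def\<close>)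
  then show ?thesis unfolding phi1_def dH_def[symmetric] by (simp add: algebra_simps)
qed

lemma phi2_eq:
  assumes "z > 0"
  shows "phi2 n\<^sub>2 h (c_hat u \<kappa>\<^sub>1 \<kappa>\<^sub>2 z\<^sub>S) (eps_hat \<epsilon>\<^sub>1 \<epsilon>\<^sub>2 z\<^sub>S) y z
    = n\<^sub>2 * (lo H z - lo h y) + z powr (- n\<^sub>2) * H z"
proof -
  have "(LINT x:{0<..z}|lborel. x powr (- n\<^sub>2) * dH x) = z powr (- n\<^sub>2) * H z - (- n\<^sub>2) * lo H z"
    by (rule integral_by_parts_from_0[OF _ continuous_on_H H_has_deriv isCont_dH dH_integrable(1) _
          powr_H_tendsto_0 assms, of "{z\<^sub>S}"])
      (use admissible_H in \<open>auto simp: admissible_def\<close>)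
  then show ?thesis unfolding phi2_def dH_def[symmetric] by (simp add: algebra_simps)
qed

end

section \<open>The candidate value function and its free boundaries\<close>

locale retirement_pair = retirement_choice +
  fixes z\<^sub>R z\<^sub>B :: real
  assumes zR: "0 < z\<^sub>R" "z\<^sub>R < zhat" and zB: "z\<^sub>R < z\<^sub>B"
    and phi1_0: "phi1 n\<^sub>1 h (c_hat u \<kappa>\<^sub>1 \<kappa>\<^sub>2 z\<^sub>S) (eps_hat \<epsilon>\<^sub>1 \<epsilon>\<^sub>2 z\<^sub>S) z\<^sub>R z\<^sub>B = 0"
    and phi2_0: "phi2 n\<^sub>2 h (c_hat u \<kappa>\<^sub>1 \<kappa>\<^sub>2 z\<^sub>S) (eps_hat \<epsilon>\<^sub>1 \<epsilon>\<^sub>2 z\<^sub>S) z\<^sub>R z\<^sub>B = 0"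
begin

text \<open>\<open>A\<close> and \<open>B\<close> are the constants \<open>E\<^sub>1\<close> and \<open>E\<^sub>2\<close>, and \<open>q\<close> is the middle piece of \<open>\<Q>\<close>.\<close>

definition A :: real where "A = - C * up h z\<^sub>R"
definition B :: real where "B = - C * lo h z\<^sub>R"

abbreviation q :: "real \<Rightarrow> real" where "q \<equiv> sol A B H"
abbreviation q1 :: "real \<Rightarrow> real" where "q1 \<equiv> sol1 A B H"
abbreviation q2 :: "real \<Rightarrow> real" where "q2 \<equiv> sol2 A B H"

abbreviation J :: "real \<Rightarrow> real" where "J \<equiv> sol 0 0 ut"
abbreviation J1 :: "real \<Rightarrow> real" where "J1 \<equiv> sol1 0 0 ut"
abbreviation J2 :: "real \<Rightarrow> real" where "J2 \<equiv> sol2 0 0 ut"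

lemma zB_pos: "z\<^sub>B > 0" using zR zB by simp

lemma Q_mid_eq: "z > 0 \<Longrightarrow> Q_mid \<theta> n\<^sub>1 n\<^sub>2 u h z\<^sub>R z = q z"
  unfolding Q_mid_def E1_def E2_def Psi_h_def J_R_def green_potential_eq_sol C_def[symmetric]
    sol_def A_def B_def lo_H up_H
  by (simp add: algebra_simps)

text \<open>The difference \<open>q - J\<close> solves \<open>L W = - h\<close> with vanishing Cauchy data at \<open>z\<^sub>R\<close>.\<close>

lemma q_minus_J:
  assumes "z > 0"
  shows "q z - J z = sol A B h z" "q1 z - J1 z = sol1 A B h z" "q2 z - J2 z = sol2 A B h z"
proof -
  have split: "A + C * up H z = C * up ut z + (A + C * up h z)" "B + C * lo H z = C * lo ut z + (B + C * lo h z)"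
    using lo_H[OF assms] up_H[OF assms] by (simp_all add: distrib_left)
  show "q z - J z = sol A B h z"
    unfolding sol_def split by (simp add: distrib_right)
  show "q1 z - J1 z = sol1 A B h z"
    unfolding sol1_def split by (simp add: distrib_right add_divide_distrib)
  show "q2 z - J2 z = sol2 A B h z"
    unfolding sol2_def split h_eq
    by (simp add: distrib_right right_diff_distrib add_divide_distrib diff_divide_distrib)
qed

lemma coeffs_zR: "A + C * up h z\<^sub>R = 0" "B + C * lo h z\<^sub>R = 0"
  unfolding A_def B_def by simp_all

text \<open>Value and slope fit smoothly at \<open>z\<^sub>R\<close>. The second derivative jumps up because \<open>h z\<^sub>R < 0\<close>; this is
  the inequality that starts the convexity argument.\<close>

lemma at_zR: "q z\<^sub>R = J z\<^sub>R" "q1 z\<^sub>R = J1 z\<^sub>R" "J2 z\<^sub>R < q2 z\<^sub>R"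
proof -
  show "q z\<^sub>R = J z\<^sub>R" "q1 z\<^sub>R = J1 z\<^sub>R"
    using q_minus_J[OF zR(1)] by (simp_all add: sol_def sol1_def coeffs_zR)
  have "C * (n\<^sub>1 - n\<^sub>2) * h z\<^sub>R < 0"
    using C_pos n1 n2 h_sign(1)[OF zR] by (intro mult_pos_neg) auto
  then have "sol2 A B h z\<^sub>R > 0"
    unfolding sol2_def coeffs_zR using zR by (simp add: divide_neg_pos)
  then show "J2 z\<^sub>R < q2 z\<^sub>R" using q_minus_J(3)[OF zR(1)] by simp
qed

text \<open>\<open>\<phi>\<^sub>1 = \<phi>\<^sub>2 = 0\<close> prescribes both coefficients of \<open>q\<close> at \<open>z\<^sub>B\<close>, namely those for which
  the first two derivatives vanish.\<close>

lemma at_zB: "q1 z\<^sub>B = 0" "q2 z\<^sub>B = 0" "\<delta> * q z\<^sub>B = H z\<^sub>B"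
proof -
  let ?P = "z\<^sub>B powr n\<^sub>1" and ?R = "z\<^sub>B powr n\<^sub>2"
  have "n\<^sub>1 * (up H z\<^sub>B - up h z\<^sub>R) = H z\<^sub>B / ?P"
    using phi1_0 unfolding phi1_eq[OF zB_pos] by (simp add: powr_minus divide_inverse mult.commute)
  moreover have "n\<^sub>2 * (lo H z\<^sub>B - lo h z\<^sub>R) = - (H z\<^sub>B / ?R)"
    using phi2_0 unfolding phi2_eq[OF zB_pos] by (simp add: powr_minus divide_inverse mult.commute)
  moreover have "n\<^sub>1 * (A + C * up H z\<^sub>B) = C * (n\<^sub>1 * (up H z\<^sub>B - up h z\<^sub>R))"
    "n\<^sub>2 * (B + C * lo H z\<^sub>B) = C * (n\<^sub>2 * (lo H z\<^sub>B - lo h z\<^sub>R))"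
    unfolding A_def B_def by (simp_all add: algebra_simps)
  ultimately have c: "(A + C * up H z\<^sub>B) * n\<^sub>1 * ?P = C * H z\<^sub>B" "(B + C * lo H z\<^sub>B) * n\<^sub>2 * ?R = - (C * H z\<^sub>B)"
    using zB_pos by (simp_all add: mult.commute)
  have "z\<^sub>B * q1 z\<^sub>B = (A + C * up H z\<^sub>B) * n\<^sub>1 * ?P + (B + C * lo H z\<^sub>B) * n\<^sub>2 * ?R"
    using zB_pos unfolding sol1_def by simp
  then show "q1 z\<^sub>B = 0" unfolding c using zB_pos by simp
  have "z\<^sub>B\<^sup>2 * q2 z\<^sub>B = ((A + C * up H z\<^sub>B) * n\<^sub>1 * ?P) * (n\<^sub>1 - 1)
      + ((B + C * lo H z\<^sub>B) * n\<^sub>2 * ?R) * (n\<^sub>2 - 1) - C * (n\<^sub>1 - n\<^sub>2) * H z\<^sub>B"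
    using zB_pos unfolding sol2_def by simp
  also have "\<dots> = 0" unfolding c by (simp add: algebra_simps)
  finally show "q2 z\<^sub>B = 0" using zB_pos by simp
  then show "\<delta> * q z\<^sub>B = H z\<^sub>B"
    using sol_ode[OF admissible_H zB_pos, of A B] \<open>q1 z\<^sub>B = 0\<close> by simp
qed

sublocale ode: convex_forcing_ode "\<theta>\<^sup>2 / 2" "\<delta> - r" \<delta> z\<^sub>R z\<^sub>B H q q1 q2
proof
  show "0 < \<theta>\<^sup>2 / 2" using \<theta> by simp
  show "0 < q2 z\<^sub>R" using at_zR(3) J_deriv2_pos[OF zR(1)] by simp
qed (use r zR zB convex_on_H at_zB sol_ode[OF admissible_H] sol_has_deriv[OF admissible_H]
    sol1_has_deriv[OF admissible_H] continuous_on_sol2[OF admissible_H] in simp_all)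

lemma q1_strict_mono: "z\<^sub>R \<le> x \<Longrightarrow> x < y \<Longrightarrow> y \<le> z\<^sub>B \<Longrightarrow> q1 x < q1 y"
proof (rule ode.q1_strict_mono)
  show False if "z\<^sub>R \<le> x" "x < y" "y \<le> z\<^sub>B" "k \<le> 0"
    "\<And>z. x < z \<Longrightarrow> z < y \<Longrightarrow> (H has_real_derivative k) (at z)" for x y k
    using that zR by (intro H_not_affine_decreasing[of x y k]) auto
qed

lemma H_zB_le: "z\<^sub>B \<le> z \<Longrightarrow> H z\<^sub>B \<le> H z"
  by (rule ode.H_end_le)

text \<open>On \<open>(z\<^sub>R, zhat]\<close> the sign of \<open>h\<close> determines that of \<open>q - J\<close>: after division by
  \<open>z powr n\<^sub>2\<close>, only the coefficient of \<open>z powr n\<^sub>1\<close> contributes to the derivative.\<close>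

lemma q_gt_J_up_to_zhat:
  assumes "z\<^sub>R < z" "z \<le> zhat"
  shows "J z < q z"
proof -
  let ?a = "\<lambda>z. A + C * up h z" and ?b = "\<lambda>z. B + C * lo h z"
  have da: "(?a has_real_derivative C * - (inverse (x powr n\<^sub>1) / x * h x)) (at x)" if "x > 0" for x
    using DERIV_add[OF DERIV_const DERIV_cmult[OF up_has_deriv[OF admissible_h that]]] by fastforce
  have db: "(?b has_real_derivative C * (inverse (x powr n\<^sub>2) / x * h x)) (at x)" if "x > 0" for x
    using DERIV_add[OF DERIV_const DERIV_cmult[OF lo_has_deriv[OF admissible_h that]]] by fastforce
  have a_pos: "?a x > 0" if "z\<^sub>R < x" "x \<le> zhat" for x
  proof -
    have "?a z\<^sub>R < ?a x"
    proof (rule DERIV_pos_imp_increasing_open[OF \<open>z\<^sub>R < x\<close>])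
      fix w assume w: "z\<^sub>R < w" "w < x"
      then have "w > 0" "h w < 0" using zR that h_sign(1)[of w] by auto
      then have "C * - (inverse (w powr n\<^sub>1) / w * h w) > 0"
        using C_pos by (intro mult_pos_pos) (auto intro!: divide_neg_pos mult_pos_neg)
      then show "\<exists>l. (?a has_real_derivative l) (at w) \<and> 0 < l" using da[OF \<open>w > 0\<close>] by blast
    next
      show "continuous_on {z\<^sub>R..x} ?a"
        using DERIV_isCont[OF da] zR by (intro continuous_at_imp_continuous_on ballI) simp
    qed
    then show ?thesis using coeffs_zR by simp
  qed
  let ?w = "\<lambda>z. ?a z * z powr (n\<^sub>1 - n\<^sub>2) + ?b z"
  have dw: "(?w has_real_derivative (n\<^sub>1 - n\<^sub>2) * x powr (n\<^sub>1 - n\<^sub>2 - 1) * ?a x) (at x)" if "x > 0" for x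
  proof -
    have "(?w has_real_derivative (C * - (inverse (x powr n\<^sub>1) / x * h x)) * x powr (n\<^sub>1 - n\<^sub>2)
        + (n\<^sub>1 - n\<^sub>2) * x powr (n\<^sub>1 - n\<^sub>2 - 1) * ?a x + C * (inverse (x powr n\<^sub>2) / x * h x)) (at x)"
      by (intro DERIV_add DERIV_mult da db has_real_derivative_powr that)
    moreover have "inverse (x powr n\<^sub>1) * x powr (n\<^sub>1 - n\<^sub>2) = inverse (x powr n\<^sub>2)"
      using that by (simp add: powr_diff field_simps)
    then have "(C * - (inverse (x powr n\<^sub>1) / x * h x)) * x powr (n\<^sub>1 - n\<^sub>2) = - (C * (inverse (x powr n\<^sub>2) / x * h x))"
      by (simp add: divide_inverse mult_ac)
    then have "(C * - (inverse (x powr n\<^sub>1) / x * h x)) * x powr (n\<^sub>1 - n\<^sub>2)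
        + (n\<^sub>1 - n\<^sub>2) * x powr (n\<^sub>1 - n\<^sub>2 - 1) * ?a x + C * (inverse (x powr n\<^sub>2) / x * h x)
        = (n\<^sub>1 - n\<^sub>2) * x powr (n\<^sub>1 - n\<^sub>2 - 1) * ?a x"
      by linarith
    ultimately show ?thesis by metis
  qed
  have "?w z\<^sub>R < ?w z"
  proof (rule DERIV_pos_imp_increasing_open[OF assms(1)])
    fix x assume x: "z\<^sub>R < x" "x < z"
    then have "x > 0" "?a x > 0" using zR assms a_pos[of x] by auto
    then have "(n\<^sub>1 - n\<^sub>2) * x powr (n\<^sub>1 - n\<^sub>2 - 1) * ?a x > 0"
      using n1 n2 by (intro mult_pos_pos) auto
    then show "\<exists>l. (?w has_real_derivative l) (at x) \<and> 0 < l" using dw[OF \<open>x > 0\<close>] by blast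
  next
    show "continuous_on {z\<^sub>R..z} ?w"
      using DERIV_isCont[OF dw] zR by (intro continuous_at_imp_continuous_on ballI) simp
  qed
  then have "0 < ?w z" using coeffs_zR by simp
  then have "0 < z powr n\<^sub>2 * ?w z" using assms zR by simp
  also have "\<dots> = sol A B h z"
    using assms zR unfolding sol_def by (simp add: powr_diff algebra_simps)
  finally show ?thesis using q_minus_J(1)[of z] assms zR by simp
qed

text \<open>Beyond \<open>zhat\<close> the sign of \<open>h\<close> makes \<open>q - J\<close> a supersolution, positive at \<open>zhat\<close> and with
  derivative \<open>- J1 z\<^sub>B > 0\<close> at \<open>z\<^sub>B\<close>, and the minimum principle applies.\<close>

lemma q_gt_J:
  assumes "z\<^sub>R < z" "z \<le> z\<^sub>B"
  shows "J z < q z"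
proof (cases "z \<le> zhat")
  case True
  then show ?thesis using q_gt_J_up_to_zhat assms by simp
next
  case False
  let ?W = "sol A B h" and ?W1 = "sol1 A B h" and ?W2 = "sol2 A B h"
  have "?W z > 0"
  proof (rule positive_by_minimum_principle[of zhat z\<^sub>B ?W ?W1 ?W2])
    show "zhat < z\<^sub>B" "zhat \<le> z" "z \<le> z\<^sub>B" using False assms by auto
    show "0 < ?W zhat" using q_gt_J_up_to_zhat[of zhat] q_minus_J(1)[of zhat] zR by simp
    show "0 < ?W1 z\<^sub>B" using q_minus_J(2)[OF zB_pos] at_zB(1) J_deriv_le(2)[OF zB_pos] by simp
    show "(?W has_real_derivative ?W1 x) (at x)" "(?W1 has_real_derivative ?W2 x) (at x)"
      if "zhat \<le> x" for x
      using sol_has_deriv[OF admissible_h] sol1_has_deriv[OF admissible_h] that zR by simp_all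
    show "?W2 x < 0" if "zhat < x" "?W x \<le> 0" "?W1 x = 0" for x
    proof -
      have "x > 0" using that zR by simp
      have "\<theta>\<^sup>2 / 2 * x\<^sup>2 * ?W2 x = \<delta> * ?W x - h x"
        using sol_ode[OF admissible_h \<open>x > 0\<close>, of A B] that by simp
      also have "\<dots> < 0"
        using h_sign(2)[OF \<open>x > 0\<close> that(1)] mult_nonneg_nonpos[of \<delta> "?W x"] that \<delta> by simp
      finally show ?thesis using \<theta> \<open>x > 0\<close> by (simp add: mult_less_0_iff)
    qed
  qed
  then show ?thesis using q_minus_J(1)[of z] assms zR by simp
qed

definition Q :: "real \<Rightarrow> real" where
  "Q z = (if z \<le> z\<^sub>R then J z else if z \<le> z\<^sub>B then q z else q z\<^sub>B)"

definition Q1 :: "real \<Rightarrow> real" where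
  "Q1 z = (if z \<le> z\<^sub>R then J1 z else if z \<le> z\<^sub>B then q1 z else 0)"

definition Q2 :: "real \<Rightarrow> real" where
  "Q2 z = (if z \<le> z\<^sub>R then J2 z else if z \<le> z\<^sub>B then q2 z else 0)"

lemma Q_fun_eq: "Q_fun \<theta> n\<^sub>1 n\<^sub>2 u h z\<^sub>R z\<^sub>B z = Q z"
  unfolding Q_fun_def Q_def using zR zB
  by (auto simp: Q_mid_eq J_R_def green_potential_eq_sol)

lemma Q_has_deriv: "z > 0 \<Longrightarrow> (Q has_real_derivative Q1 z) (at z)"
  unfolding Q_def[abs_def] Q1_def
  by (intro glue_has_deriv[OF sol_has_deriv[OF admissible_dual_utility]]
      glue_has_deriv[OF sol_has_deriv[OF admissible_H] DERIV_const])
    (use zB at_zR at_zB in auto)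

lemma Q1_has_deriv: "z > 0 \<Longrightarrow> z \<noteq> z\<^sub>R \<Longrightarrow> (Q1 has_real_derivative Q2 z) (at z)"
  unfolding Q1_def[abs_def] Q2_def
  by (intro glue_has_deriv[OF sol1_has_deriv[OF admissible_dual_utility]]
      glue_has_deriv[OF sol1_has_deriv[OF admissible_H] DERIV_const])
    (use zB at_zR at_zB in auto)

lemma isCont_Q1:
  assumes "z > 0" shows "isCont Q1 z"
proof -
  have c: "continuous_on {0<..} (sol1 a b F)" if "admissible F" for a b F
    using DERIV_isCont[OF sol1_has_deriv[OF that]] by (intro continuous_at_imp_continuous_on ballI) simp
  have s: "continuous_on {z \<in> {0<..}. P z} f" if "continuous_on {0<..} f" for P and f :: "real \<Rightarrow> real"
    by (rule continuous_on_subset[OF that]) auto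
  have "continuous_on {0<..} (\<lambda>z. if z \<le> z\<^sub>B then q1 z else 0)"
    by (intro continuous_on_cases_le s c admissible_H continuous_on_id continuous_on_const) (use at_zB in auto)
  note right = this
  have "continuous_on {0<..} Q1"
    unfolding Q1_def[abs_def]
    by (rule continuous_on_cases_le[OF s[OF c[OF admissible_dual_utility]] s[OF right] continuous_on_id])
      (use at_zR zB in auto)
  then show ?thesis using assms by (simp add: continuous_on_eq_continuous_at)
qed

lemma continuous_on_Q2: "continuous_on ({0<..} - {z\<^sub>R}) Q2"
proof -
  have s: "continuous_on {z \<in> {z\<^sub>R<..}. P z} f" if "continuous_on {0<..} f" for P and f :: "real \<Rightarrow> real"
    by (rule continuous_on_subset[OF that]) (use zR in auto)
  have "continuous_on {z\<^sub>R<..} (\<lambda>z. if z \<le> z\<^sub>B then q2 z else 0)"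
    by (intro continuous_on_cases_le s continuous_on_sol2 admissible_H continuous_on_id continuous_on_const)
      (use at_zB in auto)
  then have 1: "continuous_on {z\<^sub>R<..} Q2"
    by (rule continuous_on_eq) (simp add: Q2_def)
  have 2: "continuous_on {0<..<z\<^sub>R} Q2"
    by (rule continuous_on_eq[OF continuous_on_subset[OF continuous_on_sol2[OF admissible_dual_utility]]])
      (auto simp: Q2_def)
  have "{0<..} - {z\<^sub>R} = {0<..<z\<^sub>R} \<union> {z\<^sub>R<..}" using zR by auto
  then show ?thesis using continuous_on_open_Un[OF _ _ 2 1] by simp
qed

lemma deriv_Q: "z > 0 \<Longrightarrow> deriv Q z = Q1 z"
  by (rule DERIV_imp_deriv[OF Q_has_deriv])

lemma deriv_Q_has_deriv:
  assumes "z > 0" "z \<noteq> z\<^sub>R" shows "(deriv Q has_real_derivative Q2 z) (at z)"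
  by (rule has_field_derivative_transform_within_open[OF Q1_has_deriv[OF assms], where S = "{0<..}"])
    (use assms deriv_Q in auto)

lemma deriv_Q_has_left_deriv: "(deriv Q has_vector_derivative J2 z\<^sub>R) (at_left z\<^sub>R)"
proof -
  have "(deriv Q has_vector_derivative J2 z\<^sub>R) (at z\<^sub>R within {..z\<^sub>R})"
  proof (rule has_vector_derivative_transform_within[where d = z\<^sub>R and f = J1])
    show "(J1 has_vector_derivative J2 z\<^sub>R) (at z\<^sub>R within {..z\<^sub>R})"
      using sol1_has_deriv[OF admissible_dual_utility zR(1)]
      by (simp add: has_real_derivative_iff_has_vector_derivative has_vector_derivative_at_within)
    show "J1 z = deriv Q z" if "z \<in> {..z\<^sub>R}" "dist z z\<^sub>R < z\<^sub>R" for z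
      using that by (simp add: deriv_Q dist_real_def Q1_def)
  qed (use zR in auto)
  then show ?thesis by (rule has_vector_derivative_within_subset) auto
qed

lemma second_deriv_Q:
  assumes "z > 0" shows "second_deriv_left_at z\<^sub>R Q z = Q2 z"
proof (cases "z = z\<^sub>R")
  case True
  then show ?thesis
    using vector_derivative_within[OF _ deriv_Q_has_left_deriv]
    by (simp add: second_deriv_left_at_def Q2_def)
next
  case False
  then show ?thesis
    using DERIV_imp_deriv[OF deriv_Q_has_deriv[OF assms False]] by (simp add: second_deriv_left_at_def)
qed

text \<open>\<open>L Q\<close> is \<open>- ut\<close> on the first piece, \<open>- H\<close> on the second, and \<open>- \<delta> q z\<^sub>B = - H z\<^sub>B\<close> on the third.\<close>

lemma L_op_Q:
  assumes "z > 0"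
  shows "L_op \<theta> \<delta> r z\<^sub>R Q z + H z = (if z \<le> z\<^sub>R then h z else if z \<le> z\<^sub>B then 0 else H z - H z\<^sub>B)"
  using sol_ode[OF admissible_dual_utility assms, of 0 0] sol_ode[OF admissible_H assms, of A B] at_zB(3)
  unfolding L_op_def second_deriv_Q[OF assms] deriv_Q[OF assms] Q_def Q1_def Q2_def h_eq by auto

lemma Q_minus_J:
  assumes "z > 0"
  shows "z \<le> z\<^sub>R \<Longrightarrow> Q z = J z" and "z\<^sub>R < z \<Longrightarrow> J z < Q z"
proof -
  show "z \<le> z\<^sub>R \<Longrightarrow> Q z = J z" by (simp add: Q_def)
  show "J z < Q z" if "z\<^sub>R < z"
  proof (cases "z \<le> z\<^sub>B")
    case True
    then show ?thesis using q_gt_J that by (simp add: Q_def)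
  next
    case False
    have "J z < J z\<^sub>B"
    proof (rule DERIV_neg_imp_decreasing[of z\<^sub>B z J])
      fix x assume "z\<^sub>B \<le> x"
      then have "x > 0" using zB_pos by simp
      then show "\<exists>l. (J has_real_derivative l) (at x) \<and> l < 0"
        using sol_has_deriv[OF admissible_dual_utility] J_deriv_le(2) by blast
    qed (use False in simp)
    also have "J z\<^sub>B < q z\<^sub>B" using q_gt_J zB by simp
    finally show ?thesis using False that by (simp add: Q_def)
  qed
qed

lemma Q1_strict_mono:
  assumes "0 < x" "x < y" "y \<le> z\<^sub>B" shows "Q1 x < Q1 y"
proof -
  have J1: "J1 x < J1 y" if "0 < x" "x < y" for x y
  proof (rule DERIV_pos_imp_increasing[OF \<open>x < y\<close>])
    fix w assume "x \<le> w"
    then have "w > 0" using that by simp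
    then show "\<exists>l. (J1 has_real_derivative l) (at w) \<and> 0 < l"
      using sol1_has_deriv[OF admissible_dual_utility] J_deriv2_pos by blast
  qed
  consider "y \<le> z\<^sub>R" | "x \<le> z\<^sub>R" "z\<^sub>R < y" | "z\<^sub>R < x" by linarith
  then show ?thesis
  proof cases
    case 1
    then show ?thesis using J1[of x y] assms by (simp add: Q1_def)
  next
    case 2
    have "J1 x \<le> J1 z\<^sub>R" using J1[of x z\<^sub>R] assms 2 by (cases "x = z\<^sub>R") auto
    also have "\<dots> < q1 y" using at_zR(2) q1_strict_mono[of z\<^sub>R y] assms 2 by simp
    finally show ?thesis using 2 assms by (simp add: Q1_def)
  next
    case 3
    then show ?thesis using q1_strict_mono[of x y] assms by (simp add: Q1_def)
  qed
qed

lemma Q1_sign: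
  assumes "z > 0" shows "z < z\<^sub>B \<Longrightarrow> Q1 z < 0" and "z\<^sub>B \<le> z \<Longrightarrow> Q1 z = 0"
proof -
  have "Q1 z\<^sub>B = 0" using zB at_zB by (simp add: Q1_def)
  then show "z < z\<^sub>B \<Longrightarrow> Q1 z < 0" using Q1_strict_mono[of z z\<^sub>B] assms by simp
  show "z\<^sub>B \<le> z \<Longrightarrow> Q1 z = 0"
    using \<open>Q1 z\<^sub>B = 0\<close> zB by (cases "z = z\<^sub>B") (auto simp: Q1_def)
qed

lemma variational_inequality:
  assumes "z > 0"
  shows "max (min (L_op \<theta> \<delta> r z\<^sub>R Q z + H z) (- deriv Q z)) (J z - Q z) = 0"
proof -
  consider "z \<le> z\<^sub>R" | "z\<^sub>R < z" "z \<le> z\<^sub>B" | "z\<^sub>B < z" by linarith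
  then show ?thesis
  proof cases
    case 1
    then have "h z < 0" using h_sign(1)[OF assms] zR by simp
    then show ?thesis using 1 Q_minus_J(1)[OF assms] L_op_Q[OF assms] by simp
  next
    case 2
    have "Q1 z \<le> 0" using Q1_sign[OF assms] 2 by (cases "z = z\<^sub>B") auto
    then show ?thesis
      using 2 Q_minus_J(2)[OF assms] L_op_Q[OF assms] deriv_Q[OF assms] by simp
  next
    case 3
    then have "H z\<^sub>B \<le> H z" "Q1 z = 0" using H_zB_le Q1_sign[OF assms] by auto
    then show ?thesis
      using 3 zB Q_minus_J(2)[OF assms] L_op_Q[OF assms] deriv_Q[OF assms] by simp
  qed
qed

lemma Q_C1: "Q C1_differentiable_on {0<..}"
  unfolding C1_differentiable_on_def
  using Q_has_deriv isCont_Q1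
  by (intro exI[of _ Q1])
    (auto simp: has_real_derivative_iff_has_vector_derivative[symmetric] intro: continuous_at_imp_continuous_on)

lemma deriv_Q_C1: "deriv Q C1_differentiable_on ({0<..} - {z\<^sub>R})"
  unfolding C1_differentiable_on_def
  using deriv_Q_has_deriv continuous_on_Q2
  by (intro exI[of _ Q2]) (auto simp: has_real_derivative_iff_has_vector_derivative[symmetric])

lemma deriv_Q_left_differentiable: "deriv Q differentiable (at_left z\<^sub>R)"
  using deriv_Q_has_left_deriv unfolding has_vector_derivative_def differentiable_def by blast

lemma strictly_convex_Q: "strictly_convex_on {0<..<z\<^sub>B} Q"
  by (rule strictly_convex_on_of_deriv_strict_mono[OF Q_has_deriv Q1_strict_mono]) auto

lemma deriv_Q_at_left_zB: "(deriv Q \<longlongrightarrow> 0) (at_left z\<^sub>B)"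
proof -
  have "(Q1 \<longlongrightarrow> Q1 z\<^sub>B) (at_left z\<^sub>B)"
    using isCont_Q1[OF zB_pos] unfolding isCont_def by (simp add: filterlim_at_split)
  moreover have "Q1 z\<^sub>B = 0" using Q1_sign(2)[OF zB_pos] by simp
  moreover have "eventually (\<lambda>z. Q1 z = deriv Q z) (at_left z\<^sub>B)"
    using zB_pos by (intro eventually_at_leftI[of 0]) (auto simp: deriv_Q)
  ultimately show ?thesis using Lim_transform_eventually by force
qed

lemma deriv_Q_at_0: "filterlim (deriv Q) at_bot (at_right 0)"
proof -
  have "eventually (\<lambda>z. deriv Q z = J1 z) (at_right 0)"
    using zR by (intro eventually_at_rightI[of 0 z\<^sub>R]) (auto simp: deriv_Q Q1_def)
  then show ?thesis using J_deriv_at_0 filterlim_cong[OF refl refl] by blast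
qed

lemma quasi_variational_solution:
  fixes Q J :: "real \<Rightarrow> real"
  assumes Q_eq: "Q = Q_fun \<theta> n\<^sub>1 n\<^sub>2 u h z\<^sub>R z\<^sub>B" and J_eq: "J = J_R \<theta> n\<^sub>1 n\<^sub>2 u"
  shows "(\<forall>z>0. max (min (L_op \<theta> \<delta> r z\<^sub>R Q z
                       + (if z > z\<^sub>S then ut (z / \<kappa>\<^sub>1) + \<epsilon>\<^sub>1 * z else 0)
                       + (if z \<le> z\<^sub>S then ut (z / \<kappa>\<^sub>2) + \<epsilon>\<^sub>2 * z else 0))
                     (- deriv Q z))
                (J z - Q z) = 0)
     \<and> Q C1_differentiable_on {0<..}
     \<and> deriv Q C1_differentiable_on ({0<..} - {z\<^sub>R})
     \<and> deriv Q differentiable (at_left z\<^sub>R)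
     \<and> {z. z > 0 \<and> Q z = J z} = {z. z > 0 \<and> z \<le> z\<^sub>R}
     \<and> {z. z > 0 \<and> Q z > J z} = {z. z > 0 \<and> z > z\<^sub>R}
     \<and> {z. z > 0 \<and> deriv Q z = 0} = {z. z > 0 \<and> z \<ge> z\<^sub>B}
     \<and> {z. z > 0 \<and> deriv Q z < 0} = {z. 0 < z \<and> z < z\<^sub>B}
     \<and> strictly_convex_on {0<..<z\<^sub>B} Q
     \<and> (deriv Q \<longlongrightarrow> 0) (at_left z\<^sub>B)
     \<and> filterlim (deriv Q) at_bot (at_right 0)"
proof -
  have Q: "Q = local.Q" unfolding Q_eq by (rule ext) (rule Q_fun_eq)
  have J: "J = sol 0 0 ut" unfolding J_eq by (rule ext) (simp add: J_R_def green_potential_eq_sol)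
  have H: "x + (if z > z\<^sub>S then ut (z / \<kappa>\<^sub>1) + \<epsilon>\<^sub>1 * z else 0) + (if z \<le> z\<^sub>S then ut (z / \<kappa>\<^sub>2) + \<epsilon>\<^sub>2 * z else 0)
      = x + H z" for x z
    by (simp add: H_def branch_def)
  have sets: "local.Q z = local.J z \<longleftrightarrow> z \<le> z\<^sub>R" "local.J z < local.Q z \<longleftrightarrow> z\<^sub>R < z"
    "deriv local.Q z = 0 \<longleftrightarrow> z\<^sub>B \<le> z" "deriv local.Q z < 0 \<longleftrightarrow> z < z\<^sub>B" if "z > 0" for z
    using Q_minus_J[OF that] Q1_sign[OF that] deriv_Q[OF that]
    by (cases "z \<le> z\<^sub>R"; cases "z < z\<^sub>B"; force)+
  show ?thesis
    unfolding Q J H using variational_inequality sets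
    by (intro conjI Q_C1 deriv_Q_C1 deriv_Q_left_differentiable strictly_convex_Q
        deriv_Q_at_left_zB deriv_Q_at_0) auto
qed

end

theorem proposition4p2:
  fixes \<delta> r \<mu> \<sigma> \<theta> \<epsilon>\<^sub>1 \<epsilon>\<^sub>2 \<kappa>\<^sub>1 \<kappa>\<^sub>2 n\<^sub>1 n\<^sub>2 z\<^sub>S zhat z\<^sub>R z\<^sub>B :: real
    and u ut h J Q :: "real \<Rightarrow> real"
    and \<phi>\<^sub>1 \<phi>\<^sub>2 :: "real \<Rightarrow> real \<Rightarrow> real"
  assumes params: "\<delta> > 0" "r > 0" "\<mu> > r" "\<sigma> > 0" "\<theta> = (\<mu> - r) / \<sigma>"
      "0 < \<epsilon>\<^sub>2" "\<epsilon>\<^sub>2 < \<epsilon>\<^sub>1" "0 < \<kappa>\<^sub>1" "\<kappa>\<^sub>1 < \<kappa>\<^sub>2" "\<kappa>\<^sub>2 < 1"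
    and roots: "n\<^sub>1 > 0" "0 > n\<^sub>2"
      "\<theta>\<^sup>2 / 2 * n\<^sub>1\<^sup>2 + (\<delta> - r - \<theta>\<^sup>2 / 2) * n\<^sub>1 - \<delta> = 0"
      "\<theta>\<^sup>2 / 2 * n\<^sub>2\<^sup>2 + (\<delta> - r - \<theta>\<^sup>2 / 2) * n\<^sub>2 - \<delta> = 0"
    and util: "utility u"
    and integrable_I:
      "\<And>y. y > 0 \<Longrightarrow> set_integrable lborel {0<..y} (\<lambda>\<eta>. \<eta> powr (- n\<^sub>2) * inv_marginal u \<eta>)"
    and ut_def: "ut = dual_utility u"
    and zS: "z\<^sub>S > 0" "switch_fun u \<kappa>\<^sub>1 \<kappa>\<^sub>2 \<epsilon>\<^sub>1 \<epsilon>\<^sub>2 z\<^sub>S = 0"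
    and zS_unique: "\<And>y. y > 0 \<Longrightarrow> switch_fun u \<kappa>\<^sub>1 \<kappa>\<^sub>2 \<epsilon>\<^sub>1 \<epsilon>\<^sub>2 y = 0 \<Longrightarrow> y = z\<^sub>S"
    and h_def: "h = h_fun u \<kappa>\<^sub>1 \<kappa>\<^sub>2 \<epsilon>\<^sub>1 \<epsilon>\<^sub>2 z\<^sub>S"
    and zhat: "zhat > 0" "h zhat = 0"
    and zhat_unique: "\<And>z. z > 0 \<Longrightarrow> h z = 0 \<Longrightarrow> z = zhat"
    and phi1_def: "\<phi>\<^sub>1 = phi1 n\<^sub>1 h (c_hat u \<kappa>\<^sub>1 \<kappa>\<^sub>2 z\<^sub>S) (eps_hat \<epsilon>\<^sub>1 \<epsilon>\<^sub>2 z\<^sub>S)"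
    and phi2_def: "\<phi>\<^sub>2 = phi2 n\<^sub>2 h (c_hat u \<kappa>\<^sub>1 \<kappa>\<^sub>2 z\<^sub>S) (eps_hat \<epsilon>\<^sub>1 \<epsilon>\<^sub>2 z\<^sub>S)"
    and pair: "0 < z\<^sub>R" "z\<^sub>R < zhat" "z\<^sub>B > z\<^sub>R" "\<phi>\<^sub>1 z\<^sub>R z\<^sub>B = 0" "\<phi>\<^sub>2 z\<^sub>R z\<^sub>B = 0"
    and pair_unique: "\<And>z\<^sub>1 z\<^sub>2. 0 < z\<^sub>1 \<Longrightarrow> z\<^sub>1 < zhat \<Longrightarrow> z\<^sub>2 > z\<^sub>1 \<Longrightarrow>
      \<phi>\<^sub>1 z\<^sub>1 z\<^sub>2 = 0 \<Longrightarrow> \<phi>\<^sub>2 z\<^sub>1 z\<^sub>2 = 0 \<Longrightarrow> z\<^sub>1 = z\<^sub>R \<and> z\<^sub>2 = z\<^sub>B"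
    and J_def: "J = J_R \<theta> n\<^sub>1 n\<^sub>2 u"
    and Q_def: "Q = Q_fun \<theta> n\<^sub>1 n\<^sub>2 u h z\<^sub>R z\<^sub>B"
  shows
    "(\<forall>z>0. max (min (L_op \<theta> \<delta> r z\<^sub>R Q z
                       + (if z > z\<^sub>S then ut (z / \<kappa>\<^sub>1) + \<epsilon>\<^sub>1 * z else 0)
                       + (if z \<le> z\<^sub>S then ut (z / \<kappa>\<^sub>2) + \<epsilon>\<^sub>2 * z else 0))
                     (- deriv Q z))
                (J z - Q z) = 0)
     \<and> Q C1_differentiable_on {0<..}
     \<and> deriv Q C1_differentiable_on ({0<..} - {z\<^sub>R})
     \<and> deriv Q differentiable (at_left z\<^sub>R)
     \<and> {z. z > 0 \<and> Q z = J z} = {z. z > 0 \<and> z \<le> z\<^sub>R}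
     \<and> {z. z > 0 \<and> Q z > J z} = {z. z > 0 \<and> z > z\<^sub>R}
     \<and> {z. z > 0 \<and> deriv Q z = 0} = {z. z > 0 \<and> z \<ge> z\<^sub>B}
     \<and> {z. z > 0 \<and> deriv Q z < 0} = {z. 0 < z \<and> z < z\<^sub>B}
     \<and> strictly_convex_on {0<..<z\<^sub>B} Q
     \<and> (deriv Q \<longlongrightarrow> 0) (at_left z\<^sub>B)
     \<and> filterlim (deriv Q) at_bot (at_right 0)"
proof -
  have "\<theta> \<noteq> 0" using params by simp
  have "utility_function u" by unfold_locales (rule util)
  moreover have "euler_operator \<theta> \<delta> r n\<^sub>1 n\<^sub>2"
    by unfold_locales (use \<open>\<theta> \<noteq> 0\<close> params roots in auto)
  ultimately have ret: "retirement u \<theta> \<delta> r n\<^sub>1 n\<^sub>2"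
    by (intro retirement.intro retirement_axioms.intro integrable_I)
  have choice: "retirement_choice u \<theta> \<delta> r n\<^sub>1 n\<^sub>2 \<kappa>\<^sub>1 \<kappa>\<^sub>2 \<epsilon>\<^sub>1 \<epsilon>\<^sub>2 z\<^sub>S zhat"
    by (rule retirement_choice.intro[OF ret], rule retirement_choice_axioms.intro)
      (fact params zS zS_unique zhat_unique[unfolded h_def])+
  have "retirement_pair u \<theta> \<delta> r n\<^sub>1 n\<^sub>2 \<kappa>\<^sub>1 \<kappa>\<^sub>2 \<epsilon>\<^sub>1 \<epsilon>\<^sub>2 z\<^sub>S zhat z\<^sub>R z\<^sub>B"
    by (rule retirement_pair.intro[OF choice], rule retirement_pair_axioms.intro)
      (fact pair pair(4)[unfolded phi1_def h_def] pair(5)[unfolded phi2_def h_def])+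
  from retirement_pair.quasi_variational_solution[OF this Q_def[unfolded h_def] J_def]
  show ?thesis unfolding ut_def .
qed

end
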